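(* Let $\mathcal V$ be a category with finite limits and let $T=(T,m,e)$ be a monad on $\mathcal V$ whose endofunctor $T$ preserves pullbacks. Let $p\colon x\to y$ be a functor of $T$-categories internal to $\mathcal V$. If - $p_1\colon x_1\to y_1$ is an effective descent morphism in $\mathcal V$, - $p_2\colon x_2\to y_2$ is a descent morphism in $\mathcal V$, and - $p_3\colon x_3\to y_3$ is an almost descent morphism in $\mathcal V$, then $p$ is an effective descent morphism in the category $\mathsf{Cat}(T,\mathcal V)$ of $T$-categories internal to $\mathcal V$.
   Context: A $T$-category $x$ internal to $\mathcal V$ consists of objects $x_0$ (objects) and $x_1$ (arrows), morphisms $d_1\colon x_1\to Tx_0$ (domain), $d_0\colon x_1\to x_0$ (codomain), $s_0\colon x_0\to x_1$ (identities) and $c\colon x_2\to x_1$ (composition), where $x_2$ (2-chains) is the pullback of $d_1\colon x_1\to Tx_0$ and $Td_0\colon Tx_1\to Tx_0$, with projections $\pi_0\colon x_2\to x_1$, $\pi_2\colon x_2\to Tx_1$; and $x_3$ (3-chains) is the pullback of $\pi_2\colon x_2\to Tx_1$ and $T\pi_0\colon Tx_2\to Tx_1$, with projections $\rho_0\colon x_3\to x_2$, $\rho_3\colon x_3\to Tx_2$. Axioms: $d_0s_0=\mathrm{id}$, $d_1s_0=e_{x_0}$, $d_0c=d_0\pi_0$, $d_1c=m_{x_0}\circ Td_1\circ\pi_2$; unit laws $c\circ(s_0d_0,\,e_{x_1})=\mathrm{id}$ and $c\circ(\mathrm{id},\,Ts_0\circ d_1)=\mathrm{id}$; associativity $c\circ(\pi_0\rho_0,\,Tc\circ\rho_3)=c\circ(c\circ\rho_0,\,m_{x_1}\circ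 T\pi_2\circ\rho_3)$. A functor $p\colon x\to y$ of $T$-categories is a pair $p_0\colon x_0\to y_0$, $p_1\colon x_1\to y_1$ with $d_0p_1=p_0d_0$, $d_1p_1=Tp_0\circ d_1$, $p_1s_0=s_0p_0$, $p_1c=c\,p_2$, where $p_2\colon x_2\to y_2$ is induced by $p_1,Tp_1$, and $p_3\colon x_3\to y_3$ is induced by $p_2,Tp_2$. Descent: for a category $\mathcal A$ with pullbacks and $q\colon e\to b$, let $q^*\colon\mathcal A/b\to\mathcal A/e$ be the pullback functor, $q_!\dashv q^*$, $T^q$ the induced monad, $\mathcal K^q\colon\mathcal A/b\to T^q\text{-}\mathsf{Alg}$ the Eilenberg–Moore comparison functor. $q$ is an almost descent, descent, or effective descent morphism if $\mathcal K^q$ is faithful, fully faithful, or an equivalence, respectively. (When $\mathcal A$ has finite limits: almost descent = pullback-stable epimorphism; descent = pullback-stable regular epimorphism.) *)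

theory Defs
  imports Main
begin

section \<open>Categories, functors, natural transformations\<close>

text \<open>
  A category is given by carrier sets of objects and arrows inside arbitrary types;
  \<open>g \<cdot>\<^bsub>C\<^esub> f\<close> is the composite "first \<open>f\<close>, then \<open>g\<close>".
\<close>

record ('o, 'a) cat =
  Obj :: "'o set"
  Arr :: "'a set"
  Dom :: "'a \<Rightarrow> 'o"
  Cod :: "'a \<Rightarrow> 'o"
  Idn :: "'o \<Rightarrow> 'a"
  Cmp :: "'a \<Rightarrow> 'a \<Rightarrow> 'a"  (infixr "\<cdot>\<index>" 75)

definition hom :: "('o, 'a) cat \<Rightarrow> 'o \<Rightarrow> 'o \<Rightarrow> 'a set" where
  "hom C X Y = {f \<in> Arr C. Dom C f = X \<and> Cod C f = Y}"

locale category =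
  fixes C :: "('o, 'a) cat" (structure)
  assumes Dom_in_Obj: "f \<in> Arr C \<Longrightarrow> Dom C f \<in> Obj C"
    and Cod_in_Obj: "f \<in> Arr C \<Longrightarrow> Cod C f \<in> Obj C"
    and Idn_in_hom: "X \<in> Obj C \<Longrightarrow> Idn C X \<in> hom C X X"
    and Cmp_in_hom: "f \<in> hom C X Y \<Longrightarrow> g \<in> hom C Y Z \<Longrightarrow> g \<cdot> f \<in> hom C X Z"
    and Cmp_Idn_right: "f \<in> hom C X Y \<Longrightarrow> f \<cdot> Idn C X = f"
    and Cmp_Idn_left: "f \<in> hom C X Y \<Longrightarrow> Idn C Y \<cdot> f = f"
    and Cmp_assoc: "f \<in> hom C W X \<Longrightarrow> g \<in> hom C X Y \<Longrightarrow> h \<in> hom C Y Z \<Longrightarrow>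
      (h \<cdot> g) \<cdot> f = h \<cdot> (g \<cdot> f)"

definition is_iso :: "('o, 'a) cat \<Rightarrow> 'a \<Rightarrow> bool" where
  "is_iso C f \<longleftrightarrow> f \<in> Arr C \<and>
    (\<exists>g \<in> hom C (Cod C f) (Dom C f).
      g \<cdot>\<^bsub>C\<^esub> f = Idn C (Dom C f) \<and> f \<cdot>\<^bsub>C\<^esub> g = Idn C (Cod C f))"

record ('o1, 'a1, 'o2, 'a2) cfun =
  omap :: "'o1 \<Rightarrow> 'o2"
  amap :: "'a1 \<Rightarrow> 'a2"

definition id_cfun :: "('o, 'a, 'o, 'a) cfun" where
  "id_cfun = \<lparr>omap = (\<lambda>X. X), amap = (\<lambda>f. f)\<rparr>"

definition comp_cfun ::
  "('o2, 'a2, 'o3, 'a3) cfun \<Rightarrow> ('o1, 'a1, 'o2, 'a2) cfun \<Rightarrow> ('o1, 'a1, 'o3, 'a3) cfun" where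
  "comp_cfun G F = \<lparr>omap = omap G \<circ> omap F, amap = amap G \<circ> amap F\<rparr>"

locale is_functor = C: category C + D: category D
  for C :: "('o1, 'a1) cat" and D :: "('o2, 'a2) cat" +
  fixes F :: "('o1, 'a1, 'o2, 'a2) cfun"
  assumes omap_in_Obj: "X \<in> Obj C \<Longrightarrow> omap F X \<in> Obj D"
    and amap_in_hom: "f \<in> hom C X Y \<Longrightarrow> amap F f \<in> hom D (omap F X) (omap F Y)"
    and amap_Idn: "X \<in> Obj C \<Longrightarrow> amap F (Idn C X) = Idn D (omap F X)"
    and amap_Cmp: "f \<in> hom C X Y \<Longrightarrow> g \<in> hom C Y Z \<Longrightarrow>
      amap F (g \<cdot>\<^bsub>C\<^esub> f) = amap F g \<cdot>\<^bsub>D\<^esub> amap F f"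

locale is_nat_trans = F: is_functor C D F + G: is_functor C D G
  for C :: "('o1, 'a1) cat" and D :: "('o2, 'a2) cat"
    and F G :: "('o1, 'a1, 'o2, 'a2) cfun" +
  fixes t :: "'o1 \<Rightarrow> 'a2"
  assumes component: "X \<in> Obj C \<Longrightarrow> t X \<in> hom D (omap F X) (omap G X)"
    and naturality: "f \<in> hom C X Y \<Longrightarrow> t Y \<cdot>\<^bsub>D\<^esub> amap F f = amap G f \<cdot>\<^bsub>D\<^esub> t X"

definition is_nat_iso ::
  "('o1, 'a1) cat \<Rightarrow> ('o2, 'a2) cat \<Rightarrow> ('o1, 'a1, 'o2, 'a2) cfun \<Rightarrow>
    ('o1, 'a1, 'o2, 'a2) cfun \<Rightarrow> ('o1 \<Rightarrow> 'a2) \<Rightarrow> bool" where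
  "is_nat_iso C D F G t \<longleftrightarrow> is_nat_trans C D F G t \<and> (\<forall>X \<in> Obj C. is_iso D (t X))"

definition faithful_functor ::
  "('o1, 'a1) cat \<Rightarrow> ('o2, 'a2) cat \<Rightarrow> ('o1, 'a1, 'o2, 'a2) cfun \<Rightarrow> bool" where
  "faithful_functor C D F \<longleftrightarrow> is_functor C D F \<and>
    (\<forall>X \<in> Obj C. \<forall>Y \<in> Obj C. inj_on (amap F) (hom C X Y))"

definition full_functor ::
  "('o1, 'a1) cat \<Rightarrow> ('o2, 'a2) cat \<Rightarrow> ('o1, 'a1, 'o2, 'a2) cfun \<Rightarrow> bool" where
  "full_functor C D F \<longleftrightarrow> is_functor C D F \<and>
    (\<forall>X \<in> Obj C. \<forall>Y \<in> Obj C. amap F ` hom C X Y = hom D (omap F X) (omap F Y))"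

definition equivalence_functor ::
  "('o1, 'a1) cat \<Rightarrow> ('o2, 'a2) cat \<Rightarrow> ('o1, 'a1, 'o2, 'a2) cfun \<Rightarrow> bool" where
  "equivalence_functor C D F \<longleftrightarrow> is_functor C D F \<and>
    (\<exists>G s t. is_functor D C G \<and>
      is_nat_iso C C id_cfun (comp_cfun G F) s \<and>
      is_nat_iso D D (comp_cfun F G) id_cfun t)"

text \<open>
  All categories constructed below have arrows of the form \<open>(X, h, Y)\<close> recording domain,
  underlying datum, and codomain; \<open>H X Y h\<close> says that \<open>h\<close> underlies an arrow \<open>X \<rightarrow> Y\<close>.
\<close>

definition mk_cat ::
  "'o set \<Rightarrow> ('o \<Rightarrow> 'o \<Rightarrow> 'h \<Rightarrow> bool) \<Rightarrow> ('o \<Rightarrow> 'h) \<Rightarrow> ('h \<Rightarrow> 'h \<Rightarrow> 'h) \<Rightarrow>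
    ('o, 'o \<times> 'h \<times> 'o) cat" where
  "mk_cat Ob H i c =
    \<lparr>Obj = Ob,
     Arr = {(X, h, Y) | X h Y. X \<in> Ob \<and> Y \<in> Ob \<and> H X Y h},
     Dom = (\<lambda>(X, h, Y). X),
     Cod = (\<lambda>(X, h, Y). Y),
     Idn = (\<lambda>X. (X, i X, X)),
     Cmp = (\<lambda>(Y', g, Z) (X, f, Y). (X, c g f, Z))\<rparr>"


section \<open>Limits and pullbacks\<close>

definition is_cone ::
  "('j, 'k) cat \<Rightarrow> ('o, 'a) cat \<Rightarrow> ('j, 'k, 'o, 'a) cfun \<Rightarrow> 'o \<Rightarrow> ('j \<Rightarrow> 'a) \<Rightarrow> bool" where
  "is_cone J C D L l \<longleftrightarrow> L \<in> Obj C \<and> (\<forall>j \<in> Obj J. l j \<in> hom C L (omap D j)) \<and>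
    (\<forall>k \<in> Arr J. amap D k \<cdot>\<^bsub>C\<^esub> l (Dom J k) = l (Cod J k))"

definition is_limit ::
  "('j, 'k) cat \<Rightarrow> ('o, 'a) cat \<Rightarrow> ('j, 'k, 'o, 'a) cfun \<Rightarrow> 'o \<Rightarrow> ('j \<Rightarrow> 'a) \<Rightarrow> bool" where
  "is_limit J C D L l \<longleftrightarrow> is_cone J C D L l \<and>
    (\<forall>M m. is_cone J C D M m \<longrightarrow>
      (\<exists>!h. h \<in> hom C M L \<and> (\<forall>j \<in> Obj J. l j \<cdot>\<^bsub>C\<^esub> h = m j)))"

text \<open>
  Every finite category is isomorphic to one whose objects and arrows are natural numbers,
  so the index categories below exhaust all finite shapes.
\<close>

definition has_finite_limits :: "('o, 'a) cat \<Rightarrow> bool" where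
  "has_finite_limits C \<longleftrightarrow>
    (\<forall>(J :: (nat, nat) cat) D. category J \<and> finite (Obj J) \<and> finite (Arr J) \<and> is_functor J C D \<longrightarrow>
      (\<exists>L l. is_limit J C D L l))"

text \<open>\<open>is_pullback C f g p q\<close>: \<open>f \<cdot> p = g \<cdot> q\<close> is a pullback square.\<close>

definition is_pullback :: "('o, 'a) cat \<Rightarrow> 'a \<Rightarrow> 'a \<Rightarrow> 'a \<Rightarrow> 'a \<Rightarrow> bool" where
  "is_pullback C f g p q \<longleftrightarrow>
    f \<in> Arr C \<and> g \<in> Arr C \<and> Cod C f = Cod C g \<and>
    p \<in> Arr C \<and> q \<in> Arr C \<and> Dom C p = Dom C q \<and>
    Cod C p = Dom C f \<and> Cod C q = Dom C g \<and> f \<cdot>\<^bsub>C\<^esub> p = g \<cdot>\<^bsub>C\<^esub> q \<and>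
    (\<forall>W. \<forall>u \<in> hom C W (Dom C f). \<forall>v \<in> hom C W (Dom C g). f \<cdot>\<^bsub>C\<^esub> u = g \<cdot>\<^bsub>C\<^esub> v \<longrightarrow>
      (\<exists>!h. h \<in> hom C W (Dom C p) \<and> p \<cdot>\<^bsub>C\<^esub> h = u \<and> q \<cdot>\<^bsub>C\<^esub> h = v))"

definition has_pullbacks :: "('o, 'a) cat \<Rightarrow> bool" where
  "has_pullbacks C \<longleftrightarrow>
    (\<forall>f \<in> Arr C. \<forall>g \<in> Arr C. Cod C f = Cod C g \<longrightarrow> (\<exists>p q. is_pullback C f g p q))"

definition preserves_pullbacks ::
  "('o1, 'a1) cat \<Rightarrow> ('o2, 'a2) cat \<Rightarrow> ('o1, 'a1, 'o2, 'a2) cfun \<Rightarrow> bool" where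
  "preserves_pullbacks C D F \<longleftrightarrow>
    (\<forall>f g p q. is_pullback C f g p q \<longrightarrow>
      is_pullback D (amap F f) (amap F g) (amap F p) (amap F q))"

text \<open>A choice of pullback for every cospan, its projections, and induced arrows \<open>(u, v)\<close>.\<close>

definition chosen_pb :: "('o, 'a) cat \<Rightarrow> 'a \<Rightarrow> 'a \<Rightarrow> 'a \<times> 'a" where
  "chosen_pb C f g = (SOME pq. is_pullback C f g (fst pq) (snd pq))"

definition pr1 :: "('o, 'a) cat \<Rightarrow> 'a \<Rightarrow> 'a \<Rightarrow> 'a" where
  "pr1 C f g = fst (chosen_pb C f g)"

definition pr2 :: "('o, 'a) cat \<Rightarrow> 'a \<Rightarrow> 'a \<Rightarrow> 'a" where
  "pr2 C f g = snd (chosen_pb C f g)"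

definition pb_obj :: "('o, 'a) cat \<Rightarrow> 'a \<Rightarrow> 'a \<Rightarrow> 'o" where
  "pb_obj C f g = Dom C (pr1 C f g)"

definition pb_pair :: "('o, 'a) cat \<Rightarrow> 'a \<Rightarrow> 'a \<Rightarrow> 'a \<Rightarrow> 'a \<Rightarrow> 'a" where
  "pb_pair C f g u v =
    (THE h. h \<in> hom C (Dom C u) (pb_obj C f g) \<and>
      pr1 C f g \<cdot>\<^bsub>C\<^esub> h = u \<and> pr2 C f g \<cdot>\<^bsub>C\<^esub> h = v)"


section \<open>Monads, algebras, and the comparison functor\<close>

record ('o, 'a) monad =
  endo :: "('o, 'a, 'o, 'a) cfun"
  mult :: "'o \<Rightarrow> 'a"
  unit :: "'o \<Rightarrow> 'a"

locale is_monad = category C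
  for C :: "('o, 'a) cat" (structure) +
  fixes T :: "('o, 'a) monad"
  assumes endo_functor: "is_functor C C (endo T)"
    and mult_natural: "is_nat_trans C C (comp_cfun (endo T) (endo T)) (endo T) (mult T)"
    and unit_natural: "is_nat_trans C C id_cfun (endo T) (unit T)"
    and mult_assoc: "X \<in> Obj C \<Longrightarrow>
      mult T X \<cdot> amap (endo T) (mult T X) = mult T X \<cdot> mult T (omap (endo T) X)"
    and mult_unit_left: "X \<in> Obj C \<Longrightarrow>
      mult T X \<cdot> unit T (omap (endo T) X) = Idn C (omap (endo T) X)"
    and mult_unit_right: "X \<in> Obj C \<Longrightarrow>
      mult T X \<cdot> amap (endo T) (unit T X) = Idn C (omap (endo T) X)"

definition is_algebra :: "('o, 'a) cat \<Rightarrow> ('o, 'a) monad \<Rightarrow> 'o \<times> 'a \<Rightarrow> bool" where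
  "is_algebra C T = (\<lambda>(X, \<xi>). X \<in> Obj C \<and> \<xi> \<in> hom C (omap (endo T) X) X \<and>
    \<xi> \<cdot>\<^bsub>C\<^esub> unit T X = Idn C X \<and>
    \<xi> \<cdot>\<^bsub>C\<^esub> amap (endo T) \<xi> = \<xi> \<cdot>\<^bsub>C\<^esub> mult T X)"

definition is_algebra_hom ::
  "('o, 'a) cat \<Rightarrow> ('o, 'a) monad \<Rightarrow> 'o \<times> 'a \<Rightarrow> 'o \<times> 'a \<Rightarrow> 'a \<Rightarrow> bool" where
  "is_algebra_hom C T = (\<lambda>(X, \<xi>) (Y, \<upsilon>) h. h \<in> hom C X Y \<and>
    h \<cdot>\<^bsub>C\<^esub> \<xi> = \<upsilon> \<cdot>\<^bsub>C\<^esub> amap (endo T) h)"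

definition Alg ::
  "('o, 'a) cat \<Rightarrow> ('o, 'a) monad \<Rightarrow> ('o \<times> 'a, ('o \<times> 'a) \<times> 'a \<times> ('o \<times> 'a)) cat" where
  "Alg C T =
    mk_cat {A. is_algebra C T A} (is_algebra_hom C T) (\<lambda>A. Idn C (fst A)) (Cmp C)"

text \<open>
  For an adjunction \<open>F \<stileturn> G\<close> with unit \<open>\<eta>\<close> and counit \<open>\<epsilon>\<close>: the induced monad \<open>(GF, G\<epsilon>F, \<eta>)\<close>,
  and the Eilenberg--Moore comparison functor \<open>Y \<mapsto> (G Y, G \<epsilon>\<^sub>Y)\<close>.
\<close>

definition induced_monad ::
  "('o1, 'a1, 'o2, 'a2) cfun \<Rightarrow> ('o2, 'a2, 'o1, 'a1) cfun \<Rightarrow>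
    ('o1 \<Rightarrow> 'a1) \<Rightarrow> ('o2 \<Rightarrow> 'a2) \<Rightarrow> ('o1, 'a1) monad" where
  "induced_monad F G \<eta> \<epsilon> =
    \<lparr>endo = comp_cfun G F, mult = (\<lambda>X. amap G (\<epsilon> (omap F X))), unit = \<eta>\<rparr>"

definition comparison ::
  "('o2, 'a2) cat \<Rightarrow> ('o2, 'a2, 'o1, 'a1) cfun \<Rightarrow> ('o2 \<Rightarrow> 'a2) \<Rightarrow>
    ('o2, 'a2, 'o1 \<times> 'a1, ('o1 \<times> 'a1) \<times> 'a1 \<times> ('o1 \<times> 'a1)) cfun" where
  "comparison D G \<epsilon> =
    (let K = (\<lambda>Y. (omap G Y, amap G (\<epsilon> Y)))
     in \<lparr>omap = K, amap = (\<lambda>h. (K (Dom D h), amap G h, K (Cod D h)))\<rparr>)"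


section \<open>Slices and descent\<close>

text \<open>An object of \<open>C/b\<close> is an arrow with codomain \<open>b\<close>.\<close>

type_synonym 'a slice_arr = "'a \<times> 'a \<times> 'a"

definition slice :: "('o, 'a) cat \<Rightarrow> 'o \<Rightarrow> ('a, 'a slice_arr) cat" where
  "slice C b =
    mk_cat {f \<in> Arr C. Cod C f = b}
      (\<lambda>f g h. h \<in> hom C (Dom C f) (Dom C g) \<and> g \<cdot>\<^bsub>C\<^esub> h = f)
      (\<lambda>f. Idn C (Dom C f)) (Cmp C)"

text \<open>
  For \<open>q : e \<rightarrow> b\<close>: the functor \<open>q\<^sub>! : C/e \<rightarrow> C/b\<close>, its right adjoint \<open>q\<^sup>* : C/b \<rightarrow> C/e\<close>
  taking \<open>g : a \<rightarrow> b\<close> to the projection \<open>e \<times>\<^sub>b a \<rightarrow> e\<close>, and the unit and counit of \<open>q\<^sub>! \<stileturn> q\<^sup>*\<close>.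
\<close>

definition slice_push ::
  "('o, 'a) cat \<Rightarrow> 'a \<Rightarrow> ('a, 'a slice_arr, 'a, 'a slice_arr) cfun" where
  "slice_push C q =
    \<lparr>omap = (\<lambda>f. q \<cdot>\<^bsub>C\<^esub> f),
     amap = (\<lambda>(f, h, g). (q \<cdot>\<^bsub>C\<^esub> f, h, q \<cdot>\<^bsub>C\<^esub> g))\<rparr>"

definition slice_pull ::
  "('o, 'a) cat \<Rightarrow> 'a \<Rightarrow> ('a, 'a slice_arr, 'a, 'a slice_arr) cfun" where
  "slice_pull C q =
    \<lparr>omap = (\<lambda>g. pr1 C q g),
     amap = (\<lambda>(f, h, g).
       (pr1 C q f, pb_pair C q g (pr1 C q f) (h \<cdot>\<^bsub>C\<^esub> pr2 C q f), pr1 C q g))\<rparr>"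

definition slice_unit :: "('o, 'a) cat \<Rightarrow> 'a \<Rightarrow> 'a \<Rightarrow> 'a slice_arr" where
  "slice_unit C q f =
    (f, pb_pair C q (q \<cdot>\<^bsub>C\<^esub> f) f (Idn C (Dom C f)), pr1 C q (q \<cdot>\<^bsub>C\<^esub> f))"

definition slice_counit :: "('o, 'a) cat \<Rightarrow> 'a \<Rightarrow> 'a \<Rightarrow> 'a slice_arr" where
  "slice_counit C q g = (q \<cdot>\<^bsub>C\<^esub> pr1 C q g, pr2 C q g, g)"

definition descent_monad :: "('o, 'a) cat \<Rightarrow> 'a \<Rightarrow> ('a, 'a slice_arr) monad" where
  "descent_monad C q =
    induced_monad (slice_push C q) (slice_pull C q) (slice_unit C q) (slice_counit C q)"

definition descent_Alg ::
  "('o, 'a) cat \<Rightarrow> 'a \<Rightarrow>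
    ('a \<times> 'a slice_arr, ('a \<times> 'a slice_arr) \<times> 'a slice_arr \<times> ('a \<times> 'a slice_arr)) cat" where
  "descent_Alg C q = Alg (slice C (Dom C q)) (descent_monad C q)"

definition descent_comparison ::
  "('o, 'a) cat \<Rightarrow> 'a \<Rightarrow>
    ('a, 'a slice_arr, 'a \<times> 'a slice_arr,
     ('a \<times> 'a slice_arr) \<times> 'a slice_arr \<times> ('a \<times> 'a slice_arr)) cfun" where
  "descent_comparison C q =
    comparison (slice C (Cod C q)) (slice_pull C q) (slice_counit C q)"

definition almost_descent :: "('o, 'a) cat \<Rightarrow> 'a \<Rightarrow> bool" where
  "almost_descent C q \<longleftrightarrow> category C \<and> has_pullbacks C \<and> q \<in> Arr C \<and>
    faithful_functor (slice C (Cod C q)) (descent_Alg C q) (descent_comparison C q)"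

definition descent :: "('o, 'a) cat \<Rightarrow> 'a \<Rightarrow> bool" where
  "descent C q \<longleftrightarrow> category C \<and> has_pullbacks C \<and> q \<in> Arr C \<and>
    faithful_functor (slice C (Cod C q)) (descent_Alg C q) (descent_comparison C q) \<and>
    full_functor (slice C (Cod C q)) (descent_Alg C q) (descent_comparison C q)"

definition effective_descent :: "('o, 'a) cat \<Rightarrow> 'a \<Rightarrow> bool" where
  "effective_descent C q \<longleftrightarrow> category C \<and> has_pullbacks C \<and> q \<in> Arr C \<and>
    equivalence_functor (slice C (Cod C q)) (descent_Alg C q) (descent_comparison C q)"


section \<open>Internal \<open>T\<close>-categories\<close>

record ('o, 'a) tcat =
  ob0 :: 'o
  ob1 :: 'o
  d1 :: 'a
  d0 :: 'a
  s0 :: 'a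
  cm :: 'a

text \<open>
  The 2-chains \<open>x\<^sub>2\<close> with projections \<open>\<pi>\<^sub>0\<close>, \<open>\<pi>\<^sub>2\<close>, the 3-chains \<open>x\<^sub>3\<close> with projections
  \<open>\<rho>\<^sub>0\<close>, \<open>\<rho>\<^sub>3\<close>, and the arrows \<open>(u, v)\<close> into \<open>x\<^sub>2\<close> and \<open>x\<^sub>3\<close>.
\<close>

context
  fixes V :: "('o, 'a) cat" (structure) and T :: "('o, 'a) monad"
begin

abbreviation T0 :: "'o \<Rightarrow> 'o" where "T0 \<equiv> omap (endo T)"
abbreviation T1 :: "'a \<Rightarrow> 'a" where "T1 \<equiv> amap (endo T)"

definition chains2 :: "('o, 'a) tcat \<Rightarrow> 'o" where
  "chains2 x = pb_obj V (d1 x) (T1 (d0 x))"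

definition pi0 :: "('o, 'a) tcat \<Rightarrow> 'a" where
  "pi0 x = pr1 V (d1 x) (T1 (d0 x))"

definition pi2 :: "('o, 'a) tcat \<Rightarrow> 'a" where
  "pi2 x = pr2 V (d1 x) (T1 (d0 x))"

definition pair2 :: "('o, 'a) tcat \<Rightarrow> 'a \<Rightarrow> 'a \<Rightarrow> 'a" where
  "pair2 x u v = pb_pair V (d1 x) (T1 (d0 x)) u v"

definition chains3 :: "('o, 'a) tcat \<Rightarrow> 'o" where
  "chains3 x = pb_obj V (pi2 x) (T1 (pi0 x))"

definition rho0 :: "('o, 'a) tcat \<Rightarrow> 'a" where
  "rho0 x = pr1 V (pi2 x) (T1 (pi0 x))"

definition rho3 :: "('o, 'a) tcat \<Rightarrow> 'a" where
  "rho3 x = pr2 V (pi2 x) (T1 (pi0 x))"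

definition pair3 :: "('o, 'a) tcat \<Rightarrow> 'a \<Rightarrow> 'a \<Rightarrow> 'a" where
  "pair3 x u v = pb_pair V (pi2 x) (T1 (pi0 x)) u v"

definition is_tcat :: "('o, 'a) tcat \<Rightarrow> bool" where
  "is_tcat x \<longleftrightarrow>
    ob0 x \<in> Obj V \<and> ob1 x \<in> Obj V \<and>
    d1 x \<in> hom V (ob1 x) (T0 (ob0 x)) \<and>
    d0 x \<in> hom V (ob1 x) (ob0 x) \<and>
    s0 x \<in> hom V (ob0 x) (ob1 x) \<and>
    cm x \<in> hom V (chains2 x) (ob1 x) \<and>
    d0 x \<cdot> s0 x = Idn V (ob0 x) \<and>
    d1 x \<cdot> s0 x = unit T (ob0 x) \<and>
    d0 x \<cdot> cm x = d0 x \<cdot> pi0 x \<and>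
    d1 x \<cdot> cm x = mult T (ob0 x) \<cdot> T1 (d1 x) \<cdot> pi2 x \<and>
    cm x \<cdot> pair2 x (s0 x \<cdot> d0 x) (unit T (ob1 x)) = Idn V (ob1 x) \<and>
    cm x \<cdot> pair2 x (Idn V (ob1 x)) (T1 (s0 x) \<cdot> d1 x) = Idn V (ob1 x) \<and>
    cm x \<cdot> pair2 x (pi0 x \<cdot> rho0 x) (T1 (cm x) \<cdot> rho3 x) =
      cm x \<cdot> pair2 x (cm x \<cdot> rho0 x) (mult T (ob1 x) \<cdot> T1 (pi2 x) \<cdot> rho3 x)"

text \<open>The arrows \<open>p\<^sub>2 : x\<^sub>2 \<rightarrow> y\<^sub>2\<close> and \<open>p\<^sub>3 : x\<^sub>3 \<rightarrow> y\<^sub>3\<close> induced by \<open>p\<^sub>1 : x\<^sub>1 \<rightarrow> y\<^sub>1\<close>.\<close>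

definition induced2 :: "('o, 'a) tcat \<Rightarrow> ('o, 'a) tcat \<Rightarrow> 'a \<Rightarrow> 'a" where
  "induced2 x y p1 = pair2 y (p1 \<cdot> pi0 x) (T1 p1 \<cdot> pi2 x)"

definition induced3 :: "('o, 'a) tcat \<Rightarrow> ('o, 'a) tcat \<Rightarrow> 'a \<Rightarrow> 'a" where
  "induced3 x y p1 =
    pair3 y (induced2 x y p1 \<cdot> rho0 x) (T1 (induced2 x y p1) \<cdot> rho3 x)"

definition is_tfunctor :: "('o, 'a) tcat \<Rightarrow> ('o, 'a) tcat \<Rightarrow> 'a \<times> 'a \<Rightarrow> bool" where
  "is_tfunctor x y = (\<lambda>(p0, p1).
    p0 \<in> hom V (ob0 x) (ob0 y) \<and>
    p1 \<in> hom V (ob1 x) (ob1 y) \<and>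
    d0 y \<cdot> p1 = p0 \<cdot> d0 x \<and>
    d1 y \<cdot> p1 = T1 p0 \<cdot> d1 x \<and>
    p1 \<cdot> s0 x = s0 y \<cdot> p0 \<and>
    p1 \<cdot> cm x = cm y \<cdot> induced2 x y p1)"

definition TCat ::
  "(('o, 'a) tcat, ('o, 'a) tcat \<times> ('a \<times> 'a) \<times> ('o, 'a) tcat) cat" where
  "TCat = mk_cat {x. is_tcat x} is_tfunctor
    (\<lambda>x. (Idn V (ob0 x), Idn V (ob1 x)))
    (\<lambda>(q0, q1) (p0, p1). (q0 \<cdot> p0, q1 \<cdot> p1))"

end

end

theory Submission
  imports Defs
begin

text \<open>
  An object of the descent category of \<open>q : e \<rightarrow> b\<close> over \<open>f : a \<rightarrow> e\<close> is an action of the kernel pair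
  of \<open>q\<close> on \<open>a\<close>: it moves a generalized element \<open>\<alpha>\<close> of \<open>a\<close> to the fibre over any \<open>t\<close> with
  \<open>q t = q (f \<alpha>)\<close>. Then \<open>q\<close> is of effective descent iff its pullbacks are regular epimorphisms and every
  action comes from a pullback \<open>a = e \<times>\<^sub>b c\<close>, that is, from a map \<open>\<pi> : a \<rightarrow> c\<close> invariant under the action.

  Pullbacks of \<open>T\<close>-categories are computed componentwise, since \<open>T\<close> preserves pullbacks, and then
  also \<open>a\<^sub>2\<close> and \<open>a\<^sub>3\<close> are pullbacks of \<open>p\<^sub>2\<close> and \<open>p\<^sub>3\<close>. An action of \<open>p\<close> on a \<open>T\<close>-category \<open>a\<close>
  gives actions of \<open>p\<^sub>1\<close> and of \<open>p\<^sub>0\<close>, which is a retract of \<open>p\<^sub>1\<close> by \<open>s\<^sub>0\<close> and \<open>d\<^sub>0\<close>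
    and hence of effective
  descent too; they yield \<open>\<pi>\<^sub>1 : a\<^sub>1 \<rightarrow> c\<^sub>1\<close>
    and \<open>\<pi>\<^sub>0 : a\<^sub>0 \<rightarrow> c\<^sub>0\<close>. The structure maps of \<open>a\<close> are equivariant,
  so domain, codomain and identities descend along the regular epimorphisms \<open>\<pi>\<^sub>0\<close>, \<open>\<pi>\<^sub>1\<close>. The
    composition
  descends along \<open>\<pi>\<^sub>2 : a\<^sub>2 \<rightarrow> c\<^sub>2\<close>, a regular epimorphism because \<open>p\<^sub>2\<close> is of descent.
    Associativity of \<open>c\<close>
  is tested on \<open>\<pi>\<^sub>3 : a\<^sub>3 \<rightarrow> c\<^sub>3\<close>, an epimorphism because \<open>p\<^sub>3\<close> is of almost descent.
\<close>

section \<open>Categories and pullbacks\<close>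

text \<open>Two obstacles shape the argument. \<open>T\<close> preserves pullbacks but is not
  assumed to preserve epimorphisms, so nothing can be cancelled under \<open>T\<close>. Each
  equation about the descended structure is therefore tested on an epimorphism onto its own source:
  c_0 for the boundaries of identities, c_1 for the unit laws, c_2 for the boundaries of composites,
  c_3 for associativity. Hence the demands weaken along the chains: on c_2 an arrow must be found,
  on c_3 only an equation checked.

  Moreover \<open>chosen_pb\<close> makes independent arbitrary choices in the base and among
  \<open>T\<close>-categories, so a chosen pullback of \<open>T\<close>-categories need not have
  chosen pullbacks as components. Descent is restated by notions that range over all pullback
  squares (\<open>stably\<close>) or name no pullback object (\<open>descent_action\<close>), and
  these are what passes between the two categories.

  Finite limits supply binary products: descent compares only arrows over the codomain b of
  \<open>q\<close>, and an arrow into an arbitrary object z becomes one over b into the product of z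
  and b.\<close>

lemma in_hom_iff: "f \<in> hom C X Y \<longleftrightarrow> f \<in> Arr C \<and> Dom C f = X \<and> Cod C f = Y"
  by (simp add: hom_def)

text \<open>Equality of the codomains of \<open>u\<close> and \<open>v\<close> is not demanded: in a
  category it follows from equality of the composites. This saves a side condition wherever
  \<open>epiD\<close> is applied.\<close>

definition epi :: "('o, 'a) cat \<Rightarrow> 'a \<Rightarrow> bool" where
  "epi C q \<longleftrightarrow> q \<in> Arr C \<and> (\<forall>u v. u \<in> Arr C \<longrightarrow> v \<in> Arr C \<longrightarrow> Dom C u = Cod C q \<longrightarrow>
     Dom C v = Cod C q \<longrightarrow> u \<cdot>\<^bsub>C\<^esub> q = v \<cdot>\<^bsub>C\<^esub> q \<longrightarrow> u = v)"

lemma epiD: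
  assumes "epi C q" "u \<cdot>\<^bsub>C\<^esub> q = v \<cdot>\<^bsub>C\<^esub> q" "u \<in> Arr C" "v \<in> Arr C" "Dom C u = Cod C q"
    "Dom C v = Cod C q"
  shows "u = v"
  using assms by (auto simp: epi_def)

lemma pullbackD:
  assumes "is_pullback C f g p q"
  shows "f \<in> Arr C" "g \<in> Arr C" "p \<in> Arr C" "q \<in> Arr C"
    "Cod C g = Cod C f" "Dom C q = Dom C p" "Cod C p = Dom C f" "Cod C q = Dom C g"
    "f \<cdot>\<^bsub>C\<^esub> p = g \<cdot>\<^bsub>C\<^esub> q"
  using assms by (auto simp: is_pullback_def)

lemma pullback_lift:
  assumes "is_pullback C f g p q" "f \<cdot>\<^bsub>C\<^esub> u = g \<cdot>\<^bsub>C\<^esub> v"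
    "u \<in> Arr C" "v \<in> Arr C" "Dom C v = Dom C u" "Cod C u = Dom C f" "Cod C v = Dom C g"
  obtains h where "h \<in> Arr C" "Dom C h = Dom C u" "Cod C h = Dom C p"
    "p \<cdot>\<^bsub>C\<^esub> h = u" "q \<cdot>\<^bsub>C\<^esub> h = v"
proof -
  have "u \<in> hom C (Dom C u) (Dom C f)" "v \<in> hom C (Dom C u) (Dom C g)"
    using assms by (auto simp: in_hom_iff)
  with assms(1,2) have "\<exists>h. h \<in> hom C (Dom C u) (Dom C p) \<and> p \<cdot>\<^bsub>C\<^esub> h = u \<and> q \<cdot>\<^bsub>C\<^esub> h = v"
    unfolding is_pullback_def by blast
  with that show thesis by (auto simp: in_hom_iff)
qed

context category
begin

lemma Dom_Obj [simp]: "f \<in> Arr C \<Longrightarrow> Dom C f \<in> Obj C"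
  and Cod_Obj [simp]: "f \<in> Arr C \<Longrightarrow> Cod C f \<in> Obj C"
  by (simp_all add: Dom_in_Obj Cod_in_Obj)

lemma Cmp_Arr [simp]:
  assumes "f \<in> Arr C" "g \<in> Arr C" "Dom C g = Cod C f"
  shows "g \<cdot> f \<in> Arr C" "Dom C (g \<cdot> f) = Dom C f" "Cod C (g \<cdot> f) = Cod C g"
  using Cmp_in_hom[of f "Dom C f" "Cod C f" g "Cod C g"] assms by (auto simp: in_hom_iff)

lemma Cmp_reassoc [simp]:
  assumes "f \<in> Arr C" "g \<in> Arr C" "h \<in> Arr C" "Dom C h = Cod C g" "Dom C g = Cod C f"
  shows "(h \<cdot> g) \<cdot> f = h \<cdot> (g \<cdot> f)"
  by (rule Cmp_assoc[of f "Dom C f" "Cod C f" g "Cod C g" h "Cod C h"])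
    (use assms in \<open>auto simp: in_hom_iff\<close>)

text \<open>Makes an equation between composites applicable inside right-nested composites.\<close>

lemma Cmp_reduce:
  assumes "g \<cdot> f = k" "f \<in> Arr C" "g \<in> Arr C" "Dom C g = Cod C f" "h \<in> Arr C" "Cod C h = Dom C f"
  shows "g \<cdot> (f \<cdot> h) = k \<cdot> h"
  using assms Cmp_reassoc[of h f g] by simp

lemma Idn_Arr [simp]:
  assumes "X \<in> Obj C"
  shows "Idn C X \<in> Arr C" "Dom C (Idn C X) = X" "Cod C (Idn C X) = X"
  using Idn_in_hom[OF assms] by (auto simp: in_hom_iff)

lemma Idn_left [simp]: "f \<in> Arr C \<Longrightarrow> Cod C f = X \<Longrightarrow> Idn C X \<cdot> f = f"
  and Idn_right [simp]: "f \<in> Arr C \<Longrightarrow> Dom C f = X \<Longrightarrow> f \<cdot> Idn C X = f"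
  by (auto intro: Cmp_Idn_left Cmp_Idn_right simp: in_hom_iff)

lemma pullbackI:
  assumes "f \<in> Arr C" "g \<in> Arr C" "p \<in> Arr C" "q \<in> Arr C"
    "Cod C g = Cod C f" "Dom C q = Dom C p" "Cod C p = Dom C f" "Cod C q = Dom C g"
    "f \<cdot> p = g \<cdot> q"
    and ex: "\<And>u v. u \<in> Arr C \<Longrightarrow> v \<in> Arr C \<Longrightarrow> Dom C v = Dom C u \<Longrightarrow> Cod C u = Dom C f \<Longrightarrow>
      Cod C v = Dom C g \<Longrightarrow> f \<cdot> u = g \<cdot> v \<Longrightarrow>
      \<exists>h. h \<in> Arr C \<and> Dom C h = Dom C u \<and> Cod C h = Dom C p \<and> p \<cdot> h = u \<and> q \<cdot> h = v"
    and un: "\<And>h k. h \<in> Arr C \<Longrightarrow> k \<in> Arr C \<Longrightarrow> Dom C k = Dom C h \<Longrightarrow> Cod C h = Dom C p \<Longrightarrow>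
      Cod C k = Dom C p \<Longrightarrow> p \<cdot> h = p \<cdot> k \<Longrightarrow> q \<cdot> h = q \<cdot> k \<Longrightarrow> h = k"
  shows "is_pullback C f g p q"
  unfolding is_pullback_def
proof (intro conjI allI ballI impI)
  fix W u v assume *: "u \<in> hom C W (Dom C f)" "v \<in> hom C W (Dom C g)" "f \<cdot> u = g \<cdot> v"
  then obtain h where h: "h \<in> Arr C" "Dom C h = W" "Cod C h = Dom C p" "p \<cdot> h = u" "q \<cdot> h = v"
    using ex[of u v] by (auto simp: in_hom_iff)
  show "\<exists>!h. h \<in> hom C W (Dom C p) \<and> p \<cdot> h = u \<and> q \<cdot> h = v"
  proof (rule ex1I[of _ h])
    fix h' assume "h' \<in> hom C W (Dom C p) \<and> p \<cdot> h' = u \<and> q \<cdot> h' = v"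
    with h show "h' = h" by - (rule un, auto simp: in_hom_iff)
  qed (use h in \<open>auto simp: in_hom_iff\<close>)
qed (use assms in auto)

text \<open>Joint monicity of the projections, the form in which uniqueness is used throughout: two
  arrows into a pullback are compared after each projection.\<close>

lemma pullback_eqI:
  assumes pb: "is_pullback C f g p q" and eq: "p \<cdot> h = p \<cdot> k" "q \<cdot> h = q \<cdot> k"
    and h: "h \<in> Arr C" "k \<in> Arr C" "Dom C k = Dom C h" "Cod C h = Dom C p" "Cod C k = Dom C p"
  shows "h = k"
proof -
  note [simp] = pullbackD[OF pb]
  note [simp] = pullbackD(9)[OF pb, THEN Cmp_reduce]
  have "p \<cdot> k \<in> hom C (Dom C h) (Dom C f)" "q \<cdot> k \<in> hom C (Dom C h) (Dom C g)"
    "f \<cdot> (p \<cdot> k) = g \<cdot> (q \<cdot> k)"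
    using h by (auto simp: in_hom_iff)
  with pb have "\<exists>!j. j \<in> hom C (Dom C h) (Dom C p) \<and> p \<cdot> j = p \<cdot> k \<and> q \<cdot> j = q \<cdot> k"
    unfolding is_pullback_def by blast
  moreover have "h \<in> hom C (Dom C h) (Dom C p)" "k \<in> hom C (Dom C h) (Dom C p)"
    using h by (auto simp: in_hom_iff)
  ultimately show ?thesis using eq by blast
qed

text \<open>The inverse \<open>l\<close> is given explicitly because a lift into the new apex is an
  old lift followed by \<open>l\<close>.\<close>

lemma pullback_iso:
  assumes pb: "is_pullback C f g p q"
    and k: "k \<in> Arr C" "l \<in> Arr C" "Cod C k = Dom C p" "Dom C l = Dom C p" "Cod C l = Dom C k"
      "k \<cdot> l = Idn C (Dom C p)" "l \<cdot> k = Idn C (Dom C k)"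
  shows "is_pullback C f g (p \<cdot> k) (q \<cdot> k)"
proof -
  note [simp] = pullbackD[OF pb] k
  note [simp] = pullbackD(9)[OF pb, THEN Cmp_reduce] k(6)[THEN Cmp_reduce] k(7)[THEN Cmp_reduce]
  show ?thesis
  proof (rule pullbackI)
    fix u v assume [simp]: "u \<in> Arr C" "v \<in> Arr C" "Dom C v = Dom C u" "Cod C u = Dom C f"
      "Cod C v = Dom C g" and eq: "f \<cdot> u = g \<cdot> v"
    obtain h where [simp]: "h \<in> Arr C" "Dom C h = Dom C u" "Cod C h = Dom C p"
      "p \<cdot> h = u" "q \<cdot> h = v" using pullback_lift[OF pb eq] by auto
    show "\<exists>h. h \<in> Arr C \<and> Dom C h = Dom C u \<and> Cod C h = Dom C (p \<cdot> k) \<and> (p \<cdot> k) \<cdot> h = u \<and>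
      (q \<cdot> k) \<cdot> h = v"
      by (rule exI[of _ "l \<cdot> h"]) simp
  next
    fix h j assume *[simp]: "h \<in> Arr C" "j \<in> Arr C" "Dom C j = Dom C h" "Cod C h = Dom C (p \<cdot> k)"
      "Cod C j = Dom C (p \<cdot> k)" and eq: "(p \<cdot> k) \<cdot> h = (p \<cdot> k) \<cdot> j" "(q \<cdot> k) \<cdot> h = (q \<cdot> k) \<cdot> j"
    have "k \<cdot> h = k \<cdot> j" by (rule pullback_eqI[OF pb]) (use eq in simp_all)
    then have "l \<cdot> (k \<cdot> h) = l \<cdot> (k \<cdot> j)" by simp
    then show "h = j" by simp
  qed simp_all
qed

lemma pullback_unique_iso:
  assumes pb: "is_pullback C f g p q" and pb': "is_pullback C f g p' q'"
  obtains k l where "k \<in> Arr C" "l \<in> Arr C" "Dom C k = Dom C p'" "Cod C k = Dom C p"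
    "Dom C l = Dom C p"
    "Cod C l = Dom C p'" "k \<cdot> l = Idn C (Dom C p)" "l \<cdot> k = Idn C (Dom C p')" "p \<cdot> k = p'"
      "q \<cdot> k = q'"
    "p' \<cdot> l = p" "q' \<cdot> l = q"
proof -
  note [simp] = pullbackD(1-8)[OF pb] pullbackD(1-8)[OF pb']
  obtain k where [simp]: "k \<in> Arr C" "Dom C k = Dom C p'" "Cod C k = Dom C p"
    and k: "p \<cdot> k = p'" "q \<cdot> k = q'"
    using pullback_lift[OF pb pullbackD(9)[OF pb']] by auto
  obtain l where [simp]: "l \<in> Arr C" "Dom C l = Dom C p" "Cod C l = Dom C p'"
    and l: "p' \<cdot> l = p" "q' \<cdot> l = q"
    using pullback_lift[OF pb' pullbackD(9)[OF pb]] by auto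
  note [simp] = k l
  note [simp] = k[THEN Cmp_reduce] l[THEN Cmp_reduce]
  have "k \<cdot> l = Idn C (Dom C p)" by (rule pullback_eqI[OF pb]) simp_all
  moreover have "l \<cdot> k = Idn C (Dom C p')" by (rule pullback_eqI[OF pb']) simp_all
  ultimately show thesis using that[of k l] by simp
qed

text \<open>Limits commute. Index 3 is the apex of the cospans with feet 1 and 2.\<close>

lemma pullback_of_pullbacks:
  assumes pb1: "is_pullback C q1 g1 f1 k1" and pb2: "is_pullback C q2 g2 f2 k2"
    and pb3: "is_pullback C q3 g3 f3 k3"
    and pbx: "is_pullback C xa xb xu xv" and pby: "is_pullback C ya yb yu yv"
    and pbc: "is_pullback C ca cb cu cv" and pba: "is_pullback C aa ab au av"
    and q: "ya \<cdot> q1 = q3 \<cdot> xa" "yb \<cdot> q2 = q3 \<cdot> xb"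
    and g: "ya \<cdot> g1 = g3 \<cdot> ca" "yb \<cdot> g2 = g3 \<cdot> cb"
    and f: "xa \<cdot> f1 = f3 \<cdot> aa" "xb \<cdot> f2 = f3 \<cdot> ab"
    and k: "ca \<cdot> k1 = k3 \<cdot> aa" "cb \<cdot> k2 = k3 \<cdot> ab"
    and dom: "Dom C xa = Dom C q1" "Dom C xb = Dom C q2" "Cod C xa = Dom C q3"
      "Dom C ya = Cod C q1" "Dom C yb = Cod C q2" "Cod C ya = Cod C q3"
      "Dom C ca = Dom C g1" "Dom C cb = Dom C g2" "Cod C ca = Dom C g3"
      "Dom C aa = Dom C f1" "Dom C ab = Dom C f2" "Cod C aa = Dom C f3"
    and P: "qP \<in> Arr C" "Dom C qP = Dom C xu" "Cod C qP = Dom C yu"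
      "gP \<in> Arr C" "Dom C gP = Dom C cu" "Cod C gP = Dom C yu"
      "fP \<in> Arr C" "Dom C fP = Dom C au" "Cod C fP = Dom C xu"
      "kP \<in> Arr C" "Dom C kP = Dom C au" "Cod C kP = Dom C cu"
    and qP: "yu \<cdot> qP = q1 \<cdot> xu" "yv \<cdot> qP = q2 \<cdot> xv"
    and gP: "yu \<cdot> gP = g1 \<cdot> cu" "yv \<cdot> gP = g2 \<cdot> cv"
    and fP: "xu \<cdot> fP = f1 \<cdot> au" "xv \<cdot> fP = f2 \<cdot> av"
    and kP: "cu \<cdot> kP = k1 \<cdot> au" "cv \<cdot> kP = k2 \<cdot> av"
  shows "is_pullback C qP gP fP kP"
proof -
  note pbs = pb1 pb2 pb3 pbx pby pbc pba
  note [simp] = pbs[THEN pullbackD(1)] pbs[THEN pullbackD(2)] pbs[THEN pullbackD(3)] pbs[THEN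
    pullbackD(4)]
    pbs[THEN pullbackD(5)] pbs[THEN pullbackD(6)] pbs[THEN pullbackD(7)] pbs[THEN pullbackD(8)]
  note [simp] = dom P
  note eqs = pbs[THEN pullbackD(9)] q g f k qP gP fP kP
  note [simp] = eqs
  note [simp] = eqs[THEN Cmp_reduce]
  show ?thesis
  proof (rule pullbackI)
    show "qP \<cdot> fP = gP \<cdot> kP"
      by (rule pullback_eqI[OF pby]) simp_all
  next
    fix u v assume [simp]: "u \<in> Arr C" "v \<in> Arr C" "Dom C v = Dom C u" "Cod C u = Dom C qP"
      "Cod C v = Dom C gP" and eq: "qP \<cdot> u = gP \<cdot> v"
    have "yu \<cdot> (qP \<cdot> u) = yu \<cdot> (gP \<cdot> v)" "yv \<cdot> (qP \<cdot> u) = yv \<cdot> (gP \<cdot> v)" using eq by simp_all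
    then have 1: "q1 \<cdot> (xu \<cdot> u) = g1 \<cdot> (cu \<cdot> v)" and 2: "q2 \<cdot> (xv \<cdot> u) = g2 \<cdot> (cv \<cdot> v)" by simp_all
    obtain w1 where [simp]: "w1 \<in> Arr C" "Dom C w1 = Dom C u" "Cod C w1 = Dom C f1"
      and w1: "f1 \<cdot> w1 = xu \<cdot> u" "k1 \<cdot> w1 = cu \<cdot> v" using pullback_lift[OF pb1 1] by auto
    obtain w2 where [simp]: "w2 \<in> Arr C" "Dom C w2 = Dom C u" "Cod C w2 = Dom C f2"
      and w2: "f2 \<cdot> w2 = xv \<cdot> u" "k2 \<cdot> w2 = cv \<cdot> v" using pullback_lift[OF pb2 2] by auto
    \<comment> \<open>The lifts found for the indices 1 and 2 combine into one arrow only if they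
      agree over index 3; this is checked after the two projections of the third pullback.\<close>
    have 3: "aa \<cdot> w1 = ab \<cdot> w2"
    proof (rule pullback_eqI[OF pb3])
      have "f3 \<cdot> (aa \<cdot> w1) = xb \<cdot> (xv \<cdot> u)" using arg_cong[OF w1(1), of "\<lambda>z. xa \<cdot> z"] by simp
      moreover have "f3 \<cdot> (ab \<cdot> w2) = xb \<cdot> (xv \<cdot> u)" using arg_cong[OF w2(1), of "\<lambda>z. xb \<cdot> z"]
        by simp
      ultimately show "f3 \<cdot> (aa \<cdot> w1) = f3 \<cdot> (ab \<cdot> w2)" by simp
      have "k3 \<cdot> (aa \<cdot> w1) = cb \<cdot> (cv \<cdot> v)" using arg_cong[OF w1(2), of "\<lambda>z. ca \<cdot> z"] by simp
      moreover have "k3 \<cdot> (ab \<cdot> w2) = cb \<cdot> (cv \<cdot> v)" using arg_cong[OF w2(2), of "\<lambda>z. cb \<cdot> z"]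
        by simp
      ultimately show "k3 \<cdot> (aa \<cdot> w1) = k3 \<cdot> (ab \<cdot> w2)" by simp
    qed simp_all
    note [simp] = w1 w2
    obtain w where [simp]: "w \<in> Arr C" "Dom C w = Dom C u" "Cod C w = Dom C au"
      and w: "au \<cdot> w = w1" "av \<cdot> w = w2" using pullback_lift[OF pba 3] by auto
    note [simp] = w
    have "fP \<cdot> w = u" by (rule pullback_eqI[OF pbx]) simp_all
    moreover have "kP \<cdot> w = v" by (rule pullback_eqI[OF pbc]) simp_all
    ultimately show "\<exists>h. h \<in> Arr C \<and> Dom C h = Dom C u \<and> Cod C h = Dom C fP \<and> fP \<cdot> h = u \<and>
      kP \<cdot> h = v"
      by (intro exI[of _ w]) simp
  next
    fix h j assume [simp]: "h \<in> Arr C" "j \<in> Arr C" "Dom C j = Dom C h" "Cod C h = Dom C fP"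
      "Cod C j = Dom C fP" and eq: "fP \<cdot> h = fP \<cdot> j" "kP \<cdot> h = kP \<cdot> j"
    have "xu \<cdot> (fP \<cdot> h) = xu \<cdot> (fP \<cdot> j)" "cu \<cdot> (kP \<cdot> h) = cu \<cdot> (kP \<cdot> j)"
      "xv \<cdot> (fP \<cdot> h) = xv \<cdot> (fP \<cdot> j)" "cv \<cdot> (kP \<cdot> h) = cv \<cdot> (kP \<cdot> j)" using eq by simp_all
    then have e: "f1 \<cdot> (au \<cdot> h) = f1 \<cdot> (au \<cdot> j)" "k1 \<cdot> (au \<cdot> h) = k1 \<cdot> (au \<cdot> j)"
      "f2 \<cdot> (av \<cdot> h) = f2 \<cdot> (av \<cdot> j)" "k2 \<cdot> (av \<cdot> h) = k2 \<cdot> (av \<cdot> j)" by simp_all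
    have "au \<cdot> h = au \<cdot> j" by (rule pullback_eqI[OF pb1 e(1,2)]) simp_all
    moreover have "av \<cdot> h = av \<cdot> j" by (rule pullback_eqI[OF pb2 e(3,4)]) simp_all
    ultimately show "h = j" by (rule pullback_eqI[OF pba]) simp_all
  qed simp_all
qed

text \<open>Serves to turn arrows into an arbitrary object into arrows of a slice: an arrow into
  \<open>X\<close>, paired with a structure map to the base \<open>Y\<close>, is an arrow over
  \<open>Y\<close> into the product.\<close>

lemma binary_product:
  assumes "has_finite_limits C" "X \<in> Obj C" "Y \<in> Obj C"
  obtains a b where "a \<in> Arr C" "b \<in> Arr C" "Dom C b = Dom C a" "Cod C a = X" "Cod C b = Y"
    "\<And>u v. u \<in> Arr C \<Longrightarrow> v \<in> Arr C \<Longrightarrow> Dom C v = Dom C u \<Longrightarrow> Cod C u = X \<Longrightarrow> Cod C v = Y \<Longrightarrow>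
       \<exists>h. h \<in> Arr C \<and> Dom C h = Dom C u \<and> Cod C h = Dom C a \<and> a \<cdot> h = u \<and> b \<cdot> h = v"
    "\<And>h k. h \<in> Arr C \<Longrightarrow> k \<in> Arr C \<Longrightarrow> Dom C k = Dom C h \<Longrightarrow> Cod C h = Dom C a \<Longrightarrow>
       Cod C k = Dom C a \<Longrightarrow> a \<cdot> h = a \<cdot> k \<Longrightarrow> b \<cdot> h = b \<cdot> k \<Longrightarrow> h = k"
proof -
  \<comment> \<open>The discrete category on two objects: each object is its own identity, and since
    composable arrows are equal, \<open>Cmp\<close> may return its first argument.\<close>
  define J :: "(nat, nat) cat" where "J = \<lparr>Obj = {0,1}, Arr = {0,1}, Dom = (\<lambda>n. n), Cod = (\<lambda>n. n),
    Idn = (\<lambda>n. n), Cmp = (\<lambda>m n. m)\<rparr>"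
  define D where "D = \<lparr>omap = (\<lambda>n::nat. if n = 0 then X else Y),
    amap = (\<lambda>n::nat. Idn C (if n = 0 then X else Y))\<rparr>"
  have J: "category J" by unfold_locales (auto simp: J_def hom_def)
  have D: "is_functor J C D"
    by (intro is_functor.intro J category_axioms is_functor_axioms.intro)
      (auto simp: D_def J_def in_hom_iff assms)
  have "finite (Obj J)" "finite (Arr J)" by (simp_all add: J_def)
  with J D assms(1) obtain L l where L: "is_limit J C D L l" unfolding has_finite_limits_def
    by blast
  have cone: "is_cone J C D M m \<longleftrightarrow> M \<in> Obj C \<and> m 0 \<in> hom C M X \<and> m 1 \<in> hom C M Y" for M m
    unfolding is_cone_def by (auto simp: J_def D_def in_hom_iff)
  have l: "l 0 \<in> Arr C" "l 1 \<in> Arr C" "Dom C (l 0) = L" "Dom C (l 1) = L" "Cod C (l 0) = X"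
    "Cod C (l 1) = Y"
    using L unfolding is_limit_def cone by (auto simp: in_hom_iff)
  have un: "\<exists>!h. h \<in> hom C (Dom C u) L \<and> l 0 \<cdot> h = u \<and> l 1 \<cdot> h = v"
    if "u \<in> Arr C" "v \<in> Arr C" "Dom C v = Dom C u" "Cod C u = X" "Cod C v = Y" for u v
  proof -
    have "is_cone J C D (Dom C u) (\<lambda>n. if n = 0 then u else v)"
      using that by (auto simp: cone in_hom_iff)
    then have "\<exists>!h. h \<in> hom C (Dom C u) L \<and> (\<forall>j \<in> Obj J. l j \<cdot> h = (if j = 0 then u else v))"
      using L unfolding is_limit_def by blast
    then show ?thesis by (simp add: J_def)
  qed
  show thesis
  proof (rule that[of "l 0" "l 1"])
    fix u v assume "u \<in> Arr C" "v \<in> Arr C" "Dom C v = Dom C u" "Cod C u = X" "Cod C v = Y"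
    from un[OF this] show "\<exists>h. h \<in> Arr C \<and> Dom C h = Dom C u \<and> Cod C h = Dom C (l 0) \<and> l 0 \<cdot> h =
      u \<and> l 1 \<cdot> h = v"
      by (auto simp: in_hom_iff l)
  next
    fix h k assume *: "h \<in> Arr C" "k \<in> Arr C" "Dom C k = Dom C h" "Cod C h = Dom C (l 0)"
       "Cod C k = Dom C (l 0)" "l 0 \<cdot> h = l 0 \<cdot> k" "l 1 \<cdot> h = l 1 \<cdot> k"
    then show "h = k"
      using un[of "l 0 \<cdot> k" "l 1 \<cdot> k"] l by (auto simp: in_hom_iff)
  qed (use l in auto)
qed

end

section \<open>Slices, algebras and the comparison functor\<close>

lemma mk_cat_simps [simp]:
  "Obj (mk_cat Ob H i c) = Ob"
  "(X, h, Y) \<in> Arr (mk_cat Ob H i c) \<longleftrightarrow> X \<in> Ob \<and> Y \<in> Ob \<and> H X Y h"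
  "Dom (mk_cat Ob H i c) (X, h, Y) = X"
  "Cod (mk_cat Ob H i c) (X, h, Y) = Y"
  "Idn (mk_cat Ob H i c) X = (X, i X, X)"
  "(Y', g, Z) \<cdot>\<^bsub>mk_cat Ob H i c\<^esub> (X, h, Y) = (X, c g h, Z)"
  by (auto simp: mk_cat_def)

lemma mk_cat_hom:
  "a \<in> hom (mk_cat Ob H i c) X Y \<longleftrightarrow> (\<exists>h. a = (X, h, Y) \<and> X \<in> Ob \<and> Y \<in> Ob \<and> H X Y h)"
  by (auto simp: in_hom_iff mk_cat_def)

lemma mk_cat_Arr:
  "a \<in> Arr (mk_cat Ob H i c) \<longleftrightarrow> (\<exists>X h Y. a = (X, h, Y) \<and> X \<in> Ob \<and> Y \<in> Ob \<and> H X Y h)"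
  by (auto simp: mk_cat_def)

lemma mk_cat_category:
  assumes "\<And>X. X \<in> Ob \<Longrightarrow> H X X (i X)"
    and "\<And>X Y Z f g. X \<in> Ob \<Longrightarrow> Y \<in> Ob \<Longrightarrow> Z \<in> Ob \<Longrightarrow> H X Y f \<Longrightarrow> H Y Z g \<Longrightarrow> H X Z (c g f)"
    and "\<And>X Y f. X \<in> Ob \<Longrightarrow> Y \<in> Ob \<Longrightarrow> H X Y f \<Longrightarrow> c f (i X) = f \<and> c (i Y) f = f"
    and "\<And>W X Y Z f g h. W \<in> Ob \<Longrightarrow> X \<in> Ob \<Longrightarrow> Y \<in> Ob \<Longrightarrow> Z \<in> Ob \<Longrightarrow> H W X f \<Longrightarrow> H X Y g \<Longrightarrow> H Y Z h \<Longrightarrow>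
      c (c h g) f = c h (c g f)"
  shows "category (mk_cat Ob H i c)"
proof
  fix f X Y g Z assume "f \<in> hom (mk_cat Ob H i c) X Y" "g \<in> hom (mk_cat Ob H i c) Y Z"
  then show "g \<cdot>\<^bsub>mk_cat Ob H i c\<^esub> f \<in> hom (mk_cat Ob H i c) X Z"
    unfolding mk_cat_hom using assms(2) by fastforce
qed (use assms in \<open>auto simp: mk_cat_hom mk_cat_Arr\<close>)

lemma comp_cfun_simps [simp]:
  "omap (comp_cfun G F) X = omap G (omap F X)" "amap (comp_cfun G F) f = amap G (amap F f)"
  by (simp_all add: comp_cfun_def)

lemma id_cfun_simps [simp]: "omap id_cfun X = X" "amap id_cfun f = f"
  by (simp_all add: id_cfun_def)

lemma is_functor_comp:
  assumes "is_functor C D F" "is_functor D E G"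
  shows "is_functor C E (comp_cfun G F)"
proof -
  interpret F: is_functor C D F by fact
  interpret G: is_functor D E G by fact
  show ?thesis
    by unfold_locales
      (auto simp: F.omap_in_Obj G.omap_in_Obj F.amap_Idn G.amap_Idn F.amap_Cmp G.amap_Cmp[OF
        F.amap_in_hom F.amap_in_hom]
        intro!: F.amap_in_hom G.amap_in_hom)
qed

lemma is_functor_id: "category C \<Longrightarrow> is_functor C C id_cfun"
  by (intro is_functor.intro is_functor_axioms.intro) auto

lemma (in is_functor) amap_simps:
  assumes "f \<in> Arr C"
  shows "amap F f \<in> Arr D" "Dom D (amap F f) = omap F (Dom C f)"
    "Cod D (amap F f) = omap F (Cod C f)"
  using amap_in_hom[of f "Dom C f" "Cod C f"] assms by (auto simp: in_hom_iff)

lemma (in is_functor) amap_comp: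
  assumes "f \<in> Arr C" "g \<in> Arr C" "Dom C g = Cod C f"
  shows "amap F (g \<cdot>\<^bsub>C\<^esub> f) = amap F g \<cdot>\<^bsub>D\<^esub> amap F f"
  by (rule amap_Cmp) (use assms in \<open>auto simp: in_hom_iff\<close>)

lemma Alg_category:
  assumes "is_functor C C (endo T)"
  shows "category (Alg C T)"
proof -
  interpret T: is_functor C C "endo T" by fact
  note [simp] = T.amap_simps T.omap_in_Obj T.amap_comp T.amap_Idn
  show ?thesis
    unfolding Alg_def
  proof (rule mk_cat_category)
    fix A assume "A \<in> {A. is_algebra C T A}"
    then show "is_algebra_hom C T A A (Idn C (fst A))"
      by (cases A) (auto simp: is_algebra_def is_algebra_hom_def in_hom_iff)
  next
    fix X Y Z f g
    assume "X \<in> {A. is_algebra C T A}" "Y \<in> {A. is_algebra C T A}" "Z \<in> {A. is_algebra C T A}"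
      and h: "is_algebra_hom C T X Y f" "is_algebra_hom C T Y Z g"
    moreover obtain X' \<xi> Y' \<upsilon> Z' \<zeta> where "X = (X', \<xi>)" "Y = (Y', \<upsilon>)" "Z = (Z', \<zeta>)"
      by (metis prod.exhaust)
    ultimately have [simp]: "f \<in> Arr C" "Dom C f = X'" "Cod C f = Y'" "g \<in> Arr C" "Dom C g = Y'"
      "Cod C g = Z'"
        "\<xi> \<in> Arr C" "Cod C \<xi> = X'" "Dom C \<xi> = omap (endo T) X'"
        "\<upsilon> \<in> Arr C" "Cod C \<upsilon> = Y'" "Dom C \<upsilon> = omap (endo T) Y'"
        "\<zeta> \<in> Arr C" "Cod C \<zeta> = Z'" "Dom C \<zeta> = omap (endo T) Z'" "X = (X', \<xi>)" "Y = (Y', \<upsilon>)"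
          "Z = (Z', \<zeta>)"
        and e: "f \<cdot>\<^bsub>C\<^esub> \<xi> = \<upsilon> \<cdot>\<^bsub>C\<^esub> amap (endo T) f" "g \<cdot>\<^bsub>C\<^esub> \<upsilon> = \<zeta> \<cdot>\<^bsub>C\<^esub> amap (endo T) g"
      by (auto simp: is_algebra_def is_algebra_hom_def in_hom_iff)
    note [simp] = e e[THEN T.C.Cmp_reduce]
    show "is_algebra_hom C T X Z (g \<cdot>\<^bsub>C\<^esub> f)"
      by (auto simp: is_algebra_hom_def in_hom_iff)
  qed (auto simp: is_algebra_def is_algebra_hom_def in_hom_iff)
qed

lemma induced_monad_simps:
  "omap (endo (induced_monad F G \<eta> \<epsilon>)) X = omap G (omap F X)"
  "amap (endo (induced_monad F G \<eta> \<epsilon>)) f = amap G (amap F f)"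
  "mult (induced_monad F G \<eta> \<epsilon>) X = amap G (\<epsilon> (omap F X))"
  "unit (induced_monad F G \<eta> \<epsilon>) X = \<eta> X"
  by (simp_all add: induced_monad_def)

text \<open>The unit law of the algebra on \<open>omap G Y\<close> is the triangle identity
  \<open>tri\<close>; its associativity is \<open>G\<close> applied to naturality of
  \<open>\<epsilon>\<close> at the arrow \<open>\<epsilon> Y\<close> itself. Naturality at an
  arbitrary \<open>f\<close> makes \<open>amap G f\<close> a homomorphism.\<close>

lemma comparison_is_functor:
  assumes "is_functor D C G" "is_functor C D F"
    and "\<And>X. X \<in> Obj C \<Longrightarrow> \<eta> X \<in> hom C X (omap G (omap F X))"
    and "is_nat_trans D D (comp_cfun F G) id_cfun \<epsilon>"
    and tri: "\<And>Y. Y \<in> Obj D \<Longrightarrow> amap G (\<epsilon> Y) \<cdot>\<^bsub>C\<^esub> \<eta> (omap G Y) = Idn C (omap G Y)"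
  shows "is_functor D (Alg C (induced_monad F G \<eta> \<epsilon>)) (comparison D G \<epsilon>)"
proof -
  interpret G: is_functor D C G by fact
  interpret F: is_functor C D F by fact
  interpret \<epsilon>: is_nat_trans D D "comp_cfun F G" id_cfun \<epsilon> by fact
  note [simp] = G.amap_simps G.omap_in_Obj F.amap_simps F.omap_in_Obj G.amap_Idn F.amap_Idn
  have \<epsilon>[simp]: "\<epsilon> Y \<in> Arr D" "Dom D (\<epsilon> Y) = omap F (omap G Y)" "Cod D (\<epsilon> Y) = Y" if "Y \<in> Obj D"
    for Y
    using \<epsilon>.component[OF that] by (auto simp: in_hom_iff)
  have nat: "\<epsilon> (Cod D f) \<cdot>\<^bsub>D\<^esub> amap F (amap G f) = f \<cdot>\<^bsub>D\<^esub> \<epsilon> (Dom D f)" if "f \<in> Arr D" for f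
    using \<epsilon>.naturality[of f "Dom D f" "Cod D f"] that by (auto simp: in_hom_iff)
  let ?T = "induced_monad F G \<eta> \<epsilon>"
  have T: "is_functor C C (endo ?T)"
    by (simp add: induced_monad_def is_functor_comp[OF F.is_functor_axioms G.is_functor_axioms])
  interpret A: category "Alg C ?T" by (rule Alg_category[OF T])
  have alg: "is_algebra C ?T (omap G Y, amap G (\<epsilon> Y))" if [simp]: "Y \<in> Obj D" for Y
    using tri nat[of "\<epsilon> Y"]
    by (auto simp: is_algebra_def induced_monad_def in_hom_iff simp flip: G.amap_comp)
  have natG: "amap G f \<cdot>\<^bsub>C\<^esub> amap G (\<epsilon> (Dom D f)) =
    amap G (\<epsilon> (Cod D f)) \<cdot>\<^bsub>C\<^esub> amap G (amap F (amap G f))"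
    if "f \<in> Arr D" for f
    using that nat[of f] by (simp flip: G.amap_comp)
  show ?thesis
    by unfold_locales
      (auto simp: in_hom_iff comparison_def Let_def Alg_def alg is_algebra_hom_def natG G.amap_comp
        induced_monad_simps)
qed

lemma slice_hom:
  "a \<in> hom (slice C b) f g \<longleftrightarrow> (\<exists>h. a = (f, h, g) \<and> f \<in> Arr C \<and> g \<in> Arr C \<and> Cod C f = b \<and> Cod C g =
    b \<and>
    h \<in> Arr C \<and> Dom C h = Dom C f \<and> Cod C h = Dom C g \<and> g \<cdot>\<^bsub>C\<^esub> h = f)"
  unfolding slice_def mk_cat_hom by (simp add: in_hom_iff) blast

lemma slice_Obj [simp]: "f \<in> Obj (slice C b) \<longleftrightarrow> f \<in> Arr C \<and> Cod C f = b"
  by (auto simp: slice_def)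

lemma slice_simps [simp]:
  "(f, h, g) \<in> Arr (slice C b) \<longleftrightarrow> f \<in> Arr C \<and> g \<in> Arr C \<and> Cod C f = b \<and> Cod C g = b \<and>
    h \<in> Arr C \<and> Dom C h = Dom C f \<and> Cod C h = Dom C g \<and> g \<cdot>\<^bsub>C\<^esub> h = f"
  "Dom (slice C b) (f, h, g) = f" "Cod (slice C b) (f, h, g) = g"
  "Idn (slice C b) f = (f, Idn C (Dom C f), f)"
  "(g', k, l) \<cdot>\<^bsub>slice C b\<^esub> (f, h, g) = (f, k \<cdot>\<^bsub>C\<^esub> h, l)"
  by (auto simp: slice_def in_hom_iff)

lemma (in category) slice_category: "category (slice C b)"
  unfolding slice_def
proof (rule mk_cat_category, goal_cases)
  case (2 X Y Z f g)
  then show ?case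
    using Cmp_reduce[of Z g Y f] by (simp add: in_hom_iff)
qed (simp_all add: in_hom_iff)

section \<open>Chosen pullbacks\<close>

locale pb_category = category +
  assumes has_pullbacks: "has_pullbacks C"
begin

lemma pr_pullback:
  assumes "f \<in> Arr C" "g \<in> Arr C" "Cod C g = Cod C f"
  shows "is_pullback C f g (pr1 C f g) (pr2 C f g)"
proof -
  have "\<exists>pq. is_pullback C f g (fst pq) (snd pq)"
    using assms has_pullbacks unfolding has_pullbacks_def by fastforce
  then show ?thesis unfolding pr1_def pr2_def chosen_pb_def by (rule someI_ex)
qed

lemma pr_simps [simp]:
  assumes "f \<in> Arr C" "g \<in> Arr C" "Cod C g = Cod C f"
  shows "pr1 C f g \<in> Arr C" "pr2 C f g \<in> Arr C" "Cod C (pr1 C f g) = Dom C f"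
    "Cod C (pr2 C f g) = Dom C g" "Dom C (pr2 C f g) = Dom C (pr1 C f g)"
  using pullbackD[OF pr_pullback[OF assms]] by auto

lemma pr_commute:
  assumes "f \<in> Arr C" "g \<in> Arr C" "Cod C g = Cod C f"
  shows "f \<cdot> pr1 C f g = g \<cdot> pr2 C f g"
  using pullbackD[OF pr_pullback[OF assms]] by auto

lemma pr_eqI:
  assumes "pr1 C f g \<cdot> h = pr1 C f g \<cdot> k" "pr2 C f g \<cdot> h = pr2 C f g \<cdot> k"
    "f \<in> Arr C" "g \<in> Arr C" "Cod C g = Cod C f" 
    "h \<in> Arr C" "k \<in> Arr C" "Dom C k = Dom C h" "Cod C h = Dom C (pr1 C f g)"
      "Cod C k = Dom C (pr1 C f g)"
  shows "h = k"
  by (rule pullback_eqI[OF pr_pullback]) (use assms in simp_all)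

lemma pb_pair_simps [simp]:
  assumes "f \<in> Arr C" "g \<in> Arr C" "Cod C g = Cod C f" "u \<in> Arr C" "v \<in> Arr C" "Dom C v = Dom C u"
    "Cod C u = Dom C f" "Cod C v = Dom C g" "f \<cdot> u = g \<cdot> v"
  shows "pb_pair C f g u v \<in> Arr C" "Dom C (pb_pair C f g u v) = Dom C u"
    "Cod C (pb_pair C f g u v) = Dom C (pr1 C f g)"
    "pr1 C f g \<cdot> pb_pair C f g u v = u" "pr2 C f g \<cdot> pb_pair C f g u v = v"
proof -
  obtain h where h: "h \<in> Arr C" "Dom C h = Dom C u" "Cod C h = Dom C (pr1 C f g)"
    "pr1 C f g \<cdot> h = u" "pr2 C f g \<cdot> h = v"
    using pullback_lift[OF pr_pullback] assms by metis
  have "pb_pair C f g u v = h"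
    unfolding pb_pair_def pb_obj_def
  proof (rule the_equality)
    fix k assume "k \<in> hom C (Dom C u) (Dom C (pr1 C f g)) \<and> pr1 C f g \<cdot> k = u \<and> pr2 C f g \<cdot> k = v"
    with h assms show "k = h" by - (rule pr_eqI[of f g], auto simp: in_hom_iff)
  qed (use h in \<open>auto simp: in_hom_iff\<close>)
  with h show "pb_pair C f g u v \<in> Arr C" "Dom C (pb_pair C f g u v) = Dom C u"
    "Cod C (pb_pair C f g u v) = Dom C (pr1 C f g)"
    "pr1 C f g \<cdot> pb_pair C f g u v = u" "pr2 C f g \<cdot> pb_pair C f g u v = v" by simp_all
qed

lemma pb_pair_reduce [simp]:
  assumes "f \<in> Arr C" "g \<in> Arr C" "Cod C g = Cod C f" "u \<in> Arr C" "v \<in> Arr C" "Dom C v = Dom C u"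
    "Cod C u = Dom C f" "Cod C v = Dom C g" "f \<cdot> u = g \<cdot> v" "h \<in> Arr C" "Cod C h = Dom C u"
  shows "pr1 C f g \<cdot> (pb_pair C f g u v \<cdot> h) = u \<cdot> h" "pr2 C f g \<cdot> (pb_pair C f g u v \<cdot> h) = v \<cdot> h"
  using pb_pair_simps(4,5)[OF assms(1-9), THEN Cmp_reduce] assms by simp_all

end

section \<open>The adjunction between slices given by an arrow\<close>

locale pb_arrow = pb_category +
  fixes q :: 'b
  assumes q [simp]: "q \<in> Arr C"
begin

abbreviation "P g \<equiv> pr1 C q g"
abbreviation "R g \<equiv> pr2 C q g"
abbreviation "pair g u v \<equiv> pb_pair C q g u v"

lemma commute [simp]: "g \<in> Arr C \<Longrightarrow> Cod C g = Cod C q \<Longrightarrow> g \<cdot> R g = q \<cdot> P g"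
  by (rule pr_commute[symmetric]) auto

lemma commute_reduce [simp]: "g \<in> Arr C \<Longrightarrow> Cod C g = Cod C q \<Longrightarrow> h \<in> Arr C \<Longrightarrow> Cod C h = Dom C (P g) \<Longrightarrow>
   g \<cdot> (R g \<cdot> h) = q \<cdot> (P g \<cdot> h)"
  by (subst commute[THEN Cmp_reduce]) auto

text \<open>The simplifier reassociates \<open>(q \<cdot> f) \<cdot> R (q \<cdot> f)\<close> to the
  right, after which \<open>commute\<close> no longer matches; this instance restores the rewrite
  for structure maps of the form \<open>q \<cdot> f\<close>.\<close>

lemma commute_comp [simp]: "f \<in> Arr C \<Longrightarrow> Cod C f = Dom C q \<Longrightarrow> q \<cdot> (f \<cdot> R (q \<cdot> f)) = q \<cdot> P (q \<cdot> f)"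
  using commute[of "q \<cdot> f"] by (simp del: commute)

lemma commute_comp_reduce [simp]:
  "f \<in> Arr C \<Longrightarrow> Cod C f = Dom C q \<Longrightarrow> h \<in> Arr C \<Longrightarrow> Cod C h = Dom C (P (q \<cdot> f)) \<Longrightarrow>
   q \<cdot> (f \<cdot> (R (q \<cdot> f) \<cdot> h)) = q \<cdot> (P (q \<cdot> f) \<cdot> h)"
  using commute_reduce[of "q \<cdot> f" h] by (simp del: commute_reduce)

lemma slice_push_functor: "is_functor (slice C (Dom C q)) (slice C (Cod C q)) (slice_push C q)"
proof (intro is_functor.intro slice_category is_functor_axioms.intro)
  fix a X Y assume "a \<in> hom (slice C (Dom C q)) X Y"
  then show "amap (slice_push C q) a \<in> hom (slice C (Cod C q)) (omap (slice_push C q) X) (omap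
    (slice_push C q) Y)"
    unfolding slice_hom slice_push_def by (elim exE) simp
next
  fix a X Y b Z assume "a \<in> hom (slice C (Dom C q)) X Y" "b \<in> hom (slice C (Dom C q)) Y Z"
  then show "amap (slice_push C q) (b \<cdot>\<^bsub>slice C (Dom C q)\<^esub> a)
    = amap (slice_push C q) b \<cdot>\<^bsub>slice C (Cod C q)\<^esub> amap (slice_push C q) a"
    unfolding slice_hom slice_push_def by (elim exE) simp
qed (simp_all add: slice_push_def)

lemma slice_pull_functor: "is_functor (slice C (Cod C q)) (slice C (Dom C q)) (slice_pull C q)"
proof (intro is_functor.intro slice_category is_functor_axioms.intro)
  fix a X Y assume "a \<in> hom (slice C (Cod C q)) X Y"
  then obtain h where a: "a = (X, h, Y)" and [simp]: "X \<in> Arr C" "Y \<in> Arr C" "Cod C X = Cod C q"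
    "Cod C Y = Cod C q"
    "h \<in> Arr C" "Dom C h = Dom C X" "Cod C h = Dom C Y" and e: "Y \<cdot> h = X" by (auto simp: slice_hom)
  show "amap (slice_pull C q) a \<in> hom (slice C (Dom C q)) (omap (slice_pull C q) X) (omap
    (slice_pull C q) Y)"
    by (simp add: slice_hom slice_pull_def a e e[THEN Cmp_reduce])
next
  fix X assume "X \<in> Obj (slice C (Cod C q))"
  then have [simp]: "X \<in> Arr C" "Cod C X = Cod C q" by auto
  have "pair X (P X) (R X) = Idn C (Dom C (P X))"
    by (rule pr_eqI[of q X]) simp_all
  then show "amap (slice_pull C q) (Idn (slice C (Cod C q)) X) =
    Idn (slice C (Dom C q)) (omap (slice_pull C q) X)"
    by (simp add: slice_pull_def)
next
  fix a X Y b Z assume "a \<in> hom (slice C (Cod C q)) X Y" "b \<in> hom (slice C (Cod C q)) Y Z"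
  then obtain h k where a: "a = (X, h, Y)" "b = (Y, k, Z)"
    and [simp]: "X \<in> Arr C" "Y \<in> Arr C" "Cod C X = Cod C q" "Cod C Y = Cod C q"
    "h \<in> Arr C" "Dom C h = Dom C X" "Cod C h = Dom C Y" 
    "Z \<in> Arr C" "Cod C Z = Cod C q" "k \<in> Arr C" "Dom C k = Dom C Y" "Cod C k = Dom C Z" 
    and e: "Y \<cdot> h = X" "Z \<cdot> k = Y" by (auto simp: slice_hom)
  have [simp]: "Z \<cdot> (k \<cdot> h) = X" "Z \<cdot> (k \<cdot> (h \<cdot> R X)) = q \<cdot> P X" using e e[THEN Cmp_reduce]
    by simp_all
  note [simp] = e e[THEN Cmp_reduce]
  have "pair Z (P X) ((k \<cdot> h) \<cdot> R X) = pair Z (P Y) (k \<cdot> R Y) \<cdot> pair Y (P X) (h \<cdot> R X)"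
    by (rule pr_eqI[of q Z]) simp_all
  then show "amap (slice_pull C q) (b \<cdot>\<^bsub>slice C (Cod C q)\<^esub> a)
    = amap (slice_pull C q) b \<cdot>\<^bsub>slice C (Dom C q)\<^esub> amap (slice_pull C q) a"
    by (simp add: slice_pull_def a)
qed (simp add: slice_pull_def)

lemma slice_counit_natural:
  "is_nat_trans (slice C (Cod C q)) (slice C (Cod C q)) (comp_cfun (slice_push C q) (slice_pull C
    q)) id_cfun
     (slice_counit C q)"
proof (intro is_nat_trans.intro is_nat_trans_axioms.intro is_functor_id slice_category
    is_functor_comp[OF slice_pull_functor slice_push_functor])
  fix f X Y assume "f \<in> hom (slice C (Cod C q)) X Y"
  then obtain h where "f = (X, h, Y)" and [simp]: "X \<in> Arr C" "Y \<in> Arr C" "Cod C X = Cod C q"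
    "Cod C Y = Cod C q"
    "h \<in> Arr C" "Dom C h = Dom C X" "Cod C h = Dom C Y" and e: "Y \<cdot> h = X" by (auto simp: slice_hom)
  then show "slice_counit C q Y \<cdot>\<^bsub>slice C (Cod C q)\<^esub> amap (comp_cfun (slice_push C q) (slice_pull
    C q)) f =
       amap id_cfun f \<cdot>\<^bsub>slice C (Cod C q)\<^esub> slice_counit C q X"
    by (simp add: slice_counit_def slice_pull_def slice_push_def e[THEN Cmp_reduce])
qed (simp add: slice_hom slice_counit_def slice_push_def slice_pull_def)

text \<open>The triangle identity of the adjunction between \<open>slice_push\<close> and
  \<open>slice_pull\<close> on underlying arrows: the first factor is the pullback of the counit at
  \<open>g\<close>, the second is the unit at \<open>P g\<close>.\<close>

lemma pair_triangle:
  assumes [simp]: "g \<in> Arr C" "Cod C g = Cod C q"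
  shows "pair g (P (q \<cdot> P g)) (R g \<cdot> R (q \<cdot> P g)) \<cdot> pair (q \<cdot> P g) (P g) (Idn C (Dom C (P g))) =
    Idn C (Dom C (P g))"
  by (rule pr_eqI[of q g]) simp_all

lemma descent_comparison_functor:
  "is_functor (slice C (Cod C q)) (descent_Alg C q) (descent_comparison C q)"
  unfolding descent_Alg_def descent_monad_def descent_comparison_def
  by (rule comparison_is_functor[OF slice_pull_functor slice_push_functor _ slice_counit_natural])
    (simp_all add: slice_hom slice_unit_def slice_push_def slice_pull_def slice_counit_def
      pair_triangle)

end

section \<open>Equivalences of categories\<close>

definition ess_surj :: "('o1, 'a1) cat \<Rightarrow> ('o2, 'a2) cat \<Rightarrow> ('o1, 'a1, 'o2, 'a2) cfun \<Rightarrow> bool" where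
  "ess_surj C D F \<longleftrightarrow> (\<forall>Y \<in> Obj D. \<exists>X \<in> Obj C. \<exists>t \<in> hom D (omap F X) Y. is_iso D t)"

lemma is_isoE:
  assumes "is_iso C f"
  obtains g where "f \<in> Arr C" "g \<in> Arr C" "Dom C g = Cod C f" "Cod C g = Dom C f"
    "g \<cdot>\<^bsub>C\<^esub> f = Idn C (Dom C f)" "f \<cdot>\<^bsub>C\<^esub> g = Idn C (Cod C f)"
  using assms by (auto simp: is_iso_def in_hom_iff)

lemma is_isoI:
  assumes "f \<in> Arr C" "g \<in> Arr C" "Dom C g = Cod C f" "Cod C g = Dom C f"
    "g \<cdot>\<^bsub>C\<^esub> f = Idn C (Dom C f)" "f \<cdot>\<^bsub>C\<^esub> g = Idn C (Cod C f)"
  shows "is_iso C f"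
  using assms by (auto simp: is_iso_def in_hom_iff)

lemma (in category) iso_cancel:
  assumes "is_iso C s" "f \<in> Arr C" "g \<in> Arr C"
  shows "Dom C f = Cod C s \<Longrightarrow> Dom C g = Cod C s \<Longrightarrow> f \<cdot> s = g \<cdot> s \<Longrightarrow> f = g"
    and "Cod C f = Dom C s \<Longrightarrow> Cod C g = Dom C s \<Longrightarrow> s \<cdot> f = s \<cdot> g \<Longrightarrow> f = g"
proof -
  obtain r where r [simp]: "s \<in> Arr C" "r \<in> Arr C" "Dom C r = Cod C s" "Cod C r = Dom C s"
    "r \<cdot> s = Idn C (Dom C s)" "s \<cdot> r = Idn C (Cod C s)" using is_isoE[OF assms(1)] by blast
  note [simp] = r(5,6)[THEN Cmp_reduce] assms(2,3)
  show "f = g" if "Dom C f = Cod C s" "Dom C g = Cod C s" "f \<cdot> s = g \<cdot> s"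
    using arg_cong[OF that(3), of "\<lambda>z. z \<cdot> r"] that(1,2) by simp
  show "f = g" if "Cod C f = Dom C s" "Cod C g = Dom C s" "s \<cdot> f = s \<cdot> g"
    using arg_cong[OF that(3), of "\<lambda>z. r \<cdot> z"] that(1,2) by simp
qed

lemma equivalence_functorD:
  assumes "equivalence_functor C D F"
  shows "is_functor C D F" "faithful_functor C D F" "full_functor C D F" "ess_surj C D F"
proof -
  from assms obtain G s t where "is_functor C D F" and G: "is_functor D C G"
    and s: "is_nat_iso C C id_cfun (comp_cfun G F) s"
      and t: "is_nat_iso D D (comp_cfun F G) id_cfun t"
    unfolding equivalence_functor_def by blast
  then interpret F: is_functor C D F by simp
  interpret G: is_functor D C G by fact
  interpret s: is_nat_trans C C id_cfun "comp_cfun G F" s using s by (simp add: is_nat_iso_def)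
  interpret t: is_nat_trans D D "comp_cfun F G" id_cfun t using t by (simp add: is_nat_iso_def)
  have si: "is_iso C (s X)" if "X \<in> Obj C" for X using s that by (simp add: is_nat_iso_def)
  have ti: "is_iso D (t X)" if "X \<in> Obj D" for X using t that by (simp add: is_nat_iso_def)
  have sh[simp]: "s X \<in> Arr C" "Dom C (s X) = X" "Cod C (s X) = omap G (omap F X)" if "X \<in> Obj C"
    for X
    using s.component[OF that] by (auto simp: in_hom_iff)
  have th[simp]: "t X \<in> Arr D" "Cod D (t X) = X" "Dom D (t X) = omap F (omap G X)" if "X \<in> Obj D"
    for X
    using t.component[OF that] by (auto simp: in_hom_iff)
  note [simp] = F.amap_simps F.omap_in_Obj F.amap_comp F.amap_Idn G.amap_simps G.omap_in_Obj
    G.amap_comp G.amap_Idn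
  have sn: "s (Cod C f) \<cdot>\<^bsub>C\<^esub> f = amap G (amap F f) \<cdot>\<^bsub>C\<^esub> s (Dom C f)" if "f \<in> Arr C" for f
    using s.naturality[of f "Dom C f" "Cod C f"] that by (auto simp: in_hom_iff)
  have tn: "t (Cod D f) \<cdot>\<^bsub>D\<^esub> amap F (amap G f) = f \<cdot>\<^bsub>D\<^esub> t (Dom D f)" if "f \<in> Arr D" for f
    using t.naturality[of f "Dom D f" "Cod D f"] that by (auto simp: in_hom_iff)
  show "is_functor C D F" by fact
  have Ff: "f = g" if e: "amap F f = amap F g" and [simp]: "f \<in> Arr C" "g \<in> Arr C"
    "Dom C g = Dom C f" "Cod C g = Cod C f"
    for f g
    by (rule F.C.iso_cancel(2)[OF si[of "Cod C f"]]) (use sn[of f] sn[of g] e in simp_all)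
  show "faithful_functor C D F"
    unfolding faithful_functor_def using F.is_functor_axioms Ff
      by (auto simp: in_hom_iff intro!: inj_onI)
  \<comment> \<open>Naturality of \<open>t\<close> recovers \<open>f\<close> composed with
    \<open>t\<close> from \<open>amap F (amap G f)\<close>, and \<open>t\<close> is invertible; so
    \<open>G\<close> is faithful too.\<close>
  have Gf: "f = g" if e: "amap G f = amap G g" and [simp]: "f \<in> Arr D" "g \<in> Arr D"
    "Dom D g = Dom D f" "Cod D g = Cod D f"
    for f g
    by (rule F.D.iso_cancel(1)[OF ti[of "Dom D f"]]) (use tn[of f] tn[of g] e in simp_all)
  show "full_functor C D F"
    unfolding full_functor_def
  proof (intro conjI ballI equalityI subsetI)
    fix X Y k assume [simp]: "X \<in> Obj C" "Y \<in> Obj C" and "k \<in> hom D (omap F X) (omap F Y)"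
    then have [simp]: "k \<in> Arr D" "Dom D k = omap F X" "Cod D k = omap F Y"
      by (auto simp: in_hom_iff)
    obtain r where [simp]: "r \<in> Arr C" "Dom C r = omap G (omap F Y)" "Cod C r = Y"
      and r: "s Y \<cdot>\<^bsub>C\<^esub> r = Idn C (omap G (omap F Y))" using is_isoE[OF si[of Y]] by auto
    \<comment> \<open>The candidate preimage of \<open>k\<close>. As \<open>r\<close> inverts
      \<open>s Y\<close>, it satisfies \<open>s Y \<cdot> h = amap G k \<cdot> s X\<close>, whence
      \<open>amap G (amap F h) = amap G k\<close>; faithfulness of \<open>G\<close> then removes
      \<open>G\<close>.\<close>
    define h where "h = r \<cdot>\<^bsub>C\<^esub> (amap G k \<cdot>\<^bsub>C\<^esub> s X)"
    have [simp]: "h \<in> Arr C" "Dom C h = X" "Cod C h = Y" by (simp_all add: h_def)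
    have "s Y \<cdot>\<^bsub>C\<^esub> h = amap G k \<cdot>\<^bsub>C\<^esub> s X" using r[THEN F.C.Cmp_reduce] by (simp add: h_def)
    then have "amap G (amap F h) \<cdot>\<^bsub>C\<^esub> s X = amap G k \<cdot>\<^bsub>C\<^esub> s X" using sn[of h] by simp
    then have "amap G (amap F h) = amap G k"
      by (rule F.C.iso_cancel(1)[OF si[of X], rotated -1]) simp_all
    then have "amap F h = k" by (rule Gf) simp_all
    moreover have "h \<in> hom C X Y" by (simp add: in_hom_iff)
    ultimately show "k \<in> amap F ` hom C X Y" by blast
  qed (auto simp: F.is_functor_axioms in_hom_iff)
  show "ess_surj C D F"
    unfolding ess_surj_def using ti t.component
      by (metis G.omap_in_Obj comp_cfun_simps(1) id_cfun_simps(1))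
qed

lemma equivalence_functorI:
  assumes ff: "faithful_functor C D F" and fu: "full_functor C D F" and es: "ess_surj C D F"
  shows "equivalence_functor C D F"
proof -
  interpret F: is_functor C D F using ff by (simp add: faithful_functor_def)
  note [simp] = F.amap_simps F.omap_in_Obj F.amap_comp F.amap_Idn
  have "\<forall>Y \<in> Obj D. \<exists>X t r. X \<in> Obj C \<and> t \<in> Arr D \<and> Dom D t = omap F X \<and> Cod D t = Y \<and>
      r \<in> Arr D \<and> Dom D r = Y \<and> Cod D r = omap F X \<and> r \<cdot>\<^bsub>D\<^esub> t = Idn D (omap F X) \<and> t \<cdot>\<^bsub>D\<^esub> r = Idn
        D Y"
  proof
    fix Y assume "Y \<in> Obj D"
    then obtain X t where X: "X \<in> Obj C" and t: "t \<in> hom D (omap F X) Y" and i: "is_iso D t"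
      using es unfolding ess_surj_def by blast
    obtain r where "r \<in> Arr D" "Dom D r = Cod D t" "Cod D r = Dom D t"
       "r \<cdot>\<^bsub>D\<^esub> t = Idn D (Dom D t)" "t \<cdot>\<^bsub>D\<^esub> r = Idn D (Cod D t)" using is_isoE[OF i] by blast
    with X t show "\<exists>X t r. X \<in> Obj C \<and> t \<in> Arr D \<and> Dom D t = omap F X \<and> Cod D t = Y \<and>
      r \<in> Arr D \<and> Dom D r = Y \<and> Cod D r = omap F X \<and> r \<cdot>\<^bsub>D\<^esub> t = Idn D (omap F X) \<and> t \<cdot>\<^bsub>D\<^esub> r = Idn
        D Y"
      by (intro exI[of _ X] exI[of _ t] exI[of _ r]) (auto simp: in_hom_iff)
  qed
  then obtain Go t r where Go: "\<And>Y. Y \<in> Obj D \<Longrightarrow> Go Y \<in> Obj C \<and> t Y \<in> Arr D \<and> Dom D (t Y) =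
    omap F (Go Y) \<and> Cod D (t Y) = Y \<and>
      r Y \<in> Arr D \<and> Dom D (r Y) = Y \<and> Cod D (r Y) = omap F (Go Y) \<and> r Y \<cdot>\<^bsub>D\<^esub> t Y = Idn D (omap F
        (Go Y)) \<and> t Y \<cdot>\<^bsub>D\<^esub> r Y = Idn D Y"
    by metis
  then have [simp]: "Go Y \<in> Obj C" "t Y \<in> Arr D" "Dom D (t Y) = omap F (Go Y)" "Cod D (t Y) = Y"
      "r Y \<in> Arr D" "Dom D (r Y) = Y" "Cod D (r Y) = omap F (Go Y)"
      and rt: "r Y \<cdot>\<^bsub>D\<^esub> t Y = Idn D (omap F (Go Y))" "t Y \<cdot>\<^bsub>D\<^esub> r Y = Idn D Y" if "Y \<in> Obj D" for Y
    using that by auto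
  note [simp] = rt rt[THEN F.D.Cmp_reduce]
  \<comment> \<open>The inverse of \<open>F\<close> on hom-sets. Its uniqueness property
    \<open>Lun\<close> yields the later equations in \<open>C\<close> by comparing images under
    \<open>F\<close>.\<close>
  define L where "L X Y k = (THE h. h \<in> hom C X Y \<and> amap F h = k)" for X Y k
  have Lun: "h = L X Y k" if "X \<in> Obj C" "Y \<in> Obj C" "h \<in> Arr C" "Dom C h = X" "Cod C h = Y"
    "amap F h = k" for X Y h k
  proof -
    have "inj_on (amap F) (hom C X Y)" using ff that unfolding faithful_functor_def by blast
    then show ?thesis unfolding L_def using that
      by (intro the_equality[symmetric]) (auto simp: in_hom_iff dest: inj_onD)
  qed
  have L: "L X Y k \<in> Arr C" "Dom C (L X Y k) = X" "Cod C (L X Y k) = Y" "amap F (L X Y k) = k"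
    if o: "X \<in> Obj C" "Y \<in> Obj C" and k: "k \<in> Arr D" "Dom D k = omap F X" "Cod D k = omap F Y"
      for X Y k
  proof -
    have "amap F ` hom C X Y = hom D (omap F X) (omap F Y)" using fu o unfolding full_functor_def
      by blast
    then have "k \<in> amap F ` hom C X Y" using k by (simp add: in_hom_iff)
    then obtain h where "h \<in> Arr C" "Dom C h = X" "Cod C h = Y" "amap F h = k"
      by (auto simp: in_hom_iff)
    with Lun[OF o] show "L X Y k \<in> Arr C" "Dom C (L X Y k) = X" "Cod C (L X Y k) = Y"
      "amap F (L X Y k) = k"
      by auto
  qed
  note [simp] = L
  define G where "G = \<lparr>omap = Go, amap = (\<lambda>k. L (Go (Dom D k)) (Go (Cod D k))
     (r (Cod D k) \<cdot>\<^bsub>D\<^esub> (k \<cdot>\<^bsub>D\<^esub> t (Dom D k))))\<rparr>"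
  have G: "is_functor D C G"
    by (intro is_functor.intro F.D.category_axioms F.C.category_axioms is_functor_axioms.intro)
      (auto simp: G_def in_hom_iff intro!: Lun[symmetric])
  define s where "s X = L X (Go (omap F X)) (r (omap F X))" for X
  have s: "is_nat_trans C C id_cfun (comp_cfun G F) s"
  proof (intro is_nat_trans.intro is_nat_trans_axioms.intro is_functor_id F.C.category_axioms
     is_functor_comp[OF F.is_functor_axioms G])
    fix f X Y assume "f \<in> hom C X Y"
    then have [simp]: "f \<in> Arr C" "X = Dom C f" "Y = Cod C f" by (auto simp: in_hom_iff)
    show "s Y \<cdot>\<^bsub>C\<^esub> amap id_cfun f = amap (comp_cfun G F) f \<cdot>\<^bsub>C\<^esub> s X"
      by (rule Lun[THEN trans, OF _ _ _ _ _ _ Lun[symmetric]]) (simp_all add: s_def G_def)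
  qed (simp add: in_hom_iff s_def G_def)
  have si: "is_iso C (s X)" if "X \<in> Obj C" for X
  proof (rule is_isoI)
    show "L (Go (omap F X)) X (t (omap F X)) \<cdot>\<^bsub>C\<^esub> s X = Idn C (Dom C (s X))"
      by (rule Lun[THEN trans, OF _ _ _ _ _ _ Lun[symmetric]]) (simp_all add: s_def that)
    show "s X \<cdot>\<^bsub>C\<^esub> L (Go (omap F X)) X (t (omap F X)) = Idn C (Cod C (s X))"
      by (rule Lun[THEN trans, OF _ _ _ _ _ _ Lun[symmetric]]) (simp_all add: s_def that)
  qed (simp_all add: that s_def)
  have t: "is_nat_trans D D (comp_cfun F G) id_cfun t"
  proof (intro is_nat_trans.intro is_nat_trans_axioms.intro is_functor_id F.D.category_axioms
     is_functor_comp[OF G F.is_functor_axioms])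
    fix f X Y assume "f \<in> hom D X Y"
    then have [simp]: "f \<in> Arr D" "X = Dom D f" "Y = Cod D f" by (auto simp: in_hom_iff)
    show "t Y \<cdot>\<^bsub>D\<^esub> amap (comp_cfun F G) f = amap id_cfun f \<cdot>\<^bsub>D\<^esub> t X"
      by (simp add: G_def)
  qed (simp add: in_hom_iff G_def)
  have ti: "is_iso D (t Y)" if "Y \<in> Obj D" for Y
    by (rule is_isoI[of _ _ "r Y"]) (simp_all add: that)
  show ?thesis
    unfolding equivalence_functor_def is_nat_iso_def using F.is_functor_axioms G s si t ti by blast
qed

section \<open>Descent in terms of stable epimorphisms and actions\<close>

text \<open>A coequalizer of its kernel pair, where pairs of arrows identified by \<open>q\<close> replace the kernel pair.
  The factorization is unique only if \<open>q\<close> is also epi, which is assumed separately.\<close>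

definition regular_epi :: "('o, 'a) cat \<Rightarrow> 'a \<Rightarrow> bool" where
  "regular_epi C q \<longleftrightarrow> q \<in> Arr C \<and>
    (\<forall>u \<in> Arr C. Dom C u = Dom C q \<longrightarrow>
      (\<forall>s \<in> Arr C. \<forall>t \<in> Arr C. Dom C t = Dom C s \<longrightarrow> Cod C s = Dom C q \<longrightarrow> Cod C t = Dom C q \<longrightarrow>
        q \<cdot>\<^bsub>C\<^esub> s = q \<cdot>\<^bsub>C\<^esub> t \<longrightarrow> u \<cdot>\<^bsub>C\<^esub> s = u \<cdot>\<^bsub>C\<^esub> t) \<longrightarrow>
      (\<exists>v \<in> Arr C. Dom C v = Cod C q \<and> v \<cdot>\<^bsub>C\<^esub> q = u))"

text \<open>All pullback squares are meant, not only the chosen ones, so that squares assembled from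
  components or from chains can be inserted directly.\<close>

definition stably :: "(('o, 'a) cat \<Rightarrow> 'a \<Rightarrow> bool) \<Rightarrow> ('o, 'a) cat \<Rightarrow> 'a \<Rightarrow> bool" where
  "stably Q C q \<longleftrightarrow> (\<forall>g p' q'. is_pullback C q g p' q' \<longrightarrow> Q C q')"

text \<open>Elementwise form of algebras: \<open>act t \<alpha>\<close> stands for \<open>\<xi> \<cdot> (t, \<alpha>)\<close>. The value of \<open>act\<close> on pairs that
  are not composable is irrelevant.\<close>

definition composable :: "('o, 'a) cat \<Rightarrow> 'a \<Rightarrow> 'a \<Rightarrow> 'a \<Rightarrow> 'a \<Rightarrow> bool" where
  "composable C q f t \<alpha> \<longleftrightarrow> t \<in> Arr C \<and> \<alpha> \<in> Arr C \<and> Dom C \<alpha> = Dom C t \<and> Cod C t = Dom C q \<and>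
     Cod C \<alpha> = Dom C f \<and> q \<cdot>\<^bsub>C\<^esub> t = q \<cdot>\<^bsub>C\<^esub> (f \<cdot>\<^bsub>C\<^esub> \<alpha>)"

text \<open>The clause for \<open>h\<close> is naturality in the stage of definition, so by the
  Yoneda lemma \<open>act\<close> amounts on composable pairs to a single arrow out of the pullback
  of \<open>q\<close> and \<open>q \<cdot> f\<close>. The clause for \<open>s\<close> and the last
  clause are the associativity and unit laws of that arrow.\<close>

definition descent_action :: "('o, 'a) cat \<Rightarrow> 'a \<Rightarrow> 'a \<Rightarrow> ('a \<Rightarrow> 'a \<Rightarrow> 'a) \<Rightarrow> bool" where
  "descent_action C q f act \<longleftrightarrow> f \<in> Arr C \<and> Cod C f = Dom C q \<and>
    (\<forall>t \<alpha>. composable C q f t \<alpha> \<longrightarrow>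
      act t \<alpha> \<in> Arr C \<and> Dom C (act t \<alpha>) = Dom C t \<and> Cod C (act t \<alpha>) = Dom C f \<and>
      f \<cdot>\<^bsub>C\<^esub> act t \<alpha> = t \<and>
      (\<forall>h \<in> Arr C. Cod C h = Dom C t \<longrightarrow> act t \<alpha> \<cdot>\<^bsub>C\<^esub> h = act (t \<cdot>\<^bsub>C\<^esub> h) (\<alpha> \<cdot>\<^bsub>C\<^esub> h)) \<and>
      (\<forall>s \<in> Arr C. Dom C s = Dom C t \<longrightarrow> Cod C s = Dom C q \<longrightarrow> q \<cdot>\<^bsub>C\<^esub> s = q \<cdot>\<^bsub>C\<^esub> t \<longrightarrow>
        act s (act t \<alpha>) = act s \<alpha>)) \<and>
    (\<forall>\<alpha> \<in> Arr C. Cod C \<alpha> = Dom C f \<longrightarrow> act (f \<cdot>\<^bsub>C\<^esub> \<alpha>) \<alpha> = \<alpha>)"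

text \<open>Since \<open>f\<close> and \<open>\<pi>\<close> are jointly monic, invariance of
  \<open>\<pi>\<close> identifies \<open>act\<close> with the canonical action on the pullback of
  \<open>g\<close>, which replaces the first component and keeps the second.\<close>

definition actions_descend :: "('o, 'a) cat \<Rightarrow> 'a \<Rightarrow> bool" where
  "actions_descend C q \<longleftrightarrow> (\<forall>f act. descent_action C q f act \<longrightarrow>
    (\<exists>g \<pi>. is_pullback C q g f \<pi> \<and>
      (\<forall>t \<alpha>. composable C q f t \<alpha> \<longrightarrow> \<pi> \<cdot>\<^bsub>C\<^esub> act t \<alpha> = \<pi> \<cdot>\<^bsub>C\<^esub> \<alpha>)))"

text \<open>An algebra of the descent monad stripped of the slice bookkeeping. As \<open>r1\<close>
  and \<open>r2\<close> project from the twofold application of the monad, the two pairs in the last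
  clause are the image of \<open>\<xi>\<close> under the monad and the multiplication.\<close>

definition descent_datum :: "('o, 'a) cat \<Rightarrow> 'a \<Rightarrow> 'a \<Rightarrow> 'a \<Rightarrow> bool" where
  "descent_datum C q f \<xi> \<longleftrightarrow> f \<in> Arr C \<and> Cod C f = Dom C q \<and> \<xi> \<in> Arr C \<and>
     Dom C \<xi> = Dom C (pr1 C q (q \<cdot>\<^bsub>C\<^esub> f)) \<and> Cod C \<xi> = Dom C f \<and> f \<cdot>\<^bsub>C\<^esub> \<xi> = pr1 C q (q \<cdot>\<^bsub>C\<^esub> f) \<and>
     \<xi> \<cdot>\<^bsub>C\<^esub> pb_pair C q (q \<cdot>\<^bsub>C\<^esub> f) f (Idn C (Dom C f)) = Idn C (Dom C f) \<and>
     (let r1 = pr1 C q (q \<cdot>\<^bsub>C\<^esub> pr1 C q (q \<cdot>\<^bsub>C\<^esub> f)); r2 = pr2 C q (q \<cdot>\<^bsub>C\<^esub> pr1 C q (q \<cdot>\<^bsub>C\<^esub> f)) in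
      \<xi> \<cdot>\<^bsub>C\<^esub> pb_pair C q (q \<cdot>\<^bsub>C\<^esub> f) r1 (\<xi> \<cdot>\<^bsub>C\<^esub> r2) = \<xi> \<cdot>\<^bsub>C\<^esub> pb_pair C q (q \<cdot>\<^bsub>C\<^esub> f) r1 (pr2 C q (q
        \<cdot>\<^bsub>C\<^esub> f) \<cdot>\<^bsub>C\<^esub> r2))"

lemma composableD:
  assumes "composable C q f t \<alpha>"
  shows "t \<in> Arr C" "\<alpha> \<in> Arr C" "Dom C \<alpha> = Dom C t" "Cod C t = Dom C q" "Cod C \<alpha> = Dom C f"
    "q \<cdot>\<^bsub>C\<^esub> (f \<cdot>\<^bsub>C\<^esub> \<alpha>) = q \<cdot>\<^bsub>C\<^esub> t"
  using assms by (auto simp: composable_def)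

section \<open>Descent data, and faithfulness and fullness of the comparison functor\<close>

context pb_arrow
begin

text \<open>The pullback of the counit at \<open>g\<close>. On generalized elements it sends
  \<open>(t, (s, \<alpha>))\<close> to \<open>(t, \<alpha>)\<close>, forgetting the intermediate
  point \<open>s\<close> of the source of \<open>q\<close>.\<close>

abbreviation "cact g \<equiv> pair g (P (q \<cdot> P g)) (R g \<cdot> R (q \<cdot> P g))"

lemma comparison_simps:
  "omap (descent_comparison C q) g = (P g, (P (q \<cdot> P g), cact g, P g))"
  "amap (descent_comparison C q) (f, h, g) =
    ((P f, (P (q \<cdot> P f), cact f, P f)), (P f, pair g (P f) (h \<cdot> R f), P g), (P g, (P (q \<cdot> P g),
      cact g, P g)))"
  by (simp_all add: descent_comparison_def comparison_def Let_def slice_pull_def slice_counit_def)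

lemma descent_monad_simps:
  "omap (endo (descent_monad C q)) f = P (q \<cdot> f)"
  "amap (endo (descent_monad C q)) (f, h, g) = (P (q \<cdot> f),
    pair (q \<cdot> g) (P (q \<cdot> f)) (h \<cdot> R (q \<cdot> f)), P (q \<cdot> g))"
  "mult (descent_monad C q) f = (P (q \<cdot> P (q \<cdot> f)),
    pair (q \<cdot> f) (P (q \<cdot> P (q \<cdot> f))) (R (q \<cdot> f) \<cdot> R (q \<cdot> P (q \<cdot> f))), P (q \<cdot> f))"
  "unit (descent_monad C q) f = (f, pair (q \<cdot> f) f (Idn C (Dom C f)), P (q \<cdot> f))"
  by (simp_all add: descent_monad_def induced_monad_simps slice_pull_def slice_push_def
    slice_unit_def slice_counit_def)

lemma is_algebra_iff:
  "is_algebra (slice C (Dom C q)) (descent_monad C q) (f, A) \<longleftrightarrow>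
    (\<exists>\<xi>. A = (P (q \<cdot> f), \<xi>, f) \<and> descent_datum C q f \<xi>)"
proof -
  have "is_algebra (slice C (Dom C q)) (descent_monad C q) (f, (P (q \<cdot> f), \<xi>, f)) \<longleftrightarrow>
    descent_datum C q f \<xi>" for \<xi>
    by (auto simp: is_algebra_def slice_hom descent_monad_simps descent_datum_def Let_def)
  moreover have "is_algebra (slice C (Dom C q)) (descent_monad C q) (f, A) \<Longrightarrow> \<exists>\<xi>. A = (P (q \<cdot> f),
    \<xi>, f)"
    unfolding is_algebra_def slice_hom descent_monad_simps by auto
  ultimately show ?thesis by blast
qed

lemma is_algebra_hom_iff:
  "is_algebra_hom (slice C (Dom C q)) (descent_monad C q) (f, (P (q \<cdot> f), \<xi>, f)) (g, (P (q \<cdot> g),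
    \<zeta>, g)) k \<longleftrightarrow>
    (\<exists>h. k = (f, h, g) \<and> f \<in> Arr C \<and> g \<in> Arr C \<and> Cod C f = Dom C q \<and> Cod C g = Dom C q \<and> h \<in> Arr C \<and>
      Dom C h = Dom C f \<and> Cod C h = Dom C g \<and> g \<cdot> h = f \<and> h \<cdot> \<xi> = \<zeta> \<cdot> pair (q \<cdot> g) (P (q \<cdot> f)) (h
        \<cdot> R (q \<cdot> f)))"
  unfolding is_algebra_hom_def slice_hom by (auto simp: descent_monad_simps)

lemma descent_Alg_simps [simp]:
  "Obj (descent_Alg C q) = {A. is_algebra (slice C (Dom C q)) (descent_monad C q) A}"
  "Dom (descent_Alg C q) (A, k, B) = A" "Cod (descent_Alg C q) (A, k, B) = B"
  "Idn (descent_Alg C q) A = (A, Idn (slice C (Dom C q)) (fst A), A)"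
  "(B, l, D) \<cdot>\<^bsub>descent_Alg C q\<^esub> (A, k, B') = (A, l \<cdot>\<^bsub>slice C (Dom C q)\<^esub> k, D)"
  by (simp_all add: descent_Alg_def Alg_def)

lemma descent_Alg_hom:
  "a \<in> hom (descent_Alg C q) A B \<longleftrightarrow> (\<exists>k. a = (A, k, B) \<and>
     is_algebra (slice C (Dom C q)) (descent_monad C q) A \<and> is_algebra (slice C (Dom C q))
       (descent_monad C q) B \<and>
     is_algebra_hom (slice C (Dom C q)) (descent_monad C q) A B k)"
  by (simp add: descent_Alg_def Alg_def mk_cat_hom)

lemma comparison_algebra:
  assumes "g \<in> Arr C" "Cod C g = Cod C q"
  shows "is_algebra (slice C (Dom C q)) (descent_monad C q) (P g, (P (q \<cdot> P g), cact g, P g))"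
  using is_functor.omap_in_Obj[OF descent_comparison_functor, of g] assms
  by (simp add: comparison_simps)

text \<open>The premise on \<open>Q\<close> says that it is invariant under precomposition with isomorphisms.\<close>

lemma stably_if_chosen:
  assumes iso: "\<And>q' k l. q' \<in> Arr C \<Longrightarrow> Q C (q' \<cdot> l) \<Longrightarrow> k \<in> Arr C \<Longrightarrow> l \<in> Arr C \<Longrightarrow>
      Dom C k = Dom C q' \<Longrightarrow> Cod C k = Dom C l \<Longrightarrow> Cod C l = Dom C q' \<Longrightarrow> l \<cdot> k = Idn C (Dom C q') \<Longrightarrow> Q C
        q'"
    and "\<And>g. g \<in> Arr C \<Longrightarrow> Cod C g = Cod C q \<Longrightarrow> Q C (R g)"
  shows "stably Q C q"
  unfolding stably_def
proof (intro allI impI)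
  fix g p' q' assume pb: "is_pullback C q g p' q'"
  note [simp] = pullbackD(1-8)[OF pb]
  obtain k l where kl: "k \<in> Arr C" "l \<in> Arr C" "Dom C k = Dom C p'" "Cod C k = Dom C (P g)"
    "Dom C l = Dom C (P g)"
    "Cod C l = Dom C p'" "l \<cdot> k = Idn C (Dom C p')" "q' \<cdot> l = R g"
    by (rule pullback_unique_iso[OF pr_pullback[of q g] pb]) simp_all
  show "Q C q'"
    by (rule iso[of q' l k]) (use kl assms(2)[of g] in simp_all)
qed

text \<open>Faithfulness compares only arrows of the slice, whereas \<open>u\<close> and
  \<open>v\<close> are arbitrary. Paired with \<open>g\<close>, they become arrows from
  \<open>g\<close> to the projection of a product onto the base; the pullbacks of these along
  \<open>q\<close> agree because \<open>u\<close> and \<open>v\<close> agree after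
  \<open>R g\<close>.\<close>

lemma faithful_imp_stably_epi:
  assumes fl: "has_finite_limits C"
    and "faithful_functor (slice C (Cod C q)) (descent_Alg C q) (descent_comparison C q)"
  shows "stably epi C q"
proof (rule stably_if_chosen)
  fix q' k l assume h: "q' \<in> Arr C" "k \<in> Arr C" "l \<in> Arr C" "epi C (q' \<cdot> l)"
    "Dom C k = Dom C q'" "Cod C k = Dom C l" "Cod C l = Dom C q'" "l \<cdot> k = Idn C (Dom C q')"
  show "epi C q'"
    unfolding epi_def
  proof (intro conjI allI impI)
    fix u v assume [simp]: "u \<in> Arr C" "v \<in> Arr C" "Dom C u = Cod C q'" "Dom C v = Cod C q'"
      and e: "u \<cdot> q' = v \<cdot> q'"
    have "u \<cdot> (q' \<cdot> l) = v \<cdot> (q' \<cdot> l)" using e[THEN Cmp_reduce] h by simp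
    then show "u = v" by (rule epiD[OF h(4)]) (use h in simp_all)
  qed (use h in simp)
next
  fix g assume [simp]: "g \<in> Arr C" "Cod C g = Cod C q"
  show "epi C (R g)"
    unfolding epi_def
  proof (intro conjI allI impI)
    fix u v assume [simp]: "u \<in> Arr C" "v \<in> Arr C" "Dom C u = Cod C (R g)" "Dom C v = Cod C (R g)"
      and e: "u \<cdot> R g = v \<cdot> R g"
    have c: "Cod C v = Cod C u" using arg_cong[OF e, of "Cod C"] by simp
    obtain a b where [simp]: "a \<in> Arr C" "b \<in> Arr C" "Dom C b = Dom C a" "Cod C a = Cod C u"
      "Cod C b = Cod C q"
      and ex: "\<And>u' v. u' \<in> Arr C \<Longrightarrow> v \<in> Arr C \<Longrightarrow> Dom C v = Dom C u' \<Longrightarrow> Cod C u' = Cod C u \<Longrightarrow> Cod C v =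
        Cod C q \<Longrightarrow>
       \<exists>h. h \<in> Arr C \<and> Dom C h = Dom C u' \<and> Cod C h = Dom C a \<and> a \<cdot> h = u' \<and> b \<cdot> h = v"
      and un: "\<And>h k. h \<in> Arr C \<Longrightarrow> k \<in> Arr C \<Longrightarrow> Dom C k = Dom C h \<Longrightarrow> Cod C h = Dom C a \<Longrightarrow>
       Cod C k = Dom C a \<Longrightarrow> a \<cdot> h = a \<cdot> k \<Longrightarrow> b \<cdot> h = b \<cdot> k \<Longrightarrow> h = k"
      by (rule binary_product[OF fl, of "Cod C u" "Cod C q"]) simp_all
    obtain u' where u': "u' \<in> Arr C" "Dom C u' = Dom C g" "Cod C u' = Dom C a" "a \<cdot> u' = u"
      "b \<cdot> u' = g"
      using ex[of u g] by auto
    obtain v' where v': "v' \<in> Arr C" "Dom C v' = Dom C g" "Cod C v' = Dom C a" "a \<cdot> v' = v"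
      "b \<cdot> v' = g"
      using ex[of v g] c by auto
    note [simp] = u' v' u'(4,5)[THEN Cmp_reduce] v'(4,5)[THEN Cmp_reduce]
    have "u' \<cdot> R g = v' \<cdot> R g" by (rule un) (simp_all add: e)
    then have "amap (descent_comparison C q) (g, u', b) = amap (descent_comparison C q) (g, v', b)"
      by (simp add: comparison_simps)
    moreover have "(g, u', b) \<in> hom (slice C (Cod C q)) g b"
      "(g, v', b) \<in> hom (slice C (Cod C q)) g b"
      by (simp_all add: slice_hom)
    moreover have "inj_on (amap (descent_comparison C q)) (hom (slice C (Cod C q)) g b)"
      using assms(2) unfolding faithful_functor_def by simp
    ultimately have "(g, u', b) = (g, v', b)" by (meson inj_onD)
    then have "u' = v'" by simp
    then show "u = v" using u'(4) v'(4) by simp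
  qed simp
qed

text \<open>An arrow \<open>u\<close> constant on the fibres of \<open>R g\<close> is a homomorphism
  in disguise: combined with \<open>P g\<close> it maps into the pullback of a product projection
  onto the base, and constancy makes this map equivariant. Fullness lifts it to an arrow of the
  slice, whose component in the product is the factorization of \<open>u\<close>.\<close>

lemma full_imp_stably_regular_epi:
  assumes fl: "has_finite_limits C"
    and "full_functor (slice C (Cod C q)) (descent_Alg C q) (descent_comparison C q)"
  shows "stably regular_epi C q"
proof (rule stably_if_chosen)
  fix q' k l assume h[simp]: "q' \<in> Arr C" "k \<in> Arr C" "l \<in> Arr C" and ep: "regular_epi C (q' \<cdot> l)"
    and h'[simp]: "Dom C k = Dom C q'" "Cod C k = Dom C l" "Cod C l = Dom C q'"
      "l \<cdot> k = Idn C (Dom C q')"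
  show "regular_epi C q'"
    unfolding regular_epi_def
  proof (intro conjI ballI impI)
    fix u assume [simp]: "u \<in> Arr C" "Dom C u = Dom C q'" and
      e: "\<forall>s \<in> Arr C. \<forall>t \<in> Arr C. Dom C t = Dom C s \<longrightarrow> Cod C s = Dom C q' \<longrightarrow> Cod C t = Dom C q' \<longrightarrow>
        q' \<cdot> s = q' \<cdot> t \<longrightarrow> u \<cdot> s = u \<cdot> t"
    have "\<exists>v\<in>Arr C. Dom C v = Cod C (q' \<cdot> l) \<and> v \<cdot> (q' \<cdot> l) = u \<cdot> l"
      by (rule ep[unfolded regular_epi_def, THEN conjunct2, rule_format, of "u \<cdot> l"])
        (simp_all add: e)
    then obtain v where [simp]: "v \<in> Arr C" "Dom C v = Cod C q'" and v: "v \<cdot> (q' \<cdot> l) = u \<cdot> l"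
      by auto
    have "v \<cdot> (q' \<cdot> (l \<cdot> k)) = u \<cdot> (l \<cdot> k)" using arg_cong[OF v, of "\<lambda>z. z \<cdot> k"]
      by (simp del: h'(4))
    then show "\<exists>v\<in>Arr C. Dom C v = Cod C q' \<and> v \<cdot> q' = u" by (intro bexI[of _ v]) simp_all
  qed simp
next
  fix g assume [simp]: "g \<in> Arr C" "Cod C g = Cod C q"
  show "regular_epi C (R g)"
    unfolding regular_epi_def
  proof (intro conjI ballI impI)
    fix u assume [simp]: "u \<in> Arr C" "Dom C u = Dom C (R g)" and
      e: "\<forall>s \<in> Arr C. \<forall>t \<in> Arr C. Dom C t = Dom C s \<longrightarrow> Cod C s = Dom C (R g) \<longrightarrow> Cod C t =
        Dom C (R g) \<longrightarrow>
        R g \<cdot> s = R g \<cdot> t \<longrightarrow> u \<cdot> s = u \<cdot> t"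
    obtain a b where [simp]: "a \<in> Arr C" "b \<in> Arr C" "Dom C b = Dom C a" "Cod C a = Cod C u"
      "Cod C b = Cod C q"
      and ex: "\<And>u' v. u' \<in> Arr C \<Longrightarrow> v \<in> Arr C \<Longrightarrow> Dom C v = Dom C u' \<Longrightarrow> Cod C u' = Cod C u \<Longrightarrow> Cod C v =
        Cod C q \<Longrightarrow>
       \<exists>h. h \<in> Arr C \<and> Dom C h = Dom C u' \<and> Cod C h = Dom C a \<and> a \<cdot> h = u' \<and> b \<cdot> h = v"
      and un: "\<And>h k. h \<in> Arr C \<Longrightarrow> k \<in> Arr C \<Longrightarrow> Dom C k = Dom C h \<Longrightarrow> Cod C h = Dom C a \<Longrightarrow>
       Cod C k = Dom C a \<Longrightarrow> a \<cdot> h = a \<cdot> k \<Longrightarrow> b \<cdot> h = b \<cdot> k \<Longrightarrow> h = k"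
      by (rule binary_product[OF fl, of "Cod C u" "Cod C q"]) simp_all
    obtain w where w: "w \<in> Arr C" "Dom C w = Dom C (P g)" "Cod C w = Dom C a" "a \<cdot> w = u"
      "b \<cdot> w = q \<cdot> P g"
      using ex[of u "q \<cdot> P g"] by auto
    note [simp] = w w(4,5)[THEN Cmp_reduce]
    define h where "h = pair b (P g) w"
    have h[simp]: "h \<in> Arr C" "Dom C h = Dom C (P g)" "Cod C h = Dom C (P b)" "P b \<cdot> h = P g"
      "R b \<cdot> h = w"
      by (simp_all add: h_def)
    note [simp] = h(4,5)[THEN Cmp_reduce]
    \<comment> \<open>\<open>cact g\<close> and \<open>R (q \<cdot> P g)\<close> agree after
      \<open>R g\<close>: the canonical action does not change the point downstairs.\<close>
    have [simp]: "u \<cdot> cact g = u \<cdot> R (q \<cdot> P g)"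
      by (rule e[rule_format]) simp_all
    have wa: "w \<cdot> cact g = w \<cdot> R (q \<cdot> P g)"
      by (rule un) simp_all
    have "h \<cdot> cact g = cact b \<cdot> pair (q \<cdot> P b) (P (q \<cdot> P g)) (h \<cdot> R (q \<cdot> P g))"
      by (rule pr_eqI[of q b]) (simp_all add: wa)
    then have "((P g, (P (q \<cdot> P g), cact g, P g)), (P g, h, P b), (P b, (P (q \<cdot> P b), cact b, P b)))
      \<in> hom (descent_Alg C q) (omap (descent_comparison C q) g) (omap (descent_comparison C q) b)"
      by (simp add: descent_Alg_hom comparison_algebra comparison_simps is_algebra_hom_iff)
    moreover have "amap (descent_comparison C q) ` hom (slice C (Cod C q)) g b =
        hom (descent_Alg C q) (omap (descent_comparison C q) g) (omap (descent_comparison C q) b)"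
      using assms(2) unfolding full_functor_def by simp
    ultimately obtain k where k: "k \<in> hom (slice C (Cod C q)) g b" and 
      k': "amap (descent_comparison C q) k = ((P g, (P (q \<cdot> P g), cact g, P g)), (P g, h, P b),
        (P b, (P (q \<cdot> P b), cact b, P b)))"
      by force
    from k obtain v where v: "k = (g, v, b)" and [simp]: "v \<in> Arr C" "Dom C v = Dom C g"
      "Cod C v = Dom C a" 
      and bv: "b \<cdot> v = g"
      by (auto simp: slice_hom)
    have "pair b (P g) (v \<cdot> R g) = h" using k' by (simp add: v comparison_simps)
    then have "R b \<cdot> pair b (P g) (v \<cdot> R g) = w" by (simp del: pb_pair_simps)
    then have "v \<cdot> R g = w" using bv[THEN Cmp_reduce] by simp
    then have "(a \<cdot> v) \<cdot> R g = u" by simp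
    then show "\<exists>v\<in>Arr C. Dom C v = Cod C (R g) \<and> v \<cdot> R g = u"
      by (intro bexI[of _ "a \<cdot> v"]) simp_all
  qed simp
qed

lemma stably_epi_imp_faithful:
  assumes "stably epi C q"
  shows "faithful_functor (slice C (Cod C q)) (descent_Alg C q) (descent_comparison C q)"
  unfolding faithful_functor_def
proof (intro conjI descent_comparison_functor ballI inj_onI)
  fix X Y a b assume [simp]: "X \<in> Obj (slice C (Cod C q))" "Y \<in> Obj (slice C (Cod C q))"
    and "a \<in> hom (slice C (Cod C q)) X Y" "b \<in> hom (slice C (Cod C q)) X Y"
    and e: "amap (descent_comparison C q) a = amap (descent_comparison C q) b"
  then obtain h k where ab: "a = (X, h, Y)" "b = (X, k, Y)" and hk[simp]: "h \<in> Arr C" "k \<in> Arr C"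
    "Dom C h = Dom C X"
    "Dom C k = Dom C X" "Cod C h = Dom C Y" "Cod C k = Dom C Y" "Y \<cdot> h = X" "Y \<cdot> k = X"
    by (auto simp: slice_hom)
  have [simp]: "X \<in> Arr C" "Y \<in> Arr C" "Cod C X = Cod C q" "Cod C Y = Cod C q" 
    using \<open>X \<in> Obj _\<close> \<open>Y \<in> Obj _\<close> unfolding slice_Obj by auto
  note [simp] = hk(7,8)[THEN Cmp_reduce]
  have ep: "epi C (R X)" using assms pr_pullback[of q X] by (simp add: stably_def)
  have "pair Y (P X) (h \<cdot> R X) = pair Y (P X) (k \<cdot> R X)" using e by (simp add: ab comparison_simps)
  then have "R Y \<cdot> pair Y (P X) (h \<cdot> R X) = R Y \<cdot> pair Y (P X) (k \<cdot> R X)"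
    by (simp del: pb_pair_simps)
  then have "h \<cdot> R X = k \<cdot> R X" by simp
  then have "h = k" by (rule epiD[OF ep]) simp_all
  then show "a = b" by (simp add: ab)
qed

lemma stably_regular_epi_imp_full:
  assumes "stably epi C q" "stably regular_epi C q"
  shows "full_functor (slice C (Cod C q)) (descent_Alg C q) (descent_comparison C q)"
  unfolding full_functor_def
proof (intro conjI descent_comparison_functor ballI equalityI subsetI)
  fix X Y a assume "X \<in> Obj (slice C (Cod C q))" "Y \<in> Obj (slice C (Cod C q))"
    "a \<in> amap (descent_comparison C q) ` hom (slice C (Cod C q)) X Y"
  then show "a \<in> hom (descent_Alg C q) (omap (descent_comparison C q) X) (omap (descent_comparison
    C q) Y)"
    by (auto intro: is_functor.amap_in_hom[OF descent_comparison_functor])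
next
  fix g g' a assume "g \<in> Obj (slice C (Cod C q))" "g' \<in> Obj (slice C (Cod C q))"
    and "a \<in> hom (descent_Alg C q) (omap (descent_comparison C q) g) (omap (descent_comparison C
      q) g')"
  then have [simp]: "g \<in> Arr C" "g' \<in> Arr C" "Cod C g = Cod C q" "Cod C g' = Cod C q"
    and "\<exists>h. a = (omap (descent_comparison C q) g, (P g, h, P g'),
      omap (descent_comparison C q) g') \<and>
      h \<in> Arr C \<and> Dom C h = Dom C (P g) \<and> Cod C h = Dom C (P g') \<and> P g' \<cdot> h = P g \<and>
      h \<cdot> cact g = cact g' \<cdot> pair (q \<cdot> P g') (P (q \<cdot> P g)) (h \<cdot> R (q \<cdot> P g))"
    unfolding descent_Alg_hom comparison_simps is_algebra_hom_iff by auto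
  then obtain h where a: "a = (omap (descent_comparison C q) g, (P g, h, P g'),
    omap (descent_comparison C q) g')" and
    h: "h \<in> Arr C" "Dom C h = Dom C (P g)" "Cod C h = Dom C (P g')" "P g' \<cdot> h = P g" and
    hc: "h \<cdot> cact g = cact g' \<cdot> pair (q \<cdot> P g') (P (q \<cdot> P g)) (h \<cdot> R (q \<cdot> P g))" by blast
  note [simp] = h h(4)[THEN Cmp_reduce]
  have ep: "epi C (R g)" and rep: "regular_epi C (R g)" using assms pr_pullback[of q g]
    by (simp_all add: stably_def)
  have inv: "(R g' \<cdot> h) \<cdot> cact g = (R g' \<cdot> h) \<cdot> R (q \<cdot> P g)"
    by (simp add: hc)
  have "\<exists>v \<in> Arr C. Dom C v = Cod C (R g) \<and> v \<cdot> R g = R g' \<cdot> h"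
  proof (rule rep[unfolded regular_epi_def, THEN conjunct2, rule_format])
    fix s t assume [simp]: "s \<in> Arr C" "t \<in> Arr C" "Dom C t = Dom C s" "Cod C s = Dom C (R g)"
      "Cod C t = Dom C (R g)" and st: "R g \<cdot> s = R g \<cdot> t"
    have [simp]: "q \<cdot> (P g \<cdot> t) = q \<cdot> (P g \<cdot> s)" using arg_cong[OF st, of "\<lambda>z. g \<cdot> z"] by simp
    \<comment> \<open>Any pair identified by \<open>R g\<close> is an instance of the canonical
      action: \<open>s\<close> is \<open>t\<close> moved to the position
      \<open>P g \<cdot> s\<close>. Evaluating the invariance \<open>inv\<close> there shows that
      \<open>R g' \<cdot> h\<close> does not distinguish \<open>s\<close> from
      \<open>t\<close>.\<close>
    have "cact g \<cdot> pair (q \<cdot> P g) (P g \<cdot> s) t = s"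
      by (rule pr_eqI[of q g]) (simp_all add: st)
    then show "(R g' \<cdot> h) \<cdot> s = (R g' \<cdot> h) \<cdot> t"
      using arg_cong[OF inv, of "\<lambda>z. z \<cdot> pair (q \<cdot> P g) (P g \<cdot> s) t"] by (simp)
  qed simp_all
  then obtain v where v: "v \<in> Arr C" "Dom C v = Dom C g" "v \<cdot> R g = R g' \<cdot> h" by auto
  have [simp]: "Cod C v = Dom C g'" using arg_cong[OF v(3), of "Cod C"] v(1,2) by simp
  note [simp] = v v(3)[THEN Cmp_reduce]
  \<comment> \<open>The factorization is found in \<open>C\<close>; that it lies over the base is
    seen after the epimorphism \<open>R g\<close>.\<close>
  have [simp]: "g' \<cdot> v = g" by (rule epiD[OF ep]) simp_all
  have "pair g' (P g) (R g' \<cdot> h) = h" by (rule pr_eqI[of q g']) simp_all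
  then have "amap (descent_comparison C q) (g, v, g') = a" by (simp add: comparison_simps a)
  moreover have "(g, v, g') \<in> hom (slice C (Cod C q)) g g'" by (simp add: slice_hom)
  ultimately show "a \<in> amap (descent_comparison C q) ` hom (slice C (Cod C q)) g g'" by blast
qed

end

lemma descent_actionD:
  assumes "descent_action C q f act"
  shows "f \<in> Arr C" "Cod C f = Dom C q"
    and "composable C q f t \<alpha> \<Longrightarrow> act t \<alpha> \<in> Arr C"
    and "composable C q f t \<alpha> \<Longrightarrow> Dom C (act t \<alpha>) = Dom C t"
    and "composable C q f t \<alpha> \<Longrightarrow> Cod C (act t \<alpha>) = Dom C f"
    and "composable C q f t \<alpha> \<Longrightarrow> f \<cdot>\<^bsub>C\<^esub> act t \<alpha> = t"
    and "composable C q f t \<alpha> \<Longrightarrow> h \<in> Arr C \<Longrightarrow> Cod C h = Dom C t \<Longrightarrow>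
       act t \<alpha> \<cdot>\<^bsub>C\<^esub> h = act (t \<cdot>\<^bsub>C\<^esub> h) (\<alpha> \<cdot>\<^bsub>C\<^esub> h)"
    and "composable C q f t \<alpha> \<Longrightarrow> s \<in> Arr C \<Longrightarrow> Dom C s = Dom C t \<Longrightarrow> Cod C s = Dom C q \<Longrightarrow>
       q \<cdot>\<^bsub>C\<^esub> s = q \<cdot>\<^bsub>C\<^esub> t \<Longrightarrow> act s (act t \<alpha>) = act s \<alpha>"
    and "\<alpha> \<in> Arr C \<Longrightarrow> Cod C \<alpha> = Dom C f \<Longrightarrow> act (f \<cdot>\<^bsub>C\<^esub> \<alpha>) \<alpha> = \<alpha>"
  using assms unfolding descent_action_def by blast+

section \<open>Essential surjectivity in terms of actions\<close>

context pb_arrow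
begin

lemma ess_surj_imp_actions_descend:
  assumes "ess_surj (slice C (Cod C q)) (descent_Alg C q) (descent_comparison C q)"
  shows "actions_descend C q"
  unfolding actions_descend_def
proof (intro allI impI)
  fix f act assume act: "descent_action C q f act"
  note [simp] = descent_actionD(1,2)[OF act]
  \<comment> \<open>The value at the universal composable pair; naturality recovers every other
    value as \<open>\<xi> \<cdot> h\<close>.\<close>
  define \<xi> where "\<xi> = act (P (q \<cdot> f)) (R (q \<cdot> f))"
  have c0: "composable C q f (P (q \<cdot> f)) (R (q \<cdot> f))"
    by (simp add: composable_def)
  note [simp] = descent_actionD(3-6)[OF act c0, folded \<xi>_def]
  have c[simp]: "composable C q f t \<alpha>" if "t \<in> Arr C" "\<alpha> \<in> Arr C" "Dom C \<alpha> = Dom C t"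
    "Cod C t = Dom C q" "Cod C \<alpha> = Dom C f"
    "q \<cdot> t = q \<cdot> (f \<cdot> \<alpha>)" for t \<alpha>
    using that by (simp add: composable_def)
  have nat[simp]: "\<xi> \<cdot> h = act (P (q \<cdot> f) \<cdot> h) (R (q \<cdot> f) \<cdot> h)" if "h \<in> Arr C"
    "Cod C h = Dom C (P (q \<cdot> f))" for h
    unfolding \<xi>_def by (rule descent_actionD(7)[OF act c0 that])
  have "descent_datum C q f \<xi>"
    unfolding descent_datum_def Let_def
  proof (intro conjI)
    show "\<xi> \<cdot> pair (q \<cdot> f) f (Idn C (Dom C f)) = Idn C (Dom C f)"
      using descent_actionD(9)[OF act, of "Idn C (Dom C f)"] by simp
    have [simp]: "R (q \<cdot> f) \<cdot> R (q \<cdot> P (q \<cdot> f)) \<in> Arr C" by simp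
    have "act (P (q \<cdot> P (q \<cdot> f))) (act (P (q \<cdot> f) \<cdot> R (q \<cdot> P (q \<cdot> f))) (R (q \<cdot> f) \<cdot> R (q \<cdot> P (q \<cdot>
      f))))
      = act (P (q \<cdot> P (q \<cdot> f))) (R (q \<cdot> f) \<cdot> R (q \<cdot> P (q \<cdot> f)))"
      by (rule descent_actionD(8)[OF act]) simp_all
    moreover have "f \<cdot> act (P (q \<cdot> f) \<cdot> R (q \<cdot> P (q \<cdot> f))) (R (q \<cdot> f) \<cdot> R (q \<cdot> P (q \<cdot> f))) =
      P (q \<cdot> f) \<cdot> R (q \<cdot> P (q \<cdot> f))"
       "act (P (q \<cdot> f) \<cdot> R (q \<cdot> P (q \<cdot> f))) (R (q \<cdot> f) \<cdot> R (q \<cdot> P (q \<cdot> f))) \<in> Arr C"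
       "Dom C (act (P (q \<cdot> f) \<cdot> R (q \<cdot> P (q \<cdot> f))) (R (q \<cdot> f) \<cdot> R (q \<cdot> P (q \<cdot> f)))) =
         Dom C (P (q \<cdot> P (q \<cdot> f)))"
       "Cod C (act (P (q \<cdot> f) \<cdot> R (q \<cdot> P (q \<cdot> f))) (R (q \<cdot> f) \<cdot> R (q \<cdot> P (q \<cdot> f)))) = Dom C f"
      using descent_actionD(3-6)[OF act, of "P (q \<cdot> f) \<cdot> R (q \<cdot> P (q \<cdot> f))"
        "R (q \<cdot> f) \<cdot> R (q \<cdot> P (q \<cdot> f))"] by simp_all
    ultimately show "\<xi> \<cdot> pair (q \<cdot> f) (P (q \<cdot> P (q \<cdot> f))) (\<xi> \<cdot> R (q \<cdot> P (q \<cdot> f))) =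
       \<xi> \<cdot> pair (q \<cdot> f) (P (q \<cdot> P (q \<cdot> f))) (R (q \<cdot> f) \<cdot> R (q \<cdot> P (q \<cdot> f)))"
      by simp
  qed simp_all
  then have "(f, (P (q \<cdot> f), \<xi>, f)) \<in> Obj (descent_Alg C q)" by (simp add: is_algebra_iff)
  then obtain g T where g: "g \<in> Obj (slice C (Cod C q))"
    and T: "T \<in> hom (descent_Alg C q) (omap (descent_comparison C q) g) (f, (P (q \<cdot> f), \<xi>, f))"
    and "is_iso (descent_Alg C q) T"
    using assms unfolding ess_surj_def by blast
  then obtain S where S: "S \<in> hom (descent_Alg C q) (f, (P (q \<cdot> f), \<xi>,
    f)) (omap (descent_comparison C q) g)"
    and TS: "T \<cdot>\<^bsub>descent_Alg C q\<^esub> S = Idn (descent_Alg C q) (f, (P (q \<cdot> f), \<xi>, f))"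
      "S \<cdot>\<^bsub>descent_Alg C q\<^esub> T = Idn (descent_Alg C q) (omap (descent_comparison C q) g)"
    unfolding in_hom_iff by (elim is_isoE conjE) metis
  have [simp]: "g \<in> Arr C" "Cod C g = Cod C q" using g unfolding slice_Obj by auto
  have "\<exists>h. T = (omap (descent_comparison C q) g, (P g, h, f), (f, (P (q \<cdot> f), \<xi>, f))) \<and> h \<in> Arr C \<and>
    Dom C h = Dom C (P g) \<and> Cod C h = Dom C f \<and> f \<cdot> h = P g"
    using T unfolding descent_Alg_hom comparison_simps is_algebra_hom_iff by auto
  then obtain h where Teq: "T = (omap (descent_comparison C q) g, (P g, h, f), (f, (P (q \<cdot> f), \<xi>,
    f)))"
    and h[simp]: "h \<in> Arr C" "Dom C h = Dom C (P g)" "Cod C h = Dom C f" "f \<cdot> h = P g"  by auto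
  have "\<exists>k. S = ((f, (P (q \<cdot> f), \<xi>, f)), (f, k, P g), omap (descent_comparison C q) g) \<and> k \<in> Arr C \<and>
    Dom C k = Dom C f \<and> Cod C k = Dom C (P g) \<and> P g \<cdot> k = f \<and> 
    k \<cdot> \<xi> = cact g \<cdot> pair (q \<cdot> P g) (P (q \<cdot> f)) (k \<cdot> R (q \<cdot> f))"
    using S unfolding descent_Alg_hom comparison_simps is_algebra_hom_iff by auto
  then obtain k where Seq: "S = ((f, (P (q \<cdot> f), \<xi>, f)), (f, k, P g),
    omap (descent_comparison C q) g)"
    and k[simp]: "k \<in> Arr C" "Dom C k = Dom C f" "Cod C k = Dom C (P g)" "P g \<cdot> k = f"
    and k\<xi>: "k \<cdot> \<xi> = cact g \<cdot> pair (q \<cdot> P g) (P (q \<cdot> f)) (k \<cdot> R (q \<cdot> f))" by blast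
  note [simp] = h(4)[THEN Cmp_reduce] k(4)[THEN Cmp_reduce]
  have hk: "h \<cdot> k = Idn C (Dom C f)" "k \<cdot> h = Idn C (Dom C (P g))"
    using TS by (simp_all add: Teq Seq comparison_simps)
  \<comment> \<open>The isomorphism of algebras carries the chosen pullback square of
    \<open>g\<close> over to \<open>f\<close>; its equivariance carries the invariance of
    \<open>R g\<close> over to \<open>R g \<cdot> k\<close>.\<close>
  have "is_pullback C q g (P g \<cdot> k) (R g \<cdot> k)"
    by (rule pullback_iso[OF pr_pullback[of q g], of k h]) (use hk in simp_all)
  then have "is_pullback C q g f (R g \<cdot> k)" by simp
  moreover have "(R g \<cdot> k) \<cdot> act t \<alpha> = (R g \<cdot> k) \<cdot> \<alpha>" if com: "composable C q f t \<alpha>" for t \<alpha>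
  proof -
    note [simp] = composableD[OF com] descent_actionD(3-6)[OF act com]
    have a: "act t \<alpha> = \<xi> \<cdot> pair (q \<cdot> f) t \<alpha>" by simp
    have "(R g \<cdot> k) \<cdot> act t \<alpha> = R g \<cdot> ((k \<cdot> \<xi>) \<cdot> pair (q \<cdot> f) t \<alpha>)" unfolding a by (simp del: nat)
    also have "\<dots> = (R g \<cdot> k) \<cdot> \<alpha>" unfolding k\<xi> by simp
    finally show ?thesis .
  qed
  ultimately show "\<exists>g \<pi>. is_pullback C q g f \<pi> \<and> (\<forall>t \<alpha>. composable C q f t \<alpha> \<longrightarrow> \<pi> \<cdot> act t \<alpha> = \<pi> \<cdot> \<alpha>)"
    by blast
qed

text \<open>Phrased with one arrow \<open>\<xi>\<close> instead of an action, because for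
  \<open>T\<close>-categories it is the arrow that splits into components. The comparison
  \<open>l\<close> from the chosen pullback of \<open>g\<close> is equivariant because both
  composites agree after \<open>f\<close> and after the invariant \<open>\<pi>\<close>.\<close>

lemma data_descend_imp_ess_surj:
  assumes "\<And>f \<xi>. descent_datum C q f \<xi> \<Longrightarrow> \<exists>g \<pi>. is_pullback C q g f \<pi> \<and> \<pi> \<cdot> \<xi> = \<pi> \<cdot> R (q \<cdot> f)"
  shows "ess_surj (slice C (Cod C q)) (descent_Alg C q) (descent_comparison C q)"
  unfolding ess_surj_def
proof
  fix Y assume Y: "Y \<in> Obj (descent_Alg C q)"
  then obtain f \<xi> where Yeq: "Y = (f, (P (q \<cdot> f), \<xi>, f))" and dat: "descent_datum C q f \<xi>"
    by (cases Y) (auto simp: is_algebra_iff)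
  from assms[OF dat] obtain g \<pi> where pb: "is_pullback C q g f \<pi>" and inv: "\<pi> \<cdot> \<xi> = \<pi> \<cdot> R (q \<cdot> f)"
    by blast
  have \<xi>: "\<xi> \<in> Arr C" "Dom C \<xi> = Dom C (P (q \<cdot> f))" "Cod C \<xi> = Dom C f" "f \<cdot> \<xi> = P (q \<cdot> f)"
    using dat by (simp_all add: descent_datum_def)
  note [simp] = pullbackD(1-8)[OF pb] \<xi>
  note \<pi>[simp] = pullbackD(9)[OF pb, symmetric] 
  note [simp] = \<pi>[THEN Cmp_reduce] inv[THEN Cmp_reduce] inv \<xi>(4)[THEN Cmp_reduce]
  obtain k l where kl[simp]: "k \<in> Arr C" "l \<in> Arr C" "Dom C k = Dom C f" "Cod C k = Dom C (P g)"
    "Dom C l = Dom C (P g)"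
    "Cod C l = Dom C f" "k \<cdot> l = Idn C (Dom C (P g))" "l \<cdot> k = Idn C (Dom C f)" "P g \<cdot> k = f"
      "R g \<cdot> k = \<pi>"
    "f \<cdot> l = P g" "\<pi> \<cdot> l = R g"
    by (rule pullback_unique_iso[OF pr_pullback[of q g] pb]) simp_all
  note [simp] = kl(7-12)[THEN Cmp_reduce]
  have lh: "l \<cdot> cact g = \<xi> \<cdot> pair (q \<cdot> f) (P (q \<cdot> P g)) (l \<cdot> R (q \<cdot> P g))"
    by (rule pullback_eqI[OF pb]) simp_all
  have kh: "k \<cdot> \<xi> = cact g \<cdot> pair (q \<cdot> P g) (P (q \<cdot> f)) (k \<cdot> R (q \<cdot> f))"
    by (rule pr_eqI[of q g]) simp_all
  let ?l = "(omap (descent_comparison C q) g, (P g, l, f), Y)"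
  let ?k = "(Y, (f, k, P g), omap (descent_comparison C q) g)"
  have l: "?l \<in> hom (descent_Alg C q) (omap (descent_comparison C q) g) Y"
    using Y by (simp add: Yeq descent_Alg_hom comparison_algebra comparison_simps
      is_algebra_hom_iff lh)
  have k: "?k \<in> hom (descent_Alg C q) Y (omap (descent_comparison C q) g)"
    using Y by (simp add: Yeq descent_Alg_hom comparison_algebra comparison_simps
      is_algebra_hom_iff kh)
  have "is_iso (descent_Alg C q) ?l"
    by (rule is_isoI[of _ _ ?k]) (use l k in \<open>simp_all add: in_hom_iff Yeq comparison_simps\<close>)
  with l show "\<exists>X\<in>Obj (slice C (Cod C q)). \<exists>t\<in>hom (descent_Alg C q) (omap (descent_comparison C q)
    X) Y. is_iso (descent_Alg C q) t"
    by (intro bexI[of _ g] bexI[of _ ?l]) simp_all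
qed

end

context category
begin

text \<open>The action lifts a composable pair to the pullback and applies \<open>\<xi>\<close>.
  Both pullbacks, and \<open>n\<close>, \<open>j\<close>, \<open>k\<close>, are left arbitrary since
  they will be components of choices made among \<open>T\<close>-categories.\<close>

lemma descent_action_of_arrow:
  assumes pb: "is_pullback C q (q \<cdot> f) P1 P2" and pb3: "is_pullback C q (q \<cdot> P1) r1 r2"
    and f: "f \<in> Arr C" "Cod C f = Dom C q"
    and \<xi>: "\<xi> \<in> Arr C" "Dom C \<xi> = Dom C P1" "Cod C \<xi> = Dom C f" "f \<cdot> \<xi> = P1"
    and n: "n \<in> Arr C" "Dom C n = Dom C f" "Cod C n = Dom C P1" "P1 \<cdot> n = f"
      "P2 \<cdot> n = Idn C (Dom C f)"
      "\<xi> \<cdot> n = Idn C (Dom C f)"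
    and j: "j \<in> Arr C" "Dom C j = Dom C r1" "Cod C j = Dom C P1" "P1 \<cdot> j = r1" "P2 \<cdot> j = \<xi> \<cdot> r2"
    and k: "k \<in> Arr C" "Dom C k = Dom C r1" "Cod C k = Dom C P1" "P1 \<cdot> k = r1" "P2 \<cdot> k = P2 \<cdot> r2"
    and assoc: "\<xi> \<cdot> j = \<xi> \<cdot> k"
  obtains act where "descent_action C q f act" "act P1 P2 = \<xi>" "composable C q f P1 P2"
proof -
  note [simp] = f \<xi> n(1-3) j(1-3) k(1-3) pullbackD(1,3-4,6-7)[OF pb] pullbackD(3-4,6-7)[OF pb3]
  have [simp]: "Cod C P2 = Dom C f" "Cod C r2 = Dom C P1"
    using pullbackD(8)[OF pb] pullbackD(8)[OF pb3] by simp_all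
  note r = n(4-6) j(4-5) k(4-5) assoc \<xi>(4)
  note [simp] = r r[THEN Cmp_reduce]
  have [simp]: "q \<cdot> (f \<cdot> P2) = q \<cdot> P1" using pullbackD(9)[OF pb] by simp
  have [simp]: "q \<cdot> (P1 \<cdot> r2) = q \<cdot> r1" using pullbackD(9)[OF pb3] by simp
  define lf where "lf t \<alpha> = (THE h. h \<in> Arr C \<and> Dom C h = Dom C t \<and> Cod C h = Dom C P1 \<and> P1 \<cdot> h =
    t \<and> P2 \<cdot> h = \<alpha>)" for t \<alpha>
  have lfI: "lf (P1 \<cdot> h) (P2 \<cdot> h) = h" if "h \<in> Arr C" "Cod C h = Dom C P1" for h
    unfolding lf_def
  proof (rule the_equality)
    fix h' assume "h' \<in> Arr C \<and> Dom C h' = Dom C (P1 \<cdot> h) \<and> Cod C h' = Dom C P1 \<and> P1 \<cdot> h' =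
      P1 \<cdot> h \<and> P2 \<cdot> h' = P2 \<cdot> h"
    with that show "h' = h" by - (rule pullback_eqI[OF pb], auto)
  qed (use that in simp_all)
  have lift: "\<exists>h. h \<in> Arr C \<and> Dom C h = Dom C t \<and> Cod C h = Dom C P1 \<and> t = P1 \<cdot> h \<and> \<alpha> = P2 \<cdot> h"
    if c: "composable C q f t \<alpha>" for t \<alpha>
  proof -
    note [simp] = composableD[OF c]
    show ?thesis using pullback_lift[OF pb, of t \<alpha>] by auto
  qed
  have act: "descent_action C q f (\<lambda>t \<alpha>. \<xi> \<cdot> lf t \<alpha>)"
    unfolding descent_action_def
  proof (intro conjI allI impI ballI)
    fix t \<alpha> assume c: "composable C q f t \<alpha>"
    then obtain h where h: "h \<in> Arr C" "Cod C h = Dom C P1" and t: "t = P1 \<cdot> h" "\<alpha> = P2 \<cdot> h"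
      using lift by blast
    note [simp] = h lfI
    show "\<xi> \<cdot> lf t \<alpha> \<in> Arr C" "Dom C (\<xi> \<cdot> lf t \<alpha>) = Dom C t" "Cod C (\<xi> \<cdot> lf t \<alpha>) = Dom C f"
      "f \<cdot> (\<xi> \<cdot> lf t \<alpha>) = t"
      by (simp_all add: t)
    show "(\<xi> \<cdot> lf t \<alpha>) \<cdot> k = \<xi> \<cdot> lf (t \<cdot> k) (\<alpha> \<cdot> k)" if [simp]: "k \<in> Arr C" "Cod C k = Dom C t"
      for k
      using that lfI[of "h \<cdot> k"] by (simp add: t)
    fix s assume s: "s \<in> Arr C" "Dom C s = Dom C t" "Cod C s = Dom C q" "q \<cdot> s = q \<cdot> t"
    \<comment> \<open>\<open>w\<close> stands for \<open>s\<close> together with the lift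
      \<open>h\<close> of \<open>(t, \<alpha>)\<close>. Composed with \<open>j\<close> and with
      \<open>k\<close> it yields the two lifts on which \<open>assoc\<close> compares
      \<open>\<xi>\<close>.\<close>
    have "\<exists>w. w \<in> Arr C \<and> Dom C w = Dom C s \<and> Cod C w = Dom C r1 \<and> r1 \<cdot> w = s \<and> r2 \<cdot> w = h"
      using s pullback_lift[OF pb3, of s h] by (auto simp: t)
    then obtain w where w[simp]: "w \<in> Arr C" "Cod C w = Dom C r1" and sw: "s = r1 \<cdot> w"
      and hw: "h = r2 \<cdot> w" by auto
    have "lf s (\<xi> \<cdot> h) = j \<cdot> w" using lfI[of "j \<cdot> w"] by (simp add: sw hw)
    moreover have "lf s (P2 \<cdot> h) = k \<cdot> w" using lfI[of "k \<cdot> w"] by (simp add: sw hw)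
    ultimately show "\<xi> \<cdot> lf s (\<xi> \<cdot> lf t \<alpha>) = \<xi> \<cdot> lf s \<alpha>" by (simp add: t)
  next
    fix \<alpha> assume "\<alpha> \<in> Arr C" "Cod C \<alpha> = Dom C f"
    then show "\<xi> \<cdot> lf (f \<cdot> \<alpha>) \<alpha> = \<alpha>" using lfI[of "n \<cdot> \<alpha>"] by simp
  qed (simp_all)
  moreover have "\<xi> \<cdot> lf P1 P2 = \<xi>" using lfI[of "Idn C (Dom C P1)"] by simp
  moreover have "composable C q f P1 P2" by (simp add: composable_def)
  ultimately show thesis using that by blast
qed

end

section \<open>Descent properties of a retract in the category of arrows\<close>

locale retract_arrow = pb_category +
  fixes q0 q1 s s' d d'
  assumes q [simp]: "q0 \<in> Arr C" "q1 \<in> Arr C"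
    and s [simp]: "s \<in> Arr C" "Dom C s = Dom C q0" "Cod C s = Dom C q1"
      "s' \<in> Arr C" "Dom C s' = Cod C q0" "Cod C s' = Cod C q1"
    and d [simp]: "d \<in> Arr C" "Dom C d = Dom C q1" "Cod C d = Dom C q0"
      "d' \<in> Arr C" "Dom C d' = Cod C q1" "Cod C d' = Cod C q0"
    and ds [simp]: "d \<cdot> s = Idn C (Dom C q0)" "d' \<cdot> s' = Idn C (Cod C q0)"
    and qs: "q1 \<cdot> s = s' \<cdot> q0" and qd: "q0 \<cdot> d = d' \<cdot> q1"
begin

lemmas ds_reduce [simp] = ds[THEN Cmp_reduce]

text \<open>If \<open>q1 t = s' g \<alpha>\<close>, then
  \<open>q0 d t = d' q1 t = d' s' g \<alpha> = g \<alpha>\<close>. So \<open>d\<close> maps the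
  pullback of \<open>q1\<close> along \<open>s' \<cdot> g\<close> to that of \<open>q0\<close> along
  \<open>g\<close>, over the same object.\<close>

lemma factor:
  assumes pb: "is_pullback C q0 g p q"
  obtains h where "h \<in> Arr C" "Dom C h = Dom C (pr1 C q1 (s' \<cdot> g))" "Cod C h = Dom C q"
    "q \<cdot> h = pr2 C q1 (s' \<cdot> g)"
proof -
  note [simp] = pullbackD(1-8)[OF pb]
  have e: "q1 \<cdot> pr1 C q1 (s' \<cdot> g) = s' \<cdot> (g \<cdot> pr2 C q1 (s' \<cdot> g))" using pr_commute[of q1 "s' \<cdot> g"]
    by simp
  have "q0 \<cdot> (d \<cdot> pr1 C q1 (s' \<cdot> g)) = g \<cdot> pr2 C q1 (s' \<cdot> g)"
    using qd[THEN Cmp_reduce, of "pr1 C q1 (s' \<cdot> g)"] by (simp add: e)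
  then show thesis using pullback_lift[OF pb, of "d \<cdot> pr1 C q1 (s' \<cdot> g)" "pr2 C q1 (s' \<cdot> g)"] that
    by auto
qed

lemma stably_epi:
  assumes "stably epi C q1"
  shows "stably epi C q0"
  unfolding stably_def
proof (intro allI impI)
  fix g p q assume pb: "is_pullback C q0 g p q"
  note [simp] = pullbackD(1-8)[OF pb]
  have ep: "epi C (pr2 C q1 (s' \<cdot> g))"
    using assms pr_pullback[of q1 "s' \<cdot> g"] unfolding stably_def by simp
  obtain h where h[simp]: "h \<in> Arr C" "Dom C h = Dom C (pr1 C q1 (s' \<cdot> g))" "Cod C h = Dom C q"
    "q \<cdot> h = pr2 C q1 (s' \<cdot> g)" using factor[OF pb] by blast
  show "epi C q"
    unfolding epi_def
  proof (intro conjI allI impI)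
    fix u v assume [simp]: "u \<in> Arr C" "v \<in> Arr C" "Dom C u = Cod C q" "Dom C v = Cod C q"
      and e: "u \<cdot> q = v \<cdot> q"
    show "u = v" by (rule epiD[OF ep]) (use e[THEN Cmp_reduce, of h] in simp_all)
  qed simp
qed

lemma stably_regular_epi:
  assumes "stably epi C q1" "stably regular_epi C q1"
  shows "stably regular_epi C q0"
  unfolding stably_def
proof (intro allI impI)
  fix g p q assume pb: "is_pullback C q0 g p q"
  note [simp] = pullbackD(1-8)[OF pb]
  let ?w1 = "pr1 C q1 (s' \<cdot> g)" and ?w2 = "pr2 C q1 (s' \<cdot> g)"
  have ep: "regular_epi C ?w2" using assms pr_pullback[of q1 "s' \<cdot> g"] unfolding stably_def by simp
  obtain h where h[simp]: "h \<in> Arr C" "Dom C h = Dom C ?w1" "Cod C h = Dom C q"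
    "q \<cdot> h = ?w2" using factor[OF pb] by blast
  note [simp] = h(4)[THEN Cmp_reduce]
  show "regular_epi C q"
    unfolding regular_epi_def
  proof (intro conjI ballI impI)
    fix u assume [simp]: "u \<in> Arr C" "Dom C u = Dom C q" and
      e: "\<forall>s \<in> Arr C. \<forall>t \<in> Arr C. Dom C t = Dom C s \<longrightarrow> Cod C s = Dom C q \<longrightarrow> Cod C t = Dom C q \<longrightarrow>
        q \<cdot> s = q \<cdot> t \<longrightarrow> u \<cdot> s = u \<cdot> t"
    have "\<exists>v\<in>Arr C. Dom C v = Cod C ?w2 \<and> v \<cdot> ?w2 = u \<cdot> h"
      by (rule ep[unfolded regular_epi_def, THEN conjunct2, rule_format]) (simp_all add: e)
    then obtain v where v[simp]: "v \<in> Arr C" "Dom C v = Dom C g" "v \<cdot> ?w2 = u \<cdot> h" by auto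
    \<comment> \<open>So far \<open>v \<cdot> q\<close> and \<open>u\<close> agree only after
      \<open>h\<close>. Pulling \<open>q1\<close> back once more, along
      \<open>s' \<cdot> (g \<cdot> q)\<close>, gives an epimorphism \<open>?b\<close> onto the
      source of \<open>q\<close>; the elements \<open>h \<cdot> c\<close> and \<open>?b\<close> lie
      in one fibre of \<open>q\<close>, where \<open>u\<close> is constant.\<close>
    let ?a = "pr1 C q1 (s' \<cdot> (g \<cdot> q))" and ?b = "pr2 C q1 (s' \<cdot> (g \<cdot> q))"
    have ep': "epi C ?b" using assms(1) pr_pullback[of q1 "s' \<cdot> (g \<cdot> q)"] unfolding stably_def
      by simp
    have "q1 \<cdot> ?a = (s' \<cdot> g) \<cdot> (q \<cdot> ?b)" using pr_commute[of q1 "s' \<cdot> (g \<cdot> q)"] by simp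
    from pullback_lift[OF pr_pullback this] obtain c where c[simp]: "c \<in> Arr C" "Dom C c = Dom C ?a"
      "Cod C c = Dom C ?w1" "?w2 \<cdot> c = q \<cdot> ?b" by auto
    have "u \<cdot> (h \<cdot> c) = u \<cdot> ?b" by (rule e[rule_format]) simp_all
    then have "(v \<cdot> q) \<cdot> ?b = u \<cdot> ?b" using v(3)[THEN Cmp_reduce, of c] by simp
    then have "v \<cdot> q = u" by (rule epiD[OF ep']) simp_all
    then show "\<exists>v\<in>Arr C. Dom C v = Cod C q \<and> v \<cdot> q = u" by (intro bexI[of _ v]) simp_all
  qed simp
qed

text \<open>An action of \<open>q\<^sub>0\<close> on \<open>f\<close> induces one of \<open>q\<^sub>1\<close> on \<open>d\<^sup>* f\<close>; if that one comes from \<open>g\<^sub>1\<close>, then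
  the given one comes from \<open>s'\<^sup>* g\<^sub>1\<close>.\<close>

lemma actions_descend:
  assumes "actions_descend C q1"
  shows "actions_descend C q0"
  unfolding actions_descend_def
proof (intro allI impI)
  fix f act assume act: "descent_action C q0 f act"
  note [simp] = descent_actionD(1,2)[OF act]
  note q1s[simp] = qs and q0d[simp] = qd
  note [simp] = q1s[THEN Cmp_reduce] q0d[THEN Cmp_reduce]
  define f1 where "f1 = pr1 C d f"
  define e where "e = pr2 C d f"
  have fe[simp]: "f1 \<in> Arr C" "e \<in> Arr C" "Cod C f1 = Dom C q1" "Cod C e = Dom C f"
    "Dom C e = Dom C f1"
    "f \<cdot> e = d \<cdot> f1" using pr_commute[of d f] by (simp_all add: f1_def e_def)
  note [simp] = fe(6)[THEN Cmp_reduce]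
  define pr where "pr u v = pb_pair C d f u v" for u v
  have pr[simp]: "pr u v \<in> Arr C" "Dom C (pr u v) = Dom C u" "Cod C (pr u v) = Dom C f1"
    "f1 \<cdot> pr u v = u" "e \<cdot> pr u v = v"
    if "u \<in> Arr C" "v \<in> Arr C" "Dom C v = Dom C u" "Cod C u = Dom C q1" "Cod C v = Dom C f"
      "f \<cdot> v = d \<cdot> u" for u v
    using pb_pair_simps[of d f u v] that by (simp_all add: f1_def e_def pr_def)
  note [simp] = pr(4,5)[THEN Cmp_reduce]
  have pre: "h = k" if "f1 \<cdot> h = f1 \<cdot> k" "e \<cdot> h = e \<cdot> k" "h \<in> Arr C" "k \<in> Arr C"
    "Dom C k = Dom C h" "Cod C h = Dom C f1" "Cod C k = Dom C f1" for h k
    using pr_eqI[of d f h k] that by (simp add: f1_def e_def)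
  \<comment> \<open>Elements of \<open>d^* f\<close> are pairs of a point \<open>t\<close> and an
    element over \<open>d t\<close>. The first component moves to the prescribed point, the second
    by the given action.\<close>
  define act1 where "act1 t \<alpha> = pr t (act (d \<cdot> t) (e \<cdot> \<alpha>))" for t \<alpha>
  have com: "composable C q0 f (d \<cdot> t) (e \<cdot> \<alpha>)" if c: "composable C q1 f1 t \<alpha>" for t \<alpha>
    using composableD[OF c] by (simp add: composable_def)
  have a1: "act1 t \<alpha> \<in> Arr C" "Dom C (act1 t \<alpha>) = Dom C t" "Cod C (act1 t \<alpha>) = Dom C f1"
    "f1 \<cdot> act1 t \<alpha> = t"
    "e \<cdot> act1 t \<alpha> = act (d \<cdot> t) (e \<cdot> \<alpha>)" if c: "composable C q1 f1 t \<alpha>" for t \<alpha>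
    using composableD[OF c] descent_actionD(3-6)[OF act com[OF c]] by (simp_all add: act1_def)
  have "descent_action C q1 f1 act1"
    unfolding descent_action_def
  proof (intro conjI allI impI ballI)
    fix t \<alpha> assume c: "composable C q1 f1 t \<alpha>"
    note [simp] = a1(1-4)[OF c] composableD[OF c]
    show "act1 t \<alpha> \<in> Arr C" "Dom C (act1 t \<alpha>) = Dom C t" "Cod C (act1 t \<alpha>) = Dom C f1"
      "f1 \<cdot> act1 t \<alpha> = t" by simp_all
    show "act1 t \<alpha> \<cdot> h = act1 (t \<cdot> h) (\<alpha> \<cdot> h)" if [simp]: "h \<in> Arr C" "Cod C h = Dom C t" for h
    proof -
      have "q1 \<cdot> (f1 \<cdot> (\<alpha> \<cdot> h)) = q1 \<cdot> (t \<cdot> h)" using Cmp_reduce[OF composableD(6)[OF c], of h]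
        by simp
      then have c': "composable C q1 f1 (t \<cdot> h) (\<alpha> \<cdot> h)" by (simp add: composable_def)
      note [simp] = a1(1-4)[OF c'] a1(4)[OF c, THEN Cmp_reduce]
      show ?thesis
      proof (rule pre)
        show "e \<cdot> (act1 t \<alpha> \<cdot> h) = e \<cdot> act1 (t \<cdot> h) (\<alpha> \<cdot> h)"
          using descent_actionD(7)[OF act com[OF c], of h] a1(5)[OF c, THEN Cmp_reduce, of h]
            a1(5)[OF c'] by simp
      qed simp_all
    qed
    show "act1 s (act1 t \<alpha>) = act1 s \<alpha>" if [simp]: "s \<in> Arr C" "Dom C s = Dom C t"
      "Cod C s = Dom C q1" and e: "q1 \<cdot> s = q1 \<cdot> t" for s
      unfolding act1_def[of s] a1(5)[OF c]
      by (subst descent_actionD(8)[OF act com[OF c]]) (simp_all add: e)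
  next
    fix \<alpha> assume [simp]: "\<alpha> \<in> Arr C" "Cod C \<alpha> = Dom C f1"
    have "act (d \<cdot> (f1 \<cdot> \<alpha>)) (e \<cdot> \<alpha>) = e \<cdot> \<alpha>" using descent_actionD(9)[OF act, of "e \<cdot> \<alpha>"] by simp
    then show "act1 (f1 \<cdot> \<alpha>) \<alpha> = \<alpha>" unfolding act1_def by - (rule pre, simp_all)
  qed simp_all
  then obtain g1 \<pi>1 where pb1: "is_pullback C q1 g1 f1 \<pi>1"
    and inv: "\<And>t \<alpha>. composable C q1 f1 t \<alpha> \<Longrightarrow> \<pi>1 \<cdot> act1 t \<alpha> = \<pi>1 \<cdot> \<alpha>"
    using assms unfolding actions_descend_def by blast
  note [simp] = pullbackD(1-8)[OF pb1]
  note g1[simp] = pullbackD(9)[OF pb1, symmetric]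
  note [simp] = g1[THEN Cmp_reduce]
  define g where "g = pr1 C s' g1"
  define k where "k = pr2 C s' g1"
  have gk[simp]: "g \<in> Arr C" "k \<in> Arr C" "Cod C g = Cod C q0" "Cod C k = Dom C g1"
    "Dom C k = Dom C g"
    "g1 \<cdot> k = s' \<cdot> g" using pr_commute[of s' g1] by (simp_all add: g_def k_def)
  note [simp] = gk(6)[THEN Cmp_reduce]
  have gke: "h = j" if "g \<cdot> h = g \<cdot> j" "k \<cdot> h = k \<cdot> j" "h \<in> Arr C" "j \<in> Arr C" "Dom C j = Dom C h"
    "Cod C h = Dom C g" "Cod C j = Dom C g" for h j
    using pr_eqI[of s' g1 h j] that by (simp add: g_def k_def)
  \<comment> \<open>\<open>m\<close> sends \<open>\<beta>\<close> to
    \<open>(s f \<beta>, \<beta>)\<close>, embedding the source of \<open>f\<close> into that of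
    \<open>d^* f\<close>. It is well defined because \<open>d s\<close> is the identity, and
    \<open>e\<close> is a retraction of it.\<close>
  define m where "m = pr (s \<cdot> f) (Idn C (Dom C f))"
  have m[simp]: "m \<in> Arr C" "Dom C m = Dom C f" "Cod C m = Dom C f1" "f1 \<cdot> m = s \<cdot> f"
    "e \<cdot> m = Idn C (Dom C f)"
    by (simp_all add: m_def)
  note [simp] = m(4,5)[THEN Cmp_reduce]
  define \<pi> where "\<pi> = pb_pair C s' g1 (q0 \<cdot> f) (\<pi>1 \<cdot> m)"
  have \<pi>[simp]: "\<pi> \<in> Arr C" "Dom C \<pi> = Dom C f" "Cod C \<pi> = Dom C g" "g \<cdot> \<pi> = q0 \<cdot> f"
    "k \<cdot> \<pi> = \<pi>1 \<cdot> m"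
    unfolding \<pi>_def g_def k_def by (subst pb_pair_simps; simp)+
  note [simp] = \<pi>(4,5)[THEN Cmp_reduce]
  have "is_pullback C q0 g f \<pi>"
  proof (rule pullbackI)
    fix u v assume [simp]: "u \<in> Arr C" "v \<in> Arr C" "Dom C v = Dom C u" "Cod C u = Dom C q0"
      "Cod C v = Dom C g"
      and uv: "q0 \<cdot> u = g \<cdot> v"
    have "q1 \<cdot> (s \<cdot> u) = g1 \<cdot> (k \<cdot> v)" by (simp add: uv)
    from pullback_lift[OF pb1 this] obtain w1 where w1: "w1 \<in> Arr C" "Dom C w1 = Dom C u"
      "Cod C w1 = Dom C f1" "f1 \<cdot> w1 = s \<cdot> u"
      "\<pi>1 \<cdot> w1 = k \<cdot> v" by auto
    note [simp] = w1
    \<comment> \<open>As \<open>f1 \<cdot> w1\<close> factors through \<open>s\<close>, the element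
      \<open>w1\<close> lies in the image of \<open>m\<close>, so applying the retraction
      \<open>e\<close> loses nothing.\<close>
    have mw: "m \<cdot> (e \<cdot> w1) = w1" by (rule pre) simp_all
    have "\<pi> \<cdot> (e \<cdot> w1) = v" by (rule gke) (simp_all add: mw uv)
    then show "\<exists>h. h \<in> Arr C \<and> Dom C h = Dom C u \<and> Cod C h = Dom C f \<and> f \<cdot> h = u \<and> \<pi> \<cdot> h = v"
      by (intro exI[of _ "e \<cdot> w1"]) simp
  next
    fix h j assume [simp]: "h \<in> Arr C" "j \<in> Arr C" "Dom C j = Dom C h" "Cod C h = Dom C f"
      "Cod C j = Dom C f"
      and eq: "f \<cdot> h = f \<cdot> j" "\<pi> \<cdot> h = \<pi> \<cdot> j"
    have eq2: "\<pi>1 \<cdot> (m \<cdot> h) = \<pi>1 \<cdot> (m \<cdot> j)" using arg_cong[OF eq(2), of "\<lambda>z. k \<cdot> z"] by simp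
    have "m \<cdot> h = m \<cdot> j" by (rule pullback_eqI[OF pb1]) (simp_all add: eq eq2)
    then have "e \<cdot> (m \<cdot> h) = e \<cdot> (m \<cdot> j)" by simp
    then show "h = j" by simp
  qed simp_all
  moreover have "\<pi> \<cdot> act t \<alpha> = \<pi> \<cdot> \<alpha>" if c: "composable C q0 f t \<alpha>" for t \<alpha>
  proof -
    note [simp] = composableD[OF c] 
    note a = descent_actionD(3-6)[OF act c]
    note [simp] = a
    have c1: "composable C q1 f1 (s \<cdot> t) (m \<cdot> \<alpha>)" by (simp add: composable_def)
    note [simp] = a1[OF c1]
    have "m \<cdot> act t \<alpha> = act1 (s \<cdot> t) (m \<cdot> \<alpha>)" by (rule pre) simp_all
    then have "\<pi>1 \<cdot> (m \<cdot> act t \<alpha>) = \<pi>1 \<cdot> (m \<cdot> \<alpha>)" using inv[OF c1] by simp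
    then show ?thesis by - (rule gke, simp_all)
  qed
  ultimately show "\<exists>g \<pi>. is_pullback C q0 g f \<pi> \<and> (\<forall>t \<alpha>. composable C q0 f t \<alpha> \<longrightarrow> \<pi> \<cdot> act t \<alpha> =
    \<pi> \<cdot> \<alpha>)"
    by blast
qed

end

section \<open>Internal categories and their chains\<close>

locale tcat_setting = is_monad C T + pb_category C for C :: "('o, 'a) cat" (structure) and T +
  assumes pres: "preserves_pullbacks C C (endo T)"
begin

abbreviation "TO \<equiv> omap (endo T)"
abbreviation "TA \<equiv> amap (endo T)"

lemma TA_simps [simp]:
  assumes "f \<in> Arr C"
  shows "TA f \<in> Arr C" "Dom C (TA f) = TO (Dom C f)" "Cod C (TA f) = TO (Cod C f)"
  using is_functor.amap_simps[OF endo_functor assms] by auto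

lemma TO_Obj [simp]: "X \<in> Obj C \<Longrightarrow> TO X \<in> Obj C"
  by (rule is_functor.omap_in_Obj[OF endo_functor])

lemma TA_Idn [simp]: "X \<in> Obj C \<Longrightarrow> TA (Idn C X) = Idn C (TO X)"
  by (rule is_functor.amap_Idn[OF endo_functor])

lemma TA_Cmp [simp]: "f \<in> Arr C \<Longrightarrow> g \<in> Arr C \<Longrightarrow> Dom C g = Cod C f \<Longrightarrow> TA (g \<cdot> f) = TA g \<cdot> TA f"
  by (rule is_functor.amap_comp[OF endo_functor])

text \<open>\<open>TA_Cmp\<close> splits the image of every composite, so an equation between
  composites must be supplied in split form to be usable under \<open>T\<close>.\<close>

lemma TA_reduce: "g \<cdot> f = k \<Longrightarrow> f \<in> Arr C \<Longrightarrow> g \<in> Arr C \<Longrightarrow> Dom C g = Cod C f \<Longrightarrow> TA g \<cdot> TA f = TA k"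
  using TA_Cmp[of f g] by simp

lemma unit_simps [simp]:
  assumes "X \<in> Obj C"
  shows "unit T X \<in> Arr C" "Dom C (unit T X) = X" "Cod C (unit T X) = TO X"
  using is_nat_trans.component[OF unit_natural assms] by (auto simp: in_hom_iff)

lemma mult_simps [simp]:
  assumes "X \<in> Obj C"
  shows "mult T X \<in> Arr C" "Dom C (mult T X) = TO (TO X)" "Cod C (mult T X) = TO X"
  using is_nat_trans.component[OF mult_natural assms] by (auto simp: in_hom_iff)

lemma unit_nat: "f \<in> Arr C \<Longrightarrow> Cod C f = Y \<Longrightarrow> unit T Y \<cdot> f = TA f \<cdot> unit T (Dom C f)"
  using is_nat_trans.naturality[OF unit_natural, of f "Dom C f" Y] by (simp add: in_hom_iff)

lemma mult_nat: "f \<in> Arr C \<Longrightarrow> Cod C f = Y \<Longrightarrow> mult T Y \<cdot> TA (TA f) = TA f \<cdot> mult T (Dom C f)"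
  using is_nat_trans.naturality[OF mult_natural, of f "Dom C f" Y] by (simp add: in_hom_iff)

text \<open>Naturality is kept in two opposite orientations: these rules carry arrows to the left of
  \<open>unit\<close> and \<open>mult\<close>, as suits cancelling an epimorphism on the right, and
  those of \<open>nat_right\<close> carry them to the right, as suits jointly monic
  projections.\<close>

lemma nat_left:
  "f \<in> Arr C \<Longrightarrow> Cod C f = Y \<Longrightarrow> unit T Y \<cdot> f = TA f \<cdot> unit T (Dom C f)"
  "f \<in> Arr C \<Longrightarrow> Cod C f = Y \<Longrightarrow> h \<in> Arr C \<Longrightarrow> Cod C h = Dom C f \<Longrightarrow>
    unit T Y \<cdot> (f \<cdot> h) = TA f \<cdot> (unit T (Dom C f) \<cdot> h)"
  "f \<in> Arr C \<Longrightarrow> Cod C f = Y \<Longrightarrow> mult T Y \<cdot> TA (TA f) = TA f \<cdot> mult T (Dom C f)"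
  "f \<in> Arr C \<Longrightarrow> Cod C f = Y \<Longrightarrow> h \<in> Arr C \<Longrightarrow> Cod C h = TO (TO (Dom C f)) \<Longrightarrow>
    mult T Y \<cdot> (TA (TA f) \<cdot> h) = TA f \<cdot> (mult T (Dom C f) \<cdot> h)"
  using unit_nat[of f Y] unit_nat[of f Y, THEN Cmp_reduce, of h]
    mult_nat[of f Y] mult_nat[of f Y, THEN Cmp_reduce, of h] by auto

lemma nat_right:
  "f \<in> Arr C \<Longrightarrow> Dom C f = X \<Longrightarrow> TA f \<cdot> unit T X = unit T (Cod C f) \<cdot> f"
  "f \<in> Arr C \<Longrightarrow> Dom C f = X \<Longrightarrow> h \<in> Arr C \<Longrightarrow> Cod C h = X \<Longrightarrow>
    TA f \<cdot> (unit T X \<cdot> h) = unit T (Cod C f) \<cdot> (f \<cdot> h)"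
  "f \<in> Arr C \<Longrightarrow> Dom C f = X \<Longrightarrow> TA f \<cdot> mult T X = mult T (Cod C f) \<cdot> TA (TA f)"
  "f \<in> Arr C \<Longrightarrow> Dom C f = X \<Longrightarrow> h \<in> Arr C \<Longrightarrow> Cod C h = TO (TO X) \<Longrightarrow>
    TA f \<cdot> (mult T X \<cdot> h) = mult T (Cod C f) \<cdot> (TA (TA f) \<cdot> h)"
  using nat_left(1,3)[of f "Cod C f"] nat_left(2,4)[of f "Cod C f" h] by auto

lemma T_pullback: "is_pullback C f g p q \<Longrightarrow> is_pullback C (TA f) (TA g) (TA p) (TA q)"
  using pres by (simp add: preserves_pullbacks_def)

section \<open>Layers of the structure: graph, operations, boundary axioms\<close>

definition tgraph :: "('o, 'a) tcat \<Rightarrow> bool" where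
  "tgraph x \<longleftrightarrow> ob0 x \<in> Obj C \<and> ob1 x \<in> Obj C \<and>
    d1 x \<in> hom C (ob1 x) (TO (ob0 x)) \<and> d0 x \<in> hom C (ob1 x) (ob0 x)"

definition tstruct :: "('o, 'a) tcat \<Rightarrow> bool" where
  "tstruct x \<longleftrightarrow> tgraph x \<and> s0 x \<in> hom C (ob0 x) (ob1 x) \<and> cm x \<in> hom C (chains2 C T x) (ob1 x)"

text \<open>The boundary axioms are singled out because they make the pairs in the unit and
  associativity laws land in the 2-chains: the rules for \<open>pair2\<close> require
  \<open>d1 x \<cdot> u = TA (d0 x) \<cdot> v\<close>, and each of the four axioms secures this for
  one of the four pairs.\<close>

definition tprecat :: "('o, 'a) tcat \<Rightarrow> bool" where
  "tprecat x \<longleftrightarrow> tstruct x \<and> d0 x \<cdot> s0 x = Idn C (ob0 x) \<and> d1 x \<cdot> s0 x = unit T (ob0 x) \<and>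
    d0 x \<cdot> cm x = d0 x \<cdot> pi0 C T x \<and> d1 x \<cdot> cm x = mult T (ob0 x) \<cdot> (TA (d1 x) \<cdot> pi2 C T x)"

abbreviation "\<pi>0 \<equiv> pi0 C T"
abbreviation "\<pi>2 \<equiv> pi2 C T"
abbreviation "\<rho>0 \<equiv> rho0 C T"
abbreviation "\<rho>3 \<equiv> rho3 C T"
abbreviation "ind2 \<equiv> induced2 C T"
abbreviation "ind3 \<equiv> induced3 C T"

lemma tgraph_simps [simp]:
  assumes "tgraph x"
  shows "ob0 x \<in> Obj C" "ob1 x \<in> Obj C" "d1 x \<in> Arr C" "Dom C (d1 x) = ob1 x"
    "Cod C (d1 x) = TO (ob0 x)"
    "d0 x \<in> Arr C" "Dom C (d0 x) = ob1 x" "Cod C (d0 x) = ob0 x"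
  using assms by (auto simp: tgraph_def in_hom_iff)

lemma chains2_pullback: "tgraph x \<Longrightarrow> is_pullback C (d1 x) (TA (d0 x)) (\<pi>0 x) (\<pi>2 x)"
  unfolding pi0_def pi2_def by (rule pr_pullback) simp_all

lemma pi_simps [simp]:
  assumes "tgraph x"
  shows "\<pi>0 x \<in> Arr C" "\<pi>2 x \<in> Arr C" "Dom C (\<pi>0 x) = chains2 C T x" "Dom C (\<pi>2 x) = chains2 C T x"
   "Cod C (\<pi>0 x) = ob1 x" "Cod C (\<pi>2 x) = TO (ob1 x)"
  using pullbackD[OF chains2_pullback[OF assms]] assms
    by (auto simp: chains2_def pb_obj_def pi0_def)

lemma chains2_Obj [simp]: "tgraph x \<Longrightarrow> chains2 C T x \<in> Obj C"
  using Dom_Obj[of "\<pi>0 x"] by simp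

lemma pi_commute [simp]: "tgraph x \<Longrightarrow> d1 x \<cdot> \<pi>0 x = TA (d0 x) \<cdot> \<pi>2 x"
  using pullbackD[OF chains2_pullback] by auto

lemma pi_commute_reduce [simp]:
  assumes "tgraph x"
  shows "h \<in> Arr C \<Longrightarrow> Cod C h = chains2 C T x \<Longrightarrow> d1 x \<cdot> (\<pi>0 x \<cdot> h) = TA (d0 x) \<cdot> (\<pi>2 x \<cdot> h)"
    "TA (d1 x) \<cdot> TA (\<pi>0 x) = TA (TA (d0 x)) \<cdot> TA (\<pi>2 x)"
    "k \<in> Arr C \<Longrightarrow> Cod C k = TO (chains2 C T x) \<Longrightarrow> TA (d1 x) \<cdot> (TA (\<pi>0 x) \<cdot> k) =
      TA (TA (d0 x)) \<cdot> (TA (\<pi>2 x) \<cdot> k)"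
  using pi_commute[OF assms, THEN Cmp_reduce, of h] pi_commute[OF assms, THEN TA_reduce]
   pi_commute[OF assms, THEN TA_reduce, THEN Cmp_reduce, of k] assms by simp_all

lemma chains3_pullback: "tgraph x \<Longrightarrow> is_pullback C (\<pi>2 x) (TA (\<pi>0 x)) (\<rho>0 x) (\<rho>3 x)"
  unfolding rho0_def rho3_def by (rule pr_pullback) simp_all

lemma rho_simps [simp]:
  assumes "tgraph x"
  shows "\<rho>0 x \<in> Arr C" "\<rho>3 x \<in> Arr C" "Dom C (\<rho>0 x) = chains3 C T x" "Dom C (\<rho>3 x) = chains3 C T x"
   "Cod C (\<rho>0 x) = chains2 C T x" "Cod C (\<rho>3 x) = TO (chains2 C T x)"
  using pullbackD[OF chains3_pullback[OF assms]] assms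
    by (auto simp: chains3_def pb_obj_def rho0_def)

lemma chains3_Obj [simp]: "tgraph x \<Longrightarrow> chains3 C T x \<in> Obj C"
  using Dom_Obj[of "\<rho>0 x"] by simp

lemma rho_commute [simp]: "tgraph x \<Longrightarrow> \<pi>2 x \<cdot> \<rho>0 x = TA (\<pi>0 x) \<cdot> \<rho>3 x"
  using pullbackD[OF chains3_pullback] by auto

lemma rho_commute_reduce [simp]:
  "tgraph x \<Longrightarrow> h \<in> Arr C \<Longrightarrow> Cod C h = chains3 C T x \<Longrightarrow> \<pi>2 x \<cdot> (\<rho>0 x \<cdot> h) = TA (\<pi>0 x) \<cdot> (\<rho>3 x \<cdot> h)"
  using rho_commute[of x, THEN Cmp_reduce, of h] by simp

lemma chains2_eqI:
  assumes "tgraph x" "\<pi>0 x \<cdot> h = \<pi>0 x \<cdot> k" "\<pi>2 x \<cdot> h = \<pi>2 x \<cdot> k" "h \<in> Arr C" "k \<in> Arr C"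
    "Dom C k = Dom C h" "Cod C h = chains2 C T x" "Cod C k = chains2 C T x"
  shows "h = k"
  by (rule pullback_eqI[OF chains2_pullback[of x]]) (use assms in simp_all)

lemma chains3_eqI:
  assumes "tgraph x" "\<rho>0 x \<cdot> h = \<rho>0 x \<cdot> k" "\<rho>3 x \<cdot> h = \<rho>3 x \<cdot> k" "h \<in> Arr C" "k \<in> Arr C"
    "Dom C k = Dom C h" "Cod C h = chains3 C T x" "Cod C k = chains3 C T x"
  shows "h = k"
  by (rule pullback_eqI[OF chains3_pullback[of x]]) (use assms in simp_all)

lemma pair2_simps [simp]:
  assumes "tgraph x" "u \<in> Arr C" "v \<in> Arr C" "Dom C v = Dom C u" "Cod C u = ob1 x"
    "Cod C v = TO (ob1 x)"
    "d1 x \<cdot> u = TA (d0 x) \<cdot> v"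
  shows "pair2 C T x u v \<in> Arr C" "Dom C (pair2 C T x u v) = Dom C u"
    "Cod C (pair2 C T x u v) = chains2 C T x"
    "\<pi>0 x \<cdot> pair2 C T x u v = u" "\<pi>2 x \<cdot> pair2 C T x u v = v"
    "h \<in> Arr C \<Longrightarrow> Cod C h = Dom C u \<Longrightarrow> \<pi>0 x \<cdot> (pair2 C T x u v \<cdot> h) = u \<cdot> h"
    "h \<in> Arr C \<Longrightarrow> Cod C h = Dom C u \<Longrightarrow> \<pi>2 x \<cdot> (pair2 C T x u v \<cdot> h) = v \<cdot> h"
  using pb_pair_simps[of "d1 x" "TA (d0 x)" u v] pb_pair_reduce[of "d1 x" "TA (d0 x)" u v h] assms
  by (auto simp: pair2_def pi0_def pi2_def chains2_def pb_obj_def)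

lemma pair3_simps [simp]:
  assumes "tgraph x" "u \<in> Arr C" "v \<in> Arr C" "Dom C v = Dom C u" "Cod C u = chains2 C T x"
    "Cod C v = TO (chains2 C T x)"
    "\<pi>2 x \<cdot> u = TA (\<pi>0 x) \<cdot> v"
  shows "pair3 C T x u v \<in> Arr C" "Dom C (pair3 C T x u v) = Dom C u"
    "Cod C (pair3 C T x u v) = chains3 C T x"
    "\<rho>0 x \<cdot> pair3 C T x u v = u" "\<rho>3 x \<cdot> pair3 C T x u v = v"
  using pb_pair_simps[of "\<pi>2 x" "TA (\<pi>0 x)" u v] assms
  by (auto simp: pair3_def rho0_def rho3_def chains3_def pb_obj_def)

section \<open>Graph maps, functors, and their action on chains\<close>

definition tmap :: "('o, 'a) tcat \<Rightarrow> ('o, 'a) tcat \<Rightarrow> 'a \<Rightarrow> 'a \<Rightarrow> bool" where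
  "tmap x y p0 p1 \<longleftrightarrow> tgraph x \<and> tgraph y \<and> p0 \<in> hom C (ob0 x) (ob0 y) \<and> p1 \<in> hom C (ob1 x) (ob1 y) \<and>
    d0 y \<cdot> p1 = p0 \<cdot> d0 x \<and> d1 y \<cdot> p1 = TA p0 \<cdot> d1 x"

text \<open>Only operations of \<open>x\<close> and \<open>y\<close> are presupposed, no axioms.
  Thus the map onto a structure under construction counts as a functor before that structure is
  known to be a \<open>T\<close>-category.\<close>

definition tfun :: "('o, 'a) tcat \<Rightarrow> ('o, 'a) tcat \<Rightarrow> 'a \<Rightarrow> 'a \<Rightarrow> bool" where
  "tfun x y p0 p1 \<longleftrightarrow> tmap x y p0 p1 \<and> tstruct x \<and> tstruct y \<and> p1 \<cdot> s0 x = s0 y \<cdot> p0 \<and>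
    p1 \<cdot> cm x = cm y \<cdot> ind2 x y p1"

lemma tfun_tmap: "tfun x y p0 p1 \<Longrightarrow> tmap x y p0 p1"
  by (simp add: tfun_def)

lemma tmap_typing:
  assumes "tmap x y p0 p1"
  shows "tgraph x" "tgraph y" "p0 \<in> Arr C" "Dom C p0 = ob0 x" "Cod C p0 = ob0 y"
    "p1 \<in> Arr C" "Dom C p1 = ob1 x" "Cod C p1 = ob1 y"
  using assms by (auto simp: tmap_def in_hom_iff)

lemma tmap_left0:
  assumes "tmap x y p0 p1"
  shows "d0 y \<cdot> p1 = p0 \<cdot> d0 x" "d1 y \<cdot> p1 = TA p0 \<cdot> d1 x"
    "h \<in> Arr C \<Longrightarrow> Cod C h = ob1 x \<Longrightarrow> d0 y \<cdot> (p1 \<cdot> h) = p0 \<cdot> (d0 x \<cdot> h)"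
    "h \<in> Arr C \<Longrightarrow> Cod C h = ob1 x \<Longrightarrow> d1 y \<cdot> (p1 \<cdot> h) = TA p0 \<cdot> (d1 x \<cdot> h)"
    "TA (d0 y) \<cdot> TA p1 = TA p0 \<cdot> TA (d0 x)" "TA (d1 y) \<cdot> TA p1 = TA (TA p0) \<cdot> TA (d1 x)"
    "k \<in> Arr C \<Longrightarrow> Cod C k = TO (ob1 x) \<Longrightarrow> TA (d0 y) \<cdot> (TA p1 \<cdot> k) = TA p0 \<cdot> (TA (d0 x) \<cdot> k)"
    "k \<in> Arr C \<Longrightarrow> Cod C k = TO (ob1 x) \<Longrightarrow> TA (d1 y) \<cdot> (TA p1 \<cdot> k) = TA (TA p0) \<cdot> (TA (d1 x) \<cdot> k)"
proof -
  note [simp] = tmap_typing[OF assms]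
  show e: "d0 y \<cdot> p1 = p0 \<cdot> d0 x" "d1 y \<cdot> p1 = TA p0 \<cdot> d1 x" using assms by (simp_all add: tmap_def)
  show "h \<in> Arr C \<Longrightarrow> Cod C h = ob1 x \<Longrightarrow> d0 y \<cdot> (p1 \<cdot> h) = p0 \<cdot> (d0 x \<cdot> h)"
    "h \<in> Arr C \<Longrightarrow> Cod C h = ob1 x \<Longrightarrow> d1 y \<cdot> (p1 \<cdot> h) = TA p0 \<cdot> (d1 x \<cdot> h)"
    "TA (d0 y) \<cdot> TA p1 = TA p0 \<cdot> TA (d0 x)" "TA (d1 y) \<cdot> TA p1 = TA (TA p0) \<cdot> TA (d1 x)"
    "k \<in> Arr C \<Longrightarrow> Cod C k = TO (ob1 x) \<Longrightarrow> TA (d0 y) \<cdot> (TA p1 \<cdot> k) = TA p0 \<cdot> (TA (d0 x) \<cdot> k)"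
    "k \<in> Arr C \<Longrightarrow> Cod C k = TO (ob1 x) \<Longrightarrow> TA (d1 y) \<cdot> (TA p1 \<cdot> k) = TA (TA p0) \<cdot> (TA (d1 x) \<cdot> k)"
    using e[THEN Cmp_reduce] e[THEN TA_reduce] e[THEN TA_reduce, THEN Cmp_reduce] by simp_all
qed

lemma ind2_typing:
  assumes "tmap x y p0 p1"
  shows "ind2 x y p1 \<in> Arr C" "Dom C (ind2 x y p1) = chains2 C T x"
    "Cod C (ind2 x y p1) = chains2 C T y"
   and "\<pi>0 y \<cdot> ind2 x y p1 = p1 \<cdot> \<pi>0 x" "\<pi>2 y \<cdot> ind2 x y p1 = TA p1 \<cdot> \<pi>2 x"
proof -
  note [simp] = tmap_typing[OF assms] tmap_left0[OF assms]
  show "ind2 x y p1 \<in> Arr C" "Dom C (ind2 x y p1) = chains2 C T x"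
    "Cod C (ind2 x y p1) = chains2 C T y"
    "\<pi>0 y \<cdot> ind2 x y p1 = p1 \<cdot> \<pi>0 x" "\<pi>2 y \<cdot> ind2 x y p1 = TA p1 \<cdot> \<pi>2 x"
    by (simp_all add: induced2_def)
qed

lemma ind3_typing:
  assumes "tmap x y p0 p1"
  shows "ind3 x y p1 \<in> Arr C" "Dom C (ind3 x y p1) = chains3 C T x"
    "Cod C (ind3 x y p1) = chains3 C T y"
   and "\<rho>0 y \<cdot> ind3 x y p1 = ind2 x y p1 \<cdot> \<rho>0 x" "\<rho>3 y \<cdot> ind3 x y p1 = TA (ind2 x y p1) \<cdot> \<rho>3 x"
proof -
  note [simp] = tmap_typing[OF assms] ind2_typing[OF assms]
  note [simp] = ind2_typing(4,5)[OF assms, THEN Cmp_reduce] ind2_typing(4,5)[OF assms, THEN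
    TA_reduce, THEN Cmp_reduce]
  show "ind3 x y p1 \<in> Arr C" "Dom C (ind3 x y p1) = chains3 C T x"
    "Cod C (ind3 x y p1) = chains3 C T y"
    "\<rho>0 y \<cdot> ind3 x y p1 = ind2 x y p1 \<cdot> \<rho>0 x" "\<rho>3 y \<cdot> ind3 x y p1 = TA (ind2 x y p1) \<cdot> \<rho>3 x"
    by (simp_all add: induced3_def)
qed

lemmas tmap_types = tmap_typing ind2_typing(1-3) ind3_typing(1-3)

lemma tmap_left1:
  assumes "tmap x y p0 p1"
  shows "\<pi>0 y \<cdot> ind2 x y p1 = p1 \<cdot> \<pi>0 x" "\<pi>2 y \<cdot> ind2 x y p1 = TA p1 \<cdot> \<pi>2 x"
    "h \<in> Arr C \<Longrightarrow> Cod C h = chains2 C T x \<Longrightarrow> \<pi>0 y \<cdot> (ind2 x y p1 \<cdot> h) = p1 \<cdot> (\<pi>0 x \<cdot> h)"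
    "h \<in> Arr C \<Longrightarrow> Cod C h = chains2 C T x \<Longrightarrow> \<pi>2 y \<cdot> (ind2 x y p1 \<cdot> h) = TA p1 \<cdot> (\<pi>2 x \<cdot> h)"
    "TA (\<pi>0 y) \<cdot> TA (ind2 x y p1) = TA p1 \<cdot> TA (\<pi>0 x)"
      "TA (\<pi>2 y) \<cdot> TA (ind2 x y p1) = TA (TA p1) \<cdot> TA (\<pi>2 x)"
    "k \<in> Arr C \<Longrightarrow> Cod C k = TO (chains2 C T x) \<Longrightarrow> TA (\<pi>0 y) \<cdot> (TA (ind2 x y p1) \<cdot> k) =
      TA p1 \<cdot> (TA (\<pi>0 x) \<cdot> k)"
    "k \<in> Arr C \<Longrightarrow> Cod C k = TO (chains2 C T x) \<Longrightarrow> TA (\<pi>2 y) \<cdot> (TA (ind2 x y p1) \<cdot> k) =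
      TA (TA p1) \<cdot> (TA (\<pi>2 x) \<cdot> k)"
    "\<rho>0 y \<cdot> ind3 x y p1 = ind2 x y p1 \<cdot> \<rho>0 x" "\<rho>3 y \<cdot> ind3 x y p1 = TA (ind2 x y p1) \<cdot> \<rho>3 x"
    "j \<in> Arr C \<Longrightarrow> Cod C j = chains3 C T x \<Longrightarrow> \<rho>0 y \<cdot> (ind3 x y p1 \<cdot> j) = ind2 x y p1 \<cdot> (\<rho>0 x \<cdot> j)"
    "j \<in> Arr C \<Longrightarrow> Cod C j = chains3 C T x \<Longrightarrow> \<rho>3 y \<cdot> (ind3 x y p1 \<cdot> j) = TA (ind2 x y p1) \<cdot> (\<rho>3 x \<cdot> j)"
proof -
  note [simp] = tmap_types[OF assms]
  note e = ind2_typing(4,5)[OF assms] ind3_typing(4,5)[OF assms]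
  note e[THEN Cmp_reduce, simp] e[THEN TA_reduce, THEN Cmp_reduce, simp] e[THEN TA_reduce, simp]
    e[simp]
  show "\<pi>0 y \<cdot> ind2 x y p1 = p1 \<cdot> \<pi>0 x" "\<pi>2 y \<cdot> ind2 x y p1 = TA p1 \<cdot> \<pi>2 x"
    "h \<in> Arr C \<Longrightarrow> Cod C h = chains2 C T x \<Longrightarrow> \<pi>0 y \<cdot> (ind2 x y p1 \<cdot> h) = p1 \<cdot> (\<pi>0 x \<cdot> h)"
    "h \<in> Arr C \<Longrightarrow> Cod C h = chains2 C T x \<Longrightarrow> \<pi>2 y \<cdot> (ind2 x y p1 \<cdot> h) = TA p1 \<cdot> (\<pi>2 x \<cdot> h)"
    "TA (\<pi>0 y) \<cdot> TA (ind2 x y p1) = TA p1 \<cdot> TA (\<pi>0 x)"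
      "TA (\<pi>2 y) \<cdot> TA (ind2 x y p1) = TA (TA p1) \<cdot> TA (\<pi>2 x)"
    "k \<in> Arr C \<Longrightarrow> Cod C k = TO (chains2 C T x) \<Longrightarrow> TA (\<pi>0 y) \<cdot> (TA (ind2 x y p1) \<cdot> k) =
      TA p1 \<cdot> (TA (\<pi>0 x) \<cdot> k)"
    "k \<in> Arr C \<Longrightarrow> Cod C k = TO (chains2 C T x) \<Longrightarrow> TA (\<pi>2 y) \<cdot> (TA (ind2 x y p1) \<cdot> k) =
      TA (TA p1) \<cdot> (TA (\<pi>2 x) \<cdot> k)"
    "\<rho>0 y \<cdot> ind3 x y p1 = ind2 x y p1 \<cdot> \<rho>0 x" "\<rho>3 y \<cdot> ind3 x y p1 = TA (ind2 x y p1) \<cdot> \<rho>3 x"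
    "j \<in> Arr C \<Longrightarrow> Cod C j = chains3 C T x \<Longrightarrow> \<rho>0 y \<cdot> (ind3 x y p1 \<cdot> j) = ind2 x y p1 \<cdot> (\<rho>0 x \<cdot> j)"
    "j \<in> Arr C \<Longrightarrow> Cod C j = chains3 C T x \<Longrightarrow> \<rho>3 y \<cdot> (ind3 x y p1 \<cdot> j) = TA (ind2 x y p1) \<cdot> (\<rho>3 x \<cdot> j)"
    by simp_all
qed

lemmas tmap_left = tmap_left0 tmap_left1

lemma tstruct_simps [simp]:
  assumes "tstruct x"
  shows "tgraph x" "s0 x \<in> Arr C" "Dom C (s0 x) = ob0 x" "Cod C (s0 x) = ob1 x"
    "cm x \<in> Arr C" "Dom C (cm x) = chains2 C T x" "Cod C (cm x) = ob1 x"
  using assms by (auto simp: tstruct_def in_hom_iff)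

lemma tfun_struct: "tfun x y p0 p1 \<Longrightarrow> tstruct x" "tfun x y p0 p1 \<Longrightarrow> tstruct y"
  by (simp_all add: tfun_def)

lemma tfun_left:
  assumes "tfun x y p0 p1"
  shows "s0 y \<cdot> p0 = p1 \<cdot> s0 x" "cm y \<cdot> ind2 x y p1 = p1 \<cdot> cm x"
    "h \<in> Arr C \<Longrightarrow> Cod C h = ob0 x \<Longrightarrow> s0 y \<cdot> (p0 \<cdot> h) = p1 \<cdot> (s0 x \<cdot> h)"
    "j \<in> Arr C \<Longrightarrow> Cod C j = chains2 C T x \<Longrightarrow> cm y \<cdot> (ind2 x y p1 \<cdot> j) = p1 \<cdot> (cm x \<cdot> j)"
    "TA (s0 y) \<cdot> TA p0 = TA p1 \<cdot> TA (s0 x)" "TA (cm y) \<cdot> TA (ind2 x y p1) = TA p1 \<cdot> TA (cm x)"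
    "k \<in> Arr C \<Longrightarrow> Cod C k = TO (ob0 x) \<Longrightarrow> TA (s0 y) \<cdot> (TA p0 \<cdot> k) = TA p1 \<cdot> (TA (s0 x) \<cdot> k)"
    "l \<in> Arr C \<Longrightarrow> Cod C l = TO (chains2 C T x) \<Longrightarrow> TA (cm y) \<cdot> (TA (ind2 x y p1) \<cdot> l) =
      TA p1 \<cdot> (TA (cm x) \<cdot> l)"
proof -
  note [simp] = tmap_types[OF tfun_tmap[OF assms]] tfun_struct[OF assms]
  show e: "s0 y \<cdot> p0 = p1 \<cdot> s0 x" "cm y \<cdot> ind2 x y p1 = p1 \<cdot> cm x" using assms
    by (simp_all add: tfun_def)
  show 
    "h \<in> Arr C \<Longrightarrow> Cod C h = ob0 x \<Longrightarrow> s0 y \<cdot> (p0 \<cdot> h) = p1 \<cdot> (s0 x \<cdot> h)"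
    "j \<in> Arr C \<Longrightarrow> Cod C j = chains2 C T x \<Longrightarrow> cm y \<cdot> (ind2 x y p1 \<cdot> j) = p1 \<cdot> (cm x \<cdot> j)"
    "TA (s0 y) \<cdot> TA p0 = TA p1 \<cdot> TA (s0 x)" "TA (cm y) \<cdot> TA (ind2 x y p1) = TA p1 \<cdot> TA (cm x)"
    "k \<in> Arr C \<Longrightarrow> Cod C k = TO (ob0 x) \<Longrightarrow> TA (s0 y) \<cdot> (TA p0 \<cdot> k) = TA p1 \<cdot> (TA (s0 x) \<cdot> k)"
    "l \<in> Arr C \<Longrightarrow> Cod C l = TO (chains2 C T x) \<Longrightarrow> TA (cm y) \<cdot> (TA (ind2 x y p1) \<cdot> l) =
      TA p1 \<cdot> (TA (cm x) \<cdot> l)"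
    using e[THEN Cmp_reduce] e[THEN TA_reduce] e[THEN TA_reduce, THEN Cmp_reduce] by simp_all
qed

text \<open>As rewrite rules, the left versions collect the components of a functor at the left of a composite,
  as needed for cancelling an epimorphism on the right; the right versions prepare cancelling jointly
  monic projections.\<close>

lemmas tmap_right = tmap_left[symmetric]
lemmas tfun_right = tfun_left[symmetric]

lemma tmap_comp:
  assumes "tmap x y p0 p1" "tmap y z q0 q1"
  shows "tmap x z (q0 \<cdot> p0) (q1 \<cdot> p1)" "ind2 x z (q1 \<cdot> p1) = ind2 y z q1 \<cdot> ind2 x y p1"
    "ind3 x z (q1 \<cdot> p1) = ind3 y z q1 \<cdot> ind3 x y p1"
proof -
  note [simp] = tmap_types[OF assms(1)] tmap_types[OF assms(2)] tmap_left[OF assms(1)]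
    tmap_left[OF assms(2)]
  show m: "tmap x z (q0 \<cdot> p0) (q1 \<cdot> p1)" by (simp add: tmap_def in_hom_iff)
  note [simp] = tmap_types[OF m] tmap_left1[OF m]
  show i: "ind2 x z (q1 \<cdot> p1) = ind2 y z q1 \<cdot> ind2 x y p1" by (rule chains2_eqI[of z]) simp_all
  show "ind3 x z (q1 \<cdot> p1) = ind3 y z q1 \<cdot> ind3 x y p1"
    by (rule chains3_eqI[of z]) (simp_all add: i)
qed

lemma tmap_id:
  assumes [simp]: "tgraph x"
  shows "tmap x x (Idn C (ob0 x)) (Idn C (ob1 x))"
    "ind2 x x (Idn C (ob1 x)) = Idn C (chains2 C T x)"
proof -
  show m: "tmap x x (Idn C (ob0 x)) (Idn C (ob1 x))" by (simp add: tmap_def in_hom_iff)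
  note [simp] = tmap_types[OF m] tmap_left1[OF m]
  show "ind2 x x (Idn C (ob1 x)) = Idn C (chains2 C T x)" by (rule chains2_eqI[of x]) simp_all
qed

lemma tprecat_simps [simp]:
  assumes "tprecat x"
  shows "tstruct x" "d0 x \<cdot> s0 x = Idn C (ob0 x)" "d1 x \<cdot> s0 x = unit T (ob0 x)"
    "d0 x \<cdot> cm x = d0 x \<cdot> \<pi>0 x" "d1 x \<cdot> cm x = mult T (ob0 x) \<cdot> (TA (d1 x) \<cdot> \<pi>2 x)"
    "h \<in> Arr C \<Longrightarrow> Cod C h = ob0 x \<Longrightarrow> d0 x \<cdot> (s0 x \<cdot> h) = h"
    "h \<in> Arr C \<Longrightarrow> Cod C h = ob0 x \<Longrightarrow> d1 x \<cdot> (s0 x \<cdot> h) = unit T (ob0 x) \<cdot> h"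
    "k \<in> Arr C \<Longrightarrow> Cod C k = chains2 C T x \<Longrightarrow> d0 x \<cdot> (cm x \<cdot> k) = d0 x \<cdot> (\<pi>0 x \<cdot> k)"
    "k \<in> Arr C \<Longrightarrow> Cod C k = chains2 C T x \<Longrightarrow> d1 x \<cdot> (cm x \<cdot> k) =
      mult T (ob0 x) \<cdot> (TA (d1 x) \<cdot> (\<pi>2 x \<cdot> k))"
    "l \<in> Arr C \<Longrightarrow> Cod C l = TO (ob0 x) \<Longrightarrow> TA (d0 x) \<cdot> (TA (s0 x) \<cdot> l) = l"
    "j \<in> Arr C \<Longrightarrow> Cod C j = TO (chains2 C T x) \<Longrightarrow> TA (d0 x) \<cdot> (TA (cm x) \<cdot> j) =
      TA (d0 x) \<cdot> (TA (\<pi>0 x) \<cdot> j)"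
proof -
  show e: "tstruct x" "d0 x \<cdot> s0 x = Idn C (ob0 x)" "d1 x \<cdot> s0 x = unit T (ob0 x)"
    "d0 x \<cdot> cm x = d0 x \<cdot> \<pi>0 x" "d1 x \<cdot> cm x = mult T (ob0 x) \<cdot> (TA (d1 x) \<cdot> \<pi>2 x)"
    using assms by (simp_all add: tprecat_def)
  note [simp] = e(1)
  show "h \<in> Arr C \<Longrightarrow> Cod C h = ob0 x \<Longrightarrow> d0 x \<cdot> (s0 x \<cdot> h) = h"
    "h \<in> Arr C \<Longrightarrow> Cod C h = ob0 x \<Longrightarrow> d1 x \<cdot> (s0 x \<cdot> h) = unit T (ob0 x) \<cdot> h"
    "k \<in> Arr C \<Longrightarrow> Cod C k = chains2 C T x \<Longrightarrow> d0 x \<cdot> (cm x \<cdot> k) = d0 x \<cdot> (\<pi>0 x \<cdot> k)"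
    "k \<in> Arr C \<Longrightarrow> Cod C k = chains2 C T x \<Longrightarrow> d1 x \<cdot> (cm x \<cdot> k) =
      mult T (ob0 x) \<cdot> (TA (d1 x) \<cdot> (\<pi>2 x \<cdot> k))"
    "l \<in> Arr C \<Longrightarrow> Cod C l = TO (ob0 x) \<Longrightarrow> TA (d0 x) \<cdot> (TA (s0 x) \<cdot> l) = l"
    "j \<in> Arr C \<Longrightarrow> Cod C j = TO (chains2 C T x) \<Longrightarrow> TA (d0 x) \<cdot> (TA (cm x) \<cdot> j) =
      TA (d0 x) \<cdot> (TA (\<pi>0 x) \<cdot> j)"
    using e(2-5)[THEN Cmp_reduce] e(2,4)[THEN TA_reduce, THEN Cmp_reduce] by simp_all
qed

section \<open>Unit and associativity laws as natural equations\<close>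

abbreviation "unitL x \<equiv> pair2 C T x (s0 x \<cdot> d0 x) (unit T (ob1 x))"
abbreviation "unitR x \<equiv> pair2 C T x (Idn C (ob1 x)) (TA (s0 x) \<cdot> d1 x)"
abbreviation "assocL x \<equiv> pair2 C T x (\<pi>0 x \<cdot> \<rho>0 x) (TA (cm x) \<cdot> \<rho>3 x)"
abbreviation "assocR x \<equiv> pair2 C T x (cm x \<cdot> \<rho>0 x) (mult T (ob1 x) \<cdot> TA (\<pi>2 x) \<cdot> \<rho>3 x)"

lemma is_tcat_iff:
  "is_tcat C T x \<longleftrightarrow> tprecat x \<and> cm x \<cdot> unitL x = Idn C (ob1 x) \<and> cm x \<cdot> unitR x = Idn C (ob1 x) \<and>
    cm x \<cdot> assocL x = cm x \<cdot> assocR x"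
  unfolding is_tcat_def tprecat_def tstruct_def tgraph_def by blast

lemma is_tcat_tprecat [simp]: "is_tcat C T x \<Longrightarrow> tprecat x"
  by (simp add: is_tcat_iff)

lemma law_chains [simp]:
  assumes "tprecat x"
  shows "unitL x \<in> Arr C" "Dom C (unitL x) = ob1 x" "Cod C (unitL x) = chains2 C T x"
    "unitR x \<in> Arr C" "Dom C (unitR x) = ob1 x" "Cod C (unitR x) = chains2 C T x"
    "assocL x \<in> Arr C" "Dom C (assocL x) = chains3 C T x" "Cod C (assocL x) = chains2 C T x"
    "assocR x \<in> Arr C" "Dom C (assocR x) = chains3 C T x" "Cod C (assocR x) = chains2 C T x"
  using assms by (simp_all add: nat_left)

text \<open>Arrows into the 2-chains of \<open>y\<close> are compared after \<open>\<pi>0\<close>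
  and \<open>\<pi>2\<close>; what remains is preservation of the operations by the functor and
  naturality of \<open>unit\<close> and \<open>mult\<close>.\<close>

lemma law_chains_natural:
  assumes p: "tfun x y p0 p1" and [simp]: "tprecat x" "tprecat y"
  shows "ind2 x y p1 \<cdot> unitL x = unitL y \<cdot> p1" "ind2 x y p1 \<cdot> unitR x = unitR y \<cdot> p1"
    "ind2 x y p1 \<cdot> assocL x = assocL y \<cdot> ind3 x y p1"
      "ind2 x y p1 \<cdot> assocR x = assocR y \<cdot> ind3 x y p1"
proof -
  note [simp] = tmap_types[OF tfun_tmap[OF p]] tmap_left[OF tfun_tmap[OF p]] tfun_left[OF p]
  show "ind2 x y p1 \<cdot> unitL x = unitL y \<cdot> p1" by (rule chains2_eqI[of y]) (simp_all add: nat_left)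
  show "ind2 x y p1 \<cdot> unitR x = unitR y \<cdot> p1" by (rule chains2_eqI[of y]) (simp_all add: nat_left)
  show "ind2 x y p1 \<cdot> assocL x = assocL y \<cdot> ind3 x y p1"
    by (rule chains2_eqI[of y]) (simp_all add: nat_left)
  show "ind2 x y p1 \<cdot> assocR x = assocR y \<cdot> ind3 x y p1"
    by (rule chains2_eqI[of y]) (simp_all add: nat_left)
qed

text \<open>With both sides of every law natural, laws pass backward along jointly monic functors
  and forward along epimorphic ones; the next two lemmas do just that.\<close>

lemma law_transport:
  assumes p: "tfun x y p0 p1" and [simp]: "tprecat x" "tprecat y"
  shows "p1 \<cdot> (cm x \<cdot> unitL x) = (cm y \<cdot> unitL y) \<cdot> p1"
    "p1 \<cdot> (cm x \<cdot> unitR x) = (cm y \<cdot> unitR y) \<cdot> p1"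
    "p1 \<cdot> (cm x \<cdot> assocL x) = (cm y \<cdot> assocL y) \<cdot> ind3 x y p1"
      "p1 \<cdot> (cm x \<cdot> assocR x) = (cm y \<cdot> assocR y) \<cdot> ind3 x y p1"
proof -
  note t = tmap_types[OF tfun_tmap[OF p]] law_chains[OF assms(2)] law_chains[OF assms(3)]
    tstruct_simps[OF tfun_struct(1)[OF p]]
    tstruct_simps[OF tfun_struct(2)[OF p]]
  note n = law_chains_natural[OF assms]
  have r: "p1 \<cdot> (cm x \<cdot> h) = cm y \<cdot> (ind2 x y p1 \<cdot> h)" if "h \<in> Arr C" "Cod C h = chains2 C T x"
    for h
    using tfun_left(4)[OF p that] by simp
  show "p1 \<cdot> (cm x \<cdot> unitL x) = (cm y \<cdot> unitL y) \<cdot> p1"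
    "p1 \<cdot> (cm x \<cdot> unitR x) = (cm y \<cdot> unitR y) \<cdot> p1"
    "p1 \<cdot> (cm x \<cdot> assocL x) = (cm y \<cdot> assocL y) \<cdot> ind3 x y p1"
      "p1 \<cdot> (cm x \<cdot> assocR x) = (cm y \<cdot> assocR y) \<cdot> ind3 x y p1"
    by (simp_all only: r t n Cmp_reassoc)
qed

lemma is_tcat_if_joint_monic:
  assumes f: "tfun a x f0 f1" and k: "tfun a c k0 k1" and a: "tprecat a" and x: "is_tcat C T x"
    and c: "is_tcat C T c"
    and jm: "\<And>h h'. h \<in> Arr C \<Longrightarrow> h' \<in> Arr C \<Longrightarrow> Dom C h' = Dom C h \<Longrightarrow> Cod C h = ob1 a \<Longrightarrow> Cod C h' =
      ob1 a \<Longrightarrow>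
      f1 \<cdot> h = f1 \<cdot> h' \<Longrightarrow> k1 \<cdot> h = k1 \<cdot> h' \<Longrightarrow> h = h'"
  shows "is_tcat C T a"
proof -
  note px = is_tcat_tprecat[OF x] and pc = is_tcat_tprecat[OF c]
  note tf = law_transport[OF f a px] and tk = law_transport[OF k a pc]
  note lx = x[unfolded is_tcat_iff] and lc = c[unfolded is_tcat_iff]
  note t = tmap_types[OF tfun_tmap[OF f]] tmap_types[OF tfun_tmap[OF k]] tstruct_simps[OF
    tfun_struct(1)[OF f]] law_chains[OF a]
    tgraph_simps
  show ?thesis
    unfolding is_tcat_iff
    by (intro conjI a; rule jm) (simp_all only: tf tk lx lc t Cmp_Arr Idn_Arr Idn_left Idn_right)
qed

text \<open>The unit laws equate arrows out of \<open>ob1 c\<close>, associativity equates arrows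
  out of the 3-chains; hence one epimorphism for each. An epimorphism on arrows need not induce one
  on chains, so \<open>e3\<close> is a separate premise.\<close>

lemma is_tcat_if_epi:
  assumes f: "tfun a c f0 f1" and c: "tprecat c" and a: "is_tcat C T a"
    and e1: "epi C f1" and e3: "epi C (ind3 a c f1)"
  shows "is_tcat C T c"
proof -
  note pa = is_tcat_tprecat[OF a] 
  note tf = law_transport[OF f pa c, symmetric]
  note la = a[unfolded is_tcat_iff] 
  note t = tmap_types[OF tfun_tmap[OF f]] tstruct_simps[OF tfun_struct(2)[OF f]] law_chains[OF c]
    tgraph_simps
  show ?thesis
    unfolding is_tcat_iff
    by (intro conjI c; (rule epiD[OF e1], simp_all only: tf la t Cmp_Arr Idn_Arr Idn_left
      Idn_right; fail)?,
        (rule epiD[OF e3], simp_all only: tf la t Cmp_Arr Idn_Arr Idn_left Idn_right; fail)?)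
qed

end

section \<open>The category of internal categories\<close>

context tcat_setting
begin

lemma is_tfunctor_iff:
  assumes "tprecat x" "tprecat y"
  shows "is_tfunctor C T x y (p0, p1) \<longleftrightarrow> tfun x y p0 p1"
  using tprecat_simps(1)[OF assms(1)] tprecat_simps(1)[OF assms(2)]
    tstruct_simps(1)[OF tprecat_simps(1)[OF assms(1)]] tstruct_simps(1)[OF tprecat_simps(1)[OF
      assms(2)]]
  by (simp add: is_tfunctor_def tfun_def tmap_def conj_ac)

lemma tfun_comp:
  assumes "tfun x y p0 p1" "tfun y z q0 q1"
  shows "tfun x z (q0 \<cdot> p0) (q1 \<cdot> p1)"
proof -
  note m = assms[THEN tfun_tmap]
  note [simp] = tmap_types[OF m(1)] tmap_types[OF m(2)] assms[THEN tfun_struct(1)] assms[THEN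
    tfun_struct(2)]
    tfun_left[OF assms(1)] tfun_left[OF assms(2)] tmap_comp[OF m]
  show ?thesis by (simp add: tfun_def)
qed

lemma tfun_id:
  assumes [simp]: "tstruct x"
  shows "tfun x x (Idn C (ob0 x)) (Idn C (ob1 x))"
  using tmap_id[of x] by (simp add: tfun_def)

lemma TCat_simps [simp]:
  "Obj (TCat C T) = {x. is_tcat C T x}"
  "Dom (TCat C T) (x, p, y) = x" "Cod (TCat C T) (x, p, y) = y"
  "Idn (TCat C T) x = (x, (Idn C (ob0 x), Idn C (ob1 x)), x)"
  "(y', (q0, q1), z) \<cdot>\<^bsub>TCat C T\<^esub> (x, (p0, p1), y) = (x, (q0 \<cdot> p0, q1 \<cdot> p1), z)"
  "(x, (p0, p1), y) \<in> Arr (TCat C T) \<longleftrightarrow> is_tcat C T x \<and> is_tcat C T y \<and> tfun x y p0 p1"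
  by (auto simp: TCat_def is_tfunctor_iff)

lemma TCat_ArrE:
  assumes "a \<in> Arr (TCat C T)"
  obtains x p0 p1 y where "a = (x, (p0, p1), y)" "is_tcat C T x" "is_tcat C T y" "tfun x y p0 p1"
proof -
  obtain x p0 p1 y where a: "a = (x, (p0, p1), y)" by (cases a) auto
  show thesis by (rule that[of x p0 p1 y]) (use assms a in auto)
qed

lemma TCat_category: "category (TCat C T)"
  unfolding TCat_def
proof (rule mk_cat_category, goal_cases)
  case (1 X)
  then show ?case by (simp add: is_tfunctor_iff tfun_id)
next
  case (2 X Y Z f g)
  then show ?case by (cases f; cases g) (auto simp: is_tfunctor_iff intro: tfun_comp)
next
  case (3 X Y f)
  then show ?case by (cases f) (auto simp: is_tfunctor_iff tmap_typing dest!: tfun_tmap)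
next
  case (4 W X Y Z f g h)
  then show ?case by (cases f; cases g; cases h) (auto simp: is_tfunctor_iff tmap_typing dest!:
    tfun_tmap)
qed

text \<open>The 2-chains are the limit of a cospan with feet \<open>ob1\<close> and
  \<open>T ob1\<close> and apex \<open>T ob0\<close>. The squares to be combined are therefore that
  of \<open>p1\<close> and the images under \<open>T\<close> of those of \<open>p1\<close> and
  \<open>p0\<close>.\<close>

lemma chains2_square_pullback:
  assumes m: "tmap x y p0 p1" "tmap c y g0 g1" "tmap a x f0 f1" "tmap a c k0 k1"
    and pb: "is_pullback C p0 g0 f0 k0" "is_pullback C p1 g1 f1 k1"
  shows "is_pullback C (ind2 x y p1) (ind2 c y g1) (ind2 a x f1) (ind2 a c k1)"
proof -
  note [simp] = tmap_types[OF m(1)] tmap_types[OF m(2)] tmap_types[OF m(3)] tmap_types[OF m(4)]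
    tmap_left[OF m(1)] tmap_left[OF m(2)] tmap_left[OF m(3)] tmap_left[OF m(4)]
  show ?thesis
    by (rule pullback_of_pullbacks[OF pb(2) T_pullback[OF pb(2)] T_pullback[OF pb(1)]
      chains2_pullback[of x] chains2_pullback[of y] chains2_pullback[of c] chains2_pullback[of
        a]]) simp_all
qed

text \<open>The same commutation of limits one level up: the feet are the 2-chains and their image
  under \<open>T\<close>, the apex is \<open>T ob1\<close>.\<close>

lemma chains3_square_pullback:
  assumes m: "tmap x y p0 p1" "tmap c y g0 g1" "tmap a x f0 f1" "tmap a c k0 k1"
    and pb: "is_pullback C p0 g0 f0 k0" "is_pullback C p1 g1 f1 k1"
  shows "is_pullback C (ind3 x y p1) (ind3 c y g1) (ind3 a x f1) (ind3 a c k1)"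
proof -
  note [simp] = tmap_types[OF m(1)] tmap_types[OF m(2)] tmap_types[OF m(3)] tmap_types[OF m(4)]
    tmap_left1[OF m(1)] tmap_left1[OF m(2)] tmap_left1[OF m(3)] tmap_left1[OF m(4)]
  note pb2 = chains2_square_pullback[OF m pb]
  show ?thesis
    by (rule pullback_of_pullbacks[OF pb2 T_pullback[OF pb2] T_pullback[OF pb(2)]
      chains3_pullback[of x] chains3_pullback[of y] chains3_pullback[of c] chains3_pullback[of
        a]]) simp_all
qed

lemma TCat_pullbackI:
  assumes tc: "is_tcat C T a" "is_tcat C T x" "is_tcat C T c" "is_tcat C T y"
    and p: "tfun x y p0 p1" and g: "tfun c y g0 g1" and f: "tfun a x f0 f1" and k: "tfun a c k0 k1"
    and pb0: "is_pullback C p0 g0 f0 k0" and pb1: "is_pullback C p1 g1 f1 k1"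
  shows "is_pullback (TCat C T) (x, (p0, p1), y) (c, (g0, g1), y) (a, (f0, f1), x) (a, (k0, k1), c)"
proof -
  interpret M: category "TCat C T" by (rule TCat_category)
  note mf = tfun_tmap[OF f] and mk = tfun_tmap[OF k]
  note [simp] = tc p g f k
  note [simp] = tmap_typing[OF tfun_tmap[OF p]] tmap_typing[OF tfun_tmap[OF g]] tmap_types[OF mf]
    tmap_types[OF mk]
  show ?thesis
  proof (rule M.pullbackI)
    show "(x, (p0, p1), y) \<cdot>\<^bsub>TCat C T\<^esub> (a, (f0, f1), x) = (c, (g0, g1), y) \<cdot>\<^bsub>TCat C T\<^esub> (a, (k0,
      k1), c)"
      using pullbackD(9)[OF pb0] pullbackD(9)[OF pb1] by simp
  next
    fix u v assume ua: "u \<in> Arr (TCat C T)" and va: "v \<in> Arr (TCat C T)"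
      and "Dom (TCat C T) v = Dom (TCat C T) u"
      and "Cod (TCat C T) u = Dom (TCat C T) (x, (p0, p1), y)"
        and "Cod (TCat C T) v = Dom (TCat C T) (c, (g0, g1), y)"
      and eq: "(x, (p0, p1), y) \<cdot>\<^bsub>TCat C T\<^esub> u = (c, (g0, g1), y) \<cdot>\<^bsub>TCat C T\<^esub> v"
    then obtain w u0 u1 v0 v1 where u: "u = (w, (u0, u1), x)" and v: "v = (w, (v0, v1), c)"
      and w[simp]: "is_tcat C T w" and uf: "tfun w x u0 u1" and vf: "tfun w c v0 v1"
      by (elim TCat_ArrE) auto
    note mu = tfun_tmap[OF uf] and mv = tfun_tmap[OF vf]
    note [simp] = tmap_types[OF mu] tmap_types[OF mv]
    have e: "p0 \<cdot> u0 = g0 \<cdot> v0" "p1 \<cdot> u1 = g1 \<cdot> v1" using eq by (simp_all add: u v)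
    obtain h0 where h0: "h0 \<in> Arr C" "Dom C h0 = ob0 w" "Cod C h0 = ob0 a" "f0 \<cdot> h0 = u0"
      "k0 \<cdot> h0 = v0"
      using pullback_lift[OF pb0 e(1)] by auto
    obtain h1 where h1: "h1 \<in> Arr C" "Dom C h1 = ob1 w" "Cod C h1 = ob1 a" "f1 \<cdot> h1 = u1"
      "k1 \<cdot> h1 = v1"
      using pullback_lift[OF pb1 e(2)] by auto
    note [simp] = h0 h1
    note hr = h0(4,5)[THEN Cmp_reduce] h0(4,5)[THEN TA_reduce] h0(4,5)[THEN TA_reduce, THEN
      Cmp_reduce]
      h1(4,5)[THEN Cmp_reduce]
    note [simp] = hr tmap_right[OF mu] tmap_right[OF mv] tmap_right[OF mf] tmap_right[OF mk]
      tfun_right[OF uf] tfun_right[OF vf] tfun_right[OF f] tfun_right[OF k]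
    \<comment> \<open>Equations into \<open>ob0 a\<close> are checked after \<open>f0\<close> and
      \<open>k0\<close>, those into \<open>TO (ob0 a)\<close> after \<open>TA f0\<close> and
      \<open>TA k0\<close>, which are jointly monic because \<open>T\<close> preserves the
      pullback.\<close>
    have hm: "tmap w a h0 h1"
      unfolding tmap_def
    proof (intro conjI)
      show "d0 a \<cdot> h1 = h0 \<cdot> d0 w" by (rule pullback_eqI[OF pb0]) simp_all
      show "d1 a \<cdot> h1 = TA h0 \<cdot> d1 w" by (rule pullback_eqI[OF T_pullback[OF pb0]]) simp_all
    qed (simp_all add: in_hom_iff)
    note [simp] = tmap_types[OF hm]
    have [simp]: "ind2 a x f1 \<cdot> ind2 w a h1 = ind2 w x u1" "ind2 a c k1 \<cdot> ind2 w a h1 = ind2 w c v1"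
      using tmap_comp(2)[OF hm mf] tmap_comp(2)[OF hm mk] by simp_all
    have "tfun w a h0 h1"
      unfolding tfun_def
    proof (intro conjI hm)
      show "h1 \<cdot> s0 w = s0 a \<cdot> h0" by (rule pullback_eqI[OF pb1]) simp_all
      show "h1 \<cdot> cm w = cm a \<cdot> ind2 w a h1" by (rule pullback_eqI[OF pb1]) simp_all
    qed simp_all
    then show "\<exists>h. h \<in> Arr (TCat C T) \<and> Dom (TCat C T) h = Dom (TCat C T) u \<and>
       Cod (TCat C T) h = Dom (TCat C T) (a, (f0, f1), x) \<and> (a, (f0, f1), x) \<cdot>\<^bsub>TCat C T\<^esub> h = u \<and>
       (a, (k0, k1), c) \<cdot>\<^bsub>TCat C T\<^esub> h = v"
      by (intro exI[of _ "(w, (h0, h1), a)"]) (simp add: u v)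
  next
    fix h j assume "h \<in> Arr (TCat C T)" "j \<in> Arr (TCat C T)" "Dom (TCat C T) j = Dom (TCat C T) h"
       "Cod (TCat C T) h = Dom (TCat C T) (a, (f0, f1), x)"
         "Cod (TCat C T) j = Dom (TCat C T) (a, (f0, f1), x)"
       and e: "(a, (f0, f1), x) \<cdot>\<^bsub>TCat C T\<^esub> h = (a, (f0, f1), x) \<cdot>\<^bsub>TCat C T\<^esub> j"
        "(a, (k0, k1), c) \<cdot>\<^bsub>TCat C T\<^esub> h = (a, (k0, k1), c) \<cdot>\<^bsub>TCat C T\<^esub> j"
    then obtain w h0 h1 j0 j1 where h: "h = (w, (h0, h1), a)" and j: "j = (w, (j0, j1), a)"
      and uf: "tfun w a h0 h1" and vf: "tfun w a j0 j1"
      by (elim TCat_ArrE) auto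
    note [simp] = tmap_typing[OF tfun_tmap[OF uf]] tmap_typing[OF tfun_tmap[OF vf]]
    have "h0 = j0" by (rule pullback_eqI[OF pb0]) (use e in \<open>simp_all add: h j\<close>)
    moreover have "h1 = j1" by (rule pullback_eqI[OF pb1]) (use e in \<open>simp_all add: h j\<close>)
    ultimately show "h = j" by (simp add: h j)
  qed simp_all
qed

text \<open>The 2-chains see only the graph. A composition, whose source is the object of 2-chains,
  can therefore be added to the record afterwards without changing that source.\<close>

lemma cm_update_simps [simp]:
  "\<pi>0 (x\<lparr>cm := k\<rparr>) = \<pi>0 x" "\<pi>2 (x\<lparr>cm := k\<rparr>) = \<pi>2 x" "chains2 C T (x\<lparr>cm := k\<rparr>) = chains2 C T x"
  "tgraph (x\<lparr>cm := k\<rparr>) = tgraph x" "ind2 (x\<lparr>cm := k\<rparr>) y p = ind2 x y p"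
    "ind2 y (x\<lparr>cm := k\<rparr>) p = ind2 y x p"
  by (cases x; simp only: tcat.update_convs tcat.select_convs pi0_def pi2_def chains2_def tgraph_def
    induced2_def pair2_def)+

lemma tmap_cm_update [simp]:
  "tmap (x\<lparr>cm := k\<rparr>) y p0 p1 = tmap x y p0 p1" "tmap y (x\<lparr>cm := k\<rparr>) p0 p1 = tmap y x p0 p1"
  unfolding tmap_def cm_update_simps by (cases x; simp only: tcat.update_convs tcat.select_convs)+

lemma tgraphI:
  assumes "ob0 x \<in> Obj C" "ob1 x \<in> Obj C" "d1 x \<in> Arr C" "Dom C (d1 x) = ob1 x"
    "Cod C (d1 x) = TO (ob0 x)"
    "d0 x \<in> Arr C" "Dom C (d0 x) = ob1 x" "Cod C (d0 x) = ob0 x"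
  shows "tgraph x"
  unfolding tgraph_def in_hom_iff using assms by blast

lemma tprecat_if_joint_monic:
  assumes f: "tfun b x f0 f1" and k: "tfun b c k0 k1" and [simp]: "tprecat x" "tprecat c"
    and pb0: "is_pullback C p0 g0 f0 k0" and pb1: "is_pullback C p1 g1 f1 k1"
  shows "tprecat b"
proof -
  note mf = tfun_tmap[OF f] and mk = tfun_tmap[OF k]
  note sb = tfun_struct(1)[OF f]
  note [simp] = sb tmap_types[OF mf] tmap_types[OF mk] tmap_right[OF mf] tmap_right[OF mk]
    tfun_right[OF f] tfun_right[OF k] nat_right
  show ?thesis
    unfolding tprecat_def
  proof (intro conjI sb)
    show "d0 b \<cdot> s0 b = Idn C (ob0 b)" by (rule pullback_eqI[OF pb0]) simp_all
    show "d1 b \<cdot> s0 b = unit T (ob0 b)" by (rule pullback_eqI[OF T_pullback[OF pb0]]) simp_all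
    show "d0 b \<cdot> cm b = d0 b \<cdot> \<pi>0 b" by (rule pullback_eqI[OF pb0]) simp_all
    show "d1 b \<cdot> cm b = mult T (ob0 b) \<cdot> (TA (d1 b) \<cdot> \<pi>2 b)"
      by (rule pullback_eqI[OF T_pullback[OF pb0]]) simp_all
  qed
qed

lemma TCat_pullback_exists:
  assumes tc[simp]: "is_tcat C T x" "is_tcat C T c" "is_tcat C T y"
    and p: "tfun x y p0 p1" and g: "tfun c y g0 g1"
  obtains a f0 f1 k0 k1 where "is_tcat C T a" "tfun a x f0 f1" "tfun a c k0 k1"
    "is_pullback C p0 g0 f0 k0" "is_pullback C p1 g1 f1 k1"
proof -
  note mp = tfun_tmap[OF p] and mg = tfun_tmap[OF g]
  note [simp] = tmap_types[OF mp] tmap_types[OF mg]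
  define f0 k0 f1 k1 where "f0 = pr1 C p0 g0" and "k0 = pr2 C p0 g0" and "f1 = pr1 C p1 g1"
    and "k1 = pr2 C p1 g1"
  have pb0: "is_pullback C p0 g0 f0 k0" and pb1: "is_pullback C p1 g1 f1 k1"
    unfolding f0_def k0_def f1_def k1_def by (auto intro: pr_pullback)
  note [simp] = pullbackD(3,4,6)[OF pb0] pullbackD(3,4,6)[OF pb1]
  have [simp]: "Cod C f0 = ob0 x" "Cod C k0 = ob0 c" "Cod C f1 = ob1 x" "Cod C k1 = ob1 c"
    using pullbackD(7,8)[OF pb0] pullbackD(7,8)[OF pb1] by simp_all
  note com = pullbackD(9)[OF pb0] pullbackD(9)[OF pb1]
  note comr[simp] = com com[THEN Cmp_reduce] com[THEN TA_reduce] com[THEN TA_reduce, THEN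
    Cmp_reduce]
  note L = tmap_left[OF mp] tmap_left[OF mg] tfun_left[OF p] tfun_left[OF g]
  have "p0 \<cdot> (d0 x \<cdot> f1) = g0 \<cdot> (d0 c \<cdot> k1)"
    using arg_cong[OF com(2), of "\<lambda>z. d0 y \<cdot> z"] by (simp add: L del: comr)
  from pullback_lift[OF pb0 this] obtain e0 where
    e0: "e0 \<in> Arr C" "Dom C e0 = Dom C f1" "Cod C e0 = Dom C f0" "f0 \<cdot> e0 = d0 x \<cdot> f1"
      "k0 \<cdot> e0 = d0 c \<cdot> k1" by auto
  have "TA p0 \<cdot> (d1 x \<cdot> f1) = TA g0 \<cdot> (d1 c \<cdot> k1)"
    using arg_cong[OF com(2), of "\<lambda>z. d1 y \<cdot> z"] by (simp add: L del: comr)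
  from pullback_lift[OF T_pullback[OF pb0] this] obtain e1 where
    e1: "e1 \<in> Arr C" "Dom C e1 = Dom C f1" "Cod C e1 = TO (Dom C f0)" "TA f0 \<cdot> e1 = d1 x \<cdot> f1"
      "TA k0 \<cdot> e1 = d1 c \<cdot> k1" by auto
  have "p1 \<cdot> (s0 x \<cdot> f0) = g1 \<cdot> (s0 c \<cdot> k0)"
    using arg_cong[OF com(1), of "\<lambda>z. s0 y \<cdot> z"] by (simp add: L del: comr)
  from pullback_lift[OF pb1 this] obtain sa where
    sa: "sa \<in> Arr C" "Dom C sa = Dom C f0" "Cod C sa = Dom C f1" "f1 \<cdot> sa = s0 x \<cdot> f0"
      "k1 \<cdot> sa = s0 c \<cdot> k0" by auto
  \<comment> \<open>\<open>undefined\<close> is a placeholder: the composition starts at the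
    2-chains of this very graph, so it is filled in only later, in \<open>b\<close>.\<close>
  define a where "a = \<lparr>ob0 = Dom C f0, ob1 = Dom C f1, d1 = e1, d0 = e0, s0 = sa, cm = undefined\<rparr>"
  have "tgraph a" by (rule tgraphI) (use e0 e1 in \<open>simp_all add: a_def\<close>)
  then have mf: "tmap a x f0 f1" and mk: "tmap a c k0 k1"
    using e0 e1 by (simp_all add: tmap_def in_hom_iff a_def)
  have [simp]: "s0 a = sa" by (simp add: a_def)
  note [simp] = tmap_types[OF mf] tmap_types[OF mk]
  have com2: "ind2 x y p1 \<cdot> ind2 a x f1 = ind2 c y g1 \<cdot> ind2 a c k1"
    using tmap_comp(2)[OF mf mp] tmap_comp(2)[OF mk mg] by simp
  have "p1 \<cdot> (cm x \<cdot> ind2 a x f1) = g1 \<cdot> (cm c \<cdot> ind2 a c k1)"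
    using arg_cong[OF com2, of "\<lambda>z. cm y \<cdot> z"] by (simp add: L del: comr)
  from pullback_lift[OF pb1 this] obtain ca where
    ca: "ca \<in> Arr C" "Dom C ca = chains2 C T a" "Cod C ca = ob1 a"
      "f1 \<cdot> ca = cm x \<cdot> ind2 a x f1" "k1 \<cdot> ca = cm c \<cdot> ind2 a c k1" by auto
  define b where "b = a\<lparr>cm := ca\<rparr>"
  have b[simp]: "ob0 b = ob0 a" "ob1 b = ob1 a" "s0 b = sa" "cm b = ca"
    "chains2 C T b = chains2 C T a"
    "tgraph b" by (simp_all add: b_def)
  have sb: "tstruct b" unfolding tstruct_def in_hom_iff using sa ca by simp
  have mb: "tmap b x f0 f1" "tmap b c k0 k1" using mf mk by (simp_all add: b_def)
  have ib: "ind2 b x f1 = ind2 a x f1" "ind2 b c k1 = ind2 a c k1" by (simp_all add: b_def)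
  have f: "tfun b x f0 f1" and k: "tfun b c k0 k1"
    using sb mb sa ca by (simp_all add: tfun_def ib)
  have pb: "tprecat b"
    by (rule tprecat_if_joint_monic[OF f k _ _ pb0 pb1]) simp_all
  have "is_tcat C T b"
    by (rule is_tcat_if_joint_monic[OF f k pb tc(1,2)]) (rule pullback_eqI[OF pb1]; simp)
  then show thesis using that f k pb0 pb1 by blast
qed

lemma TCat_has_pullbacks: "has_pullbacks (TCat C T)"
  unfolding has_pullbacks_def
proof (intro ballI impI)
  fix p g assume "p \<in> Arr (TCat C T)" "g \<in> Arr (TCat C T)" "Cod (TCat C T) p = Cod (TCat C T) g"
  then obtain x y c p0 p1 g0 g1 where pg: "p = (x, (p0, p1), y)" "g = (c, (g0, g1), y)"
    and t: "is_tcat C T x" "is_tcat C T c" "is_tcat C T y" and f: "tfun x y p0 p1" "tfun c y g0 g1"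
    by (elim TCat_ArrE) auto
  obtain a f0 f1 k0 k1 where "is_tcat C T a" "tfun a x f0 f1" "tfun a c k0 k1"
    "is_pullback C p0 g0 f0 k0" "is_pullback C p1 g1 f1 k1" using TCat_pullback_exists[OF t f]
      by blast
  then show "\<exists>f k. is_pullback (TCat C T) p g f k"
    unfolding pg using TCat_pullbackI t f by blast
qed

text \<open>A pullback of \<open>T\<close>-categories, however chosen, is isomorphic to the
  componentwise one, and an isomorphism of \<open>T\<close>-categories is invertible on components;
  so the component squares are pullbacks as well.\<close>

lemma TCat_pullbackD:
  assumes pb: "is_pullback (TCat C T) (x, (p0, p1), y) (c, (g0, g1), y') (a, (f0, f1), x') (a',
    (k0, k1), c')"
  shows "is_pullback C p0 g0 f0 k0" "is_pullback C p1 g1 f1 k1"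
    "x' = x" "y' = y" "c' = c" "a' = a" "is_tcat C T a" "is_tcat C T x" "is_tcat C T c"
      "is_tcat C T y"
    "tfun x y p0 p1" "tfun c y g0 g1" "tfun a x f0 f1" "tfun a c k0 k1"
proof -
  interpret M: category "TCat C T" by (rule TCat_category)
  show eq: "x' = x" "y' = y" "c' = c" "a' = a" and t: "is_tcat C T a" "is_tcat C T x"
    "is_tcat C T c" "is_tcat C T y"
    and f: "tfun x y p0 p1" "tfun c y g0 g1" "tfun a x f0 f1" "tfun a c k0 k1"
      using pullbackD[OF pb] by auto
  obtain b f0' f1' k0' k1' where b: "is_tcat C T b" "tfun b x f0' f1'" "tfun b c k0' k1'" and
    pbs: "is_pullback C p0 g0 f0' k0'" "is_pullback C p1 g1 f1' k1'"
    using TCat_pullback_exists[OF t(2,3,4) f(1,2)] by blast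
  have pb': "is_pullback (TCat C T) (x, (p0, p1), y) (c, (g0, g1), y) (b, (f0', f1'), x) (b, (k0',
    k1'), c)"
    by (rule TCat_pullbackI[OF b(1) t(2-4) f(1,2) b(2,3) pbs])
  obtain k l where kl: "k \<in> Arr (TCat C T)" "l \<in> Arr (TCat C T)" "Dom (TCat C T) k = a"
    "Cod (TCat C T) k = b"
    "Dom (TCat C T) l = b" "Cod (TCat C T) l = a" "k \<cdot>\<^bsub>TCat C T\<^esub> l = Idn (TCat C T) b"
      "l \<cdot>\<^bsub>TCat C T\<^esub> k = Idn (TCat C T) a"
    "(b, (f0', f1'), x) \<cdot>\<^bsub>TCat C T\<^esub> k = (a, (f0, f1), x)"
      "(b, (k0', k1'), c) \<cdot>\<^bsub>TCat C T\<^esub> k = (a, (k0, k1), c)"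
    by (rule M.pullback_unique_iso[OF pb' pb[unfolded eq]]) simp_all
  obtain m0 m1 where k: "k = (a, (m0, m1), b)" and m: "tfun a b m0 m1" using kl(1,3,4)
    by (elim TCat_ArrE) auto
  obtain l0 l1 where l: "l = (b, (l0, l1), a)" and n: "tfun b a l0 l1" using kl(2,5,6)
    by (elim TCat_ArrE) auto
  note [simp] = tmap_typing[OF tfun_tmap[OF m]] tmap_typing[OF tfun_tmap[OF n]] tmap_typing[OF
    tfun_tmap[OF b(2)]]
    tmap_typing[OF tfun_tmap[OF b(3)]]
  have e: "f0' \<cdot> m0 = f0" "f1' \<cdot> m1 = f1" "k0' \<cdot> m0 = k0" "k1' \<cdot> m1 = k1"
    "m0 \<cdot> l0 = Idn C (ob0 b)" "l0 \<cdot> m0 = Idn C (ob0 a)"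
    "m1 \<cdot> l1 = Idn C (ob1 b)" "l1 \<cdot> m1 = Idn C (ob1 a)" using kl(7-10) by (simp_all add: k l)
  show "is_pullback C p0 g0 f0 k0" using pullback_iso[OF pbs(1), of m0 l0] e by simp
  show "is_pullback C p1 g1 f1 k1" using pullback_iso[OF pbs(2), of m1 l1] e by simp
qed

end

section \<open>Descent of internal categories\<close>

context category
begin

text \<open>Reduces the test on all identified pairs to one universal pair. Among
  \<open>T\<close>-categories this is the accessible one: its legs are components of functors,
  whereas an arbitrary arrow of \<open>C\<close> need not be.\<close>

lemma regular_epi_factor_kernel_pair:
  assumes rep: "regular_epi C k" and pb: "is_pullback C k k l r"
    and u: "u \<in> Arr C" "Dom C u = Dom C k" "u \<cdot> l = u \<cdot> r"
  obtains v where "v \<in> Arr C" "Dom C v = Cod C k" "Cod C v = Cod C u" "v \<cdot> k = u"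
proof -
  note [simp] = u(1,2) pullbackD(1,3-4,6-8)[OF pb]
  have "\<exists>v\<in>Arr C. Dom C v = Cod C k \<and> v \<cdot> k = u"
  proof (rule rep[unfolded regular_epi_def, THEN conjunct2, rule_format])
    fix s t assume [simp]: "s \<in> Arr C" "t \<in> Arr C" "Dom C t = Dom C s" "Cod C s = Dom C k"
      "Cod C t = Dom C k"
      and e: "k \<cdot> s = k \<cdot> t"
    obtain h where h: "h \<in> Arr C" "Dom C h = Dom C s" "Cod C h = Dom C l" "l \<cdot> h = s" "r \<cdot> h = t"
      using pullback_lift[OF pb e] by auto
    have "u \<cdot> (l \<cdot> h) = u \<cdot> (r \<cdot> h)" using Cmp_reduce[OF u(3), of h] h(1-3) by simp
    then show "u \<cdot> s = u \<cdot> t" by (simp add: h)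
  qed simp_all
  then obtain v where v: "v \<in> Arr C" "Dom C v = Cod C k" "v \<cdot> k = u" by blast
  have "Cod C v = Cod C u" using arg_cong[OF v(3), of "Cod C"] v(1,2) by simp
  with v show thesis using that by blast
qed

text \<open>When \<open>k\<close> is a pullback of \<open>q\<close>, the pullback of
  \<open>q\<close> and \<open>q \<cdot> f\<close> serves as its kernel pair: elements
  \<open>s\<close>, \<open>t\<close> with the same image under \<open>k\<close> are
  \<open>\<xi> \<cdot> h\<close> and \<open>P2 \<cdot> h\<close> for the lift \<open>h\<close> of
  \<open>(f \<cdot> s, t)\<close>. Invariance under \<open>\<xi>\<close> is thus constancy on the
  fibres of \<open>k\<close>.\<close>

lemma regular_epi_factor_action:
  assumes rep: "regular_epi C k" and pb: "is_pullback C q g f k"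
    and pb2: "is_pullback C q (q \<cdot> f) P1 P2"
    and \<xi>: "\<xi> \<in> Arr C" "Dom C \<xi> = Dom C P1" "Cod C \<xi> = Dom C f" "f \<cdot> \<xi> = P1" "k \<cdot> \<xi> = k \<cdot> P2"
    and u: "u \<in> Arr C" "Dom C u = Dom C f" "u \<cdot> \<xi> = u \<cdot> P2"
  obtains v where "v \<in> Arr C" "Dom C v = Cod C k" "Cod C v = Cod C u" "v \<cdot> k = u"
proof -
  note [simp] = u(1,2) pullbackD(1-8)[OF pb] pullbackD(1,3-4,6-7)[OF pb2] \<xi>(1-3)
  have [simp]: "Cod C P2 = Dom C f" using pullbackD(8)[OF pb2] by simp
  have "\<exists>v\<in>Arr C. Dom C v = Cod C k \<and> v \<cdot> k = u"
  proof (rule rep[unfolded regular_epi_def, THEN conjunct2, rule_format])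
    fix s t assume [simp]: "s \<in> Arr C" "t \<in> Arr C" "Dom C t = Dom C s" "Cod C s = Dom C k"
      "Cod C t = Dom C k"
      and e: "k \<cdot> s = k \<cdot> t"
    have "q \<cdot> (f \<cdot> s) = (q \<cdot> f) \<cdot> t"
      using arg_cong[OF e, of "\<lambda>z. g \<cdot> z"] pullbackD(9)[OF pb, THEN Cmp_reduce] pullbackD(9)[OF
        pb, THEN Cmp_reduce, symmetric]
      by simp
    from pullback_lift[OF pb2 this] obtain h where h: "h \<in> Arr C" "Dom C h = Dom C s"
      "Cod C h = Dom C P1"
      "P1 \<cdot> h = f \<cdot> s" "P2 \<cdot> h = t" by auto
    note [simp] = h \<xi>(4,5)[THEN Cmp_reduce]
    have "\<xi> \<cdot> h = s" by (rule pullback_eqI[OF pb]) (simp_all add: e)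
    then show "u \<cdot> s = u \<cdot> t" using Cmp_reduce[OF u(3), of h] by simp
  qed simp_all
  then obtain v where v: "v \<in> Arr C" "Dom C v = Cod C k" "v \<cdot> k = u" by blast
  have "Cod C v = Cod C u" using arg_cong[OF v(3), of "Cod C"] v(1,2) by simp
  with v show thesis using that by blast
qed

end

section \<open>Structure on the target of an epimorphic functor\<close>

context tcat_setting
begin

text \<open>The source of an axiom decides where it is tested: the axioms for \<open>s0\<close> on
  objects, those for \<open>cm\<close> on 2-chains.\<close>

lemma tprecat_if_epi:
  assumes f: "tfun a c f0 f1" and [simp]: "is_tcat C T a"
    and e: "epi C f0" "epi C f1" "epi C (ind2 a c f1)"
  shows "tprecat c"
proof -
  note mf = tfun_tmap[OF f] and sc = tfun_struct(2)[OF f]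
  note [simp] = sc tmap_types[OF mf] tmap_left[OF mf] tfun_left[OF f] nat_left
  show ?thesis
    unfolding tprecat_def
  proof (intro conjI sc)
    show "d0 c \<cdot> s0 c = Idn C (ob0 c)" by (rule epiD[OF e(1)]) simp_all
    show "d1 c \<cdot> s0 c = unit T (ob0 c)" by (rule epiD[OF e(1)]) simp_all
    show "d0 c \<cdot> cm c = d0 c \<cdot> \<pi>0 c" by (rule epiD[OF e(3)]) simp_all
    show "d1 c \<cdot> cm c = mult T (ob0 c) \<cdot> (TA (d1 c) \<cdot> \<pi>2 c)" by (rule epiD[OF e(3)]) simp_all
  qed
qed

lemma tfun_if_epi:
  assumes k: "tfun a c k0 k1" and h: "tfun a z (g0 \<cdot> k0) (g1 \<cdot> k1)" and g: "tmap c z g0 g1"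
    and e: "epi C k0" "epi C (ind2 a c k1)"
  shows "tfun c z g0 g1"
proof -
  note mk = tfun_tmap[OF k]
  note [simp] = tfun_struct(2)[OF k] tfun_struct(2)[OF h] tfun_struct(1)[OF k] tmap_types[OF mk]
    tmap_types[OF g] tfun_left[OF k]
  show ?thesis
    unfolding tfun_def
  proof (intro conjI g)
    show "g1 \<cdot> s0 c = s0 z \<cdot> g0" by (rule epiD[OF e(1)]) (use tfun_left(1)[OF h] in simp_all)
    show "g1 \<cdot> cm c = cm z \<cdot> ind2 c z g1"
      by (rule epiD[OF e(2)]) (use tfun_left(2)[OF h] tmap_comp(2)[OF mk g] in simp_all)
  qed simp_all
qed

lemma TCat_pullbackE:
  assumes pb: "is_pullback (TCat C T) (x, (p0, p1), y) g f k"
  obtains c g0 g1 a f0 f1 k0 k1 where "g = (c, (g0, g1), y)" "f = (a, (f0, f1), x)"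
    "k = (a, (k0, k1), c)"
    "is_pullback C p0 g0 f0 k0" "is_pullback C p1 g1 f1 k1"
    "is_tcat C T a" "is_tcat C T x" "is_tcat C T c" "is_tcat C T y"
    "tfun x y p0 p1" "tfun c y g0 g1" "tfun a x f0 f1" "tfun a c k0 k1"
proof -
  obtain c g0 g1 y' a f0 f1 x' a' k0 k1 c' where eq: "g = (c, (g0, g1), y')"
    "f = (a, (f0, f1), x')" "k = (a', (k0, k1), c')"
    by (metis prod.exhaust)
  show thesis using that TCat_pullbackD[OF pb[unfolded eq]] eq by blast
qed

lemma TCat_pb_category: "pb_category (TCat C T)"
  by (intro pb_category.intro TCat_category pb_category_axioms.intro TCat_has_pullbacks)

lemma TCat_stably_epi:
  assumes "stably epi C p0" "stably epi C p1"
  shows "stably epi (TCat C T) (x, (p0, p1), y)"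
  unfolding stably_def
proof (intro allI impI)
  fix g f k assume "is_pullback (TCat C T) (x, (p0, p1), y) g f k"
  then obtain a k0 k1 c g0 g1 f0 f1 where k: "k = (a, (k0, k1), c)" and t[simp]: "is_tcat C T a"
    "is_tcat C T c" "tfun a c k0 k1"
    and pb: "is_pullback C p0 g0 f0 k0" "is_pullback C p1 g1 f1 k1" by (elim TCat_pullbackE) blast
  have e: "epi C k0" "epi C k1" using assms pb by (auto simp: stably_def)
  note [simp] = tmap_typing[OF tfun_tmap[OF t(3)]]
  show "epi (TCat C T) k"
    unfolding epi_def
  proof (intro conjI allI impI)
    fix u v assume "u \<in> Arr (TCat C T)" "v \<in> Arr (TCat C T)" "Dom (TCat C T) u = Cod (TCat C T) k"
      "Dom (TCat C T) v = Cod (TCat C T) k" and uv: "u \<cdot>\<^bsub>TCat C T\<^esub> k = v \<cdot>\<^bsub>TCat C T\<^esub> k"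
    then obtain z u0 u1 z' v0 v1 where u: "u = (c, (u0, u1), z)" "v = (c, (v0, v1), z')"
      and uf: "tfun c z u0 u1" "tfun c z' v0 v1" by (elim TCat_ArrE) (auto simp: k)
    note [simp] = tmap_typing[OF tfun_tmap[OF uf(1)]] tmap_typing[OF tfun_tmap[OF uf(2)]]
    have "u0 = v0" by (rule epiD[OF e(1)]) (use uv in \<open>simp_all add: k u\<close>)
    moreover have "u1 = v1" by (rule epiD[OF e(2)]) (use uv in \<open>simp_all add: k u\<close>)
    ultimately show "u = v" using uv by (simp add: k u)
  qed (simp add: k)
qed

text \<open>Regularity on objects and arrows yields the components of the factorization. That they
  form a functor is a matter of equations, for which epimorphisms suffice; for composition the
  epimorphism is the one on 2-chains.\<close>

lemma TCat_stably_regular_epi: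
  assumes r: "stably regular_epi C p0" "stably regular_epi C p1"
    and e: "stably epi C p0" "stably epi C p1" "stably epi C (ind2 x y p1)"
  shows "stably regular_epi (TCat C T) (x, (p0, p1), y)"
  unfolding stably_def
proof (intro allI impI)
  interpret M: pb_category "TCat C T" by (rule TCat_pb_category)
  fix g f k assume "is_pullback (TCat C T) (x, (p0, p1), y) g f k"
  then obtain a k0 k1 c g0 g1 f0 f1 where k: "k = (a, (k0, k1), c)" and t[simp]: "is_tcat C T a"
    "is_tcat C T c" "tfun a c k0 k1"
    and pb: "is_pullback C p0 g0 f0 k0" "is_pullback C p1 g1 f1 k1" 
    and fg: "tfun x y p0 p1" "tfun c y g0 g1" "tfun a x f0 f1" by (elim TCat_pullbackE) blast
  note km = tfun_tmap[OF t(3)]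
  have pb2: "is_pullback C (ind2 x y p1) (ind2 c y g1) (ind2 a x f1) (ind2 a c k1)"
    by (rule chains2_square_pullback[OF fg(1-3)[THEN tfun_tmap] km pb])
  have ek: "epi C k0" "epi C k1" "epi C (ind2 a c k1)" and rk: "regular_epi C k0" "regular_epi C k1"
    using r e pb pb2 by (auto simp: stably_def)
  note [simp] = tmap_types[OF km] tmap_left[OF km] tfun_left[OF t(3)]
  show "regular_epi (TCat C T) k"
    unfolding regular_epi_def
  proof (intro conjI ballI impI)
    fix u assume ua: "u \<in> Arr (TCat C T)" "Dom (TCat C T) u = Dom (TCat C T) k"
      and inv: "\<forall>s\<in>Arr (TCat C T). \<forall>t\<in>Arr (TCat C T). Dom (TCat C T) t = Dom (TCat C T) s \<longrightarrow>
        Cod (TCat C T) s = Dom (TCat C T) k \<longrightarrow> Cod (TCat C T) t = Dom (TCat C T) k \<longrightarrow>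
        k \<cdot>\<^bsub>TCat C T\<^esub> s = k \<cdot>\<^bsub>TCat C T\<^esub> t \<longrightarrow> u \<cdot>\<^bsub>TCat C T\<^esub> s = u \<cdot>\<^bsub>TCat C T\<^esub> t"
    then obtain z u0 u1 where u: "u = (a, (u0, u1), z)" and z[simp]: "is_tcat C T z"
      and uf: "tfun a z u0 u1"
      by (elim TCat_ArrE) (auto simp: k)
    note um = tfun_tmap[OF uf]
    note [simp] = tmap_types[OF um] tmap_left[OF um] tfun_left[OF uf]
    \<comment> \<open>The hypothesis \<open>inv\<close> speaks of pairs of functors only. It is
      applied to the kernel pair of \<open>k\<close> among \<open>T\<close>-categories, whose
      components are kernel pairs of \<open>k0\<close> and \<open>k1\<close>.\<close>
    have "is_pullback (TCat C T) (a, (k0, k1), c) (a, (k0, k1),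
      c) (pr1 (TCat C T) k k) (pr2 (TCat C T) k k)"
      using M.pr_pullback[of k k] by (simp add: k)
    then obtain w l0 l1 r0 r1 where lr: "pr1 (TCat C T) k k = (w, (l0, l1), a)"
      "pr2 (TCat C T) k k = (w, (r0, r1), a)"
      and kp: "is_pullback C k0 k0 l0 r0" "is_pullback C k1 k1 l1 r1" by (elim TCat_pullbackE) auto
    have "u \<cdot>\<^bsub>TCat C T\<^esub> pr1 (TCat C T) k k = u \<cdot>\<^bsub>TCat C T\<^esub> pr2 (TCat C T) k k"
      by (rule inv[rule_format]) (use M.pr_commute[of k k] in \<open>simp_all add: k\<close>)
    then have uk: "u0 \<cdot> l0 = u0 \<cdot> r0" "u1 \<cdot> l1 = u1 \<cdot> r1" by (simp_all add: u lr)
    obtain v0 where v0: "v0 \<in> Arr C" "Dom C v0 = ob0 c" "Cod C v0 = ob0 z" "v0 \<cdot> k0 = u0"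
      using regular_epi_factor_kernel_pair[OF rk(1) kp(1) _ _ uk(1)] by auto
    obtain v1 where v1: "v1 \<in> Arr C" "Dom C v1 = ob1 c" "Cod C v1 = ob1 z" "v1 \<cdot> k1 = u1"
      using regular_epi_factor_kernel_pair[OF rk(2) kp(2) _ _ uk(2)] by auto
    note [simp] = v0 v1 v0(4)[THEN Cmp_reduce] v1(4)[THEN Cmp_reduce] v0(4)[THEN TA_reduce, THEN
      Cmp_reduce]
    have vm: "tmap c z v0 v1"
      unfolding tmap_def
    proof (intro conjI)
      show "d0 z \<cdot> v1 = v0 \<cdot> d0 c" by (rule epiD[OF ek(2)]) simp_all
      show "d1 z \<cdot> v1 = TA v0 \<cdot> d1 c" by (rule epiD[OF ek(2)]) simp_all
    qed (simp_all add: in_hom_iff)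
    have "tfun c z v0 v1"
      by (rule tfun_if_epi[OF t(3) _ vm ek(1,3)]) (simp add: uf)
    then show "\<exists>v\<in>Arr (TCat C T). Dom (TCat C T) v = Cod (TCat C T) k \<and> v \<cdot>\<^bsub>TCat C T\<^esub> k = u"
      by (intro bexI[of _ "(c, (v0, v1), z)"]) (simp_all add: k u)
  qed (simp add: k)
qed

lemma TCat_data_descend:
  assumes xy[simp]: "is_tcat C T x" "is_tcat C T y" and p: "tfun x y p0 p1"
    and ac: "actions_descend C p0" "actions_descend C p1"
    and r: "stably regular_epi C p0" "stably regular_epi C p1" "stably regular_epi C (ind2 x y p1)"
    and e: "stably epi C p0" "stably epi C p1" "stably epi C (ind2 x y p1)"
      "stably epi C (ind3 x y p1)"
    and dat: "descent_datum (TCat C T) (x, (p0, p1), y) F X"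
  shows "\<exists>G K. is_pullback (TCat C T) (x, (p0, p1), y) G F K \<and>
    K \<cdot>\<^bsub>TCat C T\<^esub> X = K \<cdot>\<^bsub>TCat C T\<^esub> pr2 (TCat C T) (x, (p0, p1), y) ((x, (p0, p1), y) \<cdot>\<^bsub>TCat C T\<^esub>
      F)"
proof -
  let ?p = "(x, (p0, p1), y)"
  note [simp] = p
  interpret M: pb_arrow "TCat C T" ?p
    by (rule pb_arrow.intro[OF TCat_pb_category pb_arrow_axioms.intro]) (simp add: p)
  note pm = tfun_tmap[OF p]
  have "F \<in> Arr (TCat C T)" "Cod (TCat C T) F = x" using dat by (simp_all add: descent_datum_def)
  then obtain a f0 f1 where F: "F = (a, (f0, f1), x)" and a[simp]: "is_tcat C T a"
    and f: "tfun a x f0 f1"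
    by (elim TCat_ArrE) auto
  note fm = tfun_tmap[OF f]
  note [simp] = tmap_types[OF fm] tmap_types[OF pm]
  define pf where "pf = (a, (p0 \<cdot> f0, p1 \<cdot> f1), y)"
  have pf: "?p \<cdot>\<^bsub>TCat C T\<^esub> F = pf" by (simp add: F pf_def)
  have [simp]: "pf \<in> Arr (TCat C T)" "Dom (TCat C T) pf = a" "Cod (TCat C T) pf = y"
    using tfun_comp[OF f p] by (simp_all add: pf_def)
  have "is_pullback (TCat C T) ?p pf (M.P pf) (M.R pf)" by (rule M.pr_pullback) simp_all
  then obtain n P10 P11 P20 P21 where P: "M.P pf = (n, (P10, P11), x)"
    and R: "M.R pf = (n, (P20, P21), a)"
    and pbP: "is_pullback C p0 (p0 \<cdot> f0) P10 P20" "is_pullback C p1 (p1 \<cdot> f1) P11 P21"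
    and n[simp]: "is_tcat C T n" and P1: "tfun n x P10 P11" and P2: "tfun n a P20 P21"
    by (elim TCat_pullbackE) (auto simp: pf_def)
  note [simp] = tmap_types[OF tfun_tmap[OF P1]] tmap_types[OF tfun_tmap[OF P2]]
  have pP: "?p \<cdot>\<^bsub>TCat C T\<^esub> M.P pf = (n, (p0 \<cdot> P10, p1 \<cdot> P11), y)" by (simp add: P)
  have "is_pullback (TCat C T) ?p (n, (p0 \<cdot> P10, p1 \<cdot> P11),
    y) (M.P (?p \<cdot>\<^bsub>TCat C T\<^esub> M.P pf)) (M.R (?p \<cdot>\<^bsub>TCat C T\<^esub> M.P pf))"
    using M.pr_pullback[of ?p "?p \<cdot>\<^bsub>TCat C T\<^esub> M.P pf"] tfun_comp[OF P1 p] p by (simp add: pP)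
  then obtain m r10 r11 r20 r21 where r1: "M.P (?p \<cdot>\<^bsub>TCat C T\<^esub> M.P pf) = (m, (r10, r11), x)"
    and r2: "M.R (?p \<cdot>\<^bsub>TCat C T\<^esub> M.P pf) = (m, (r20, r21), n)"
    and pbr: "is_pullback C p0 (p0 \<cdot> P10) r10 r20" "is_pullback C p1 (p1 \<cdot> P11) r11 r21"
    and m[simp]: "is_tcat C T m" and r1f: "tfun m x r10 r11" and r2f: "tfun m n r20 r21"
    by (elim TCat_pullbackE) auto
  note [simp] = tmap_types[OF tfun_tmap[OF r1f]] tmap_types[OF tfun_tmap[OF r2f]]
  have "X \<in> Arr (TCat C T)" "Dom (TCat C T) X = n" "Cod (TCat C T) X = a"
    using dat unfolding descent_datum_def pf by (simp_all add: P F)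
  then obtain \<xi>0 \<xi>1 where X: "X = (n, (\<xi>0, \<xi>1), a)" and \<xi>: "tfun n a \<xi>0 \<xi>1"
    by (elim TCat_ArrE) auto
  note \<xi>m = tfun_tmap[OF \<xi>]
  note [simp] = tmap_types[OF \<xi>m]
  have "F \<cdot>\<^bsub>TCat C T\<^esub> X = M.P pf" using dat unfolding descent_datum_def pf by simp
  then have f\<xi>: "f0 \<cdot> \<xi>0 = P10" "f1 \<cdot> \<xi>1 = P11" by (simp_all add: F X P)
  \<comment> \<open>The laws of the datum are to be read off componentwise, so the arrows occurring
    in them need components: \<open>N\<close> is the unit of the descent monad, and the pairs with
    \<open>rX\<close> and \<open>rR\<close> further on form the two sides of associativity.\<close>
  define N where "N = M.pair pf F (Idn (TCat C T) a)"
  have "?p \<cdot>\<^bsub>TCat C T\<^esub> F = pf \<cdot>\<^bsub>TCat C T\<^esub> Idn (TCat C T) a" by (simp add: pf_def F)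
  then have "N \<in> Arr (TCat C T)" "Dom (TCat C T) N = a" "Cod (TCat C T) N = n"
    and PN: "M.P pf \<cdot>\<^bsub>TCat C T\<^esub> N = F"
     "M.R pf \<cdot>\<^bsub>TCat C T\<^esub> N = Idn (TCat C T) a"
    unfolding N_def using M.pb_pair_simps[of ?p pf F "Idn (TCat C T) a"] tfun_id[of a] f p
      by (simp_all add: F P)
  then obtain n0 n1 where N: "N = (a, (n0, n1), n)" and nf: "tfun a n n0 n1"
    by (elim TCat_ArrE) auto
  note [simp] = tmap_types[OF tfun_tmap[OF nf]]
  have "X \<cdot>\<^bsub>TCat C T\<^esub> N = Idn (TCat C T) a" using dat unfolding descent_datum_def pf
    by (simp add: F N_def)
  then have \<xi>n: "\<xi>0 \<cdot> n0 = Idn C (ob0 a)" "\<xi>1 \<cdot> n1 = Idn C (ob1 a)" by (simp_all add: X N)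
  have Pn: "P10 \<cdot> n0 = f0" "P11 \<cdot> n1 = f1" "P20 \<cdot> n0 = Idn C (ob0 a)" "P21 \<cdot> n1 = Idn C (ob1 a)"
    using PN by (simp_all add: P R N F)
  define r where "r = (m, (r10, r11), x)"
  define rX where "rX = (m, (\<xi>0 \<cdot> r20, \<xi>1 \<cdot> r21), a)"
  define rR where "rR = (m, (P20 \<cdot> r20, P21 \<cdot> r21), a)"
  have rA: "r \<in> Arr (TCat C T)" "rX \<in> Arr (TCat C T)" "rR \<in> Arr (TCat C T)"
    using r1f tfun_comp[OF r2f \<xi>] tfun_comp[OF r2f P2] by (simp_all add: r_def rX_def rR_def)
  have cr: "p0 \<cdot> (P10 \<cdot> r20) = p0 \<cdot> r10" "p1 \<cdot> (P11 \<cdot> r21) = p1 \<cdot> r11"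
    using pullbackD(9)[OF pbr(1)] pullbackD(9)[OF pbr(2)] by simp_all
  have crP: "p0 \<cdot> (f0 \<cdot> P20) = p0 \<cdot> P10" "p1 \<cdot> (f1 \<cdot> P21) = p1 \<cdot> P11"
    using pullbackD(9)[OF pbP(1)] pullbackD(9)[OF pbP(2)] by simp_all
  have cr': "p0 \<cdot> (f0 \<cdot> (P20 \<cdot> r20)) = p0 \<cdot> r10" "p1 \<cdot> (f1 \<cdot> (P21 \<cdot> r21)) = p1 \<cdot> r11"
    using Cmp_reduce[OF crP(1), of r20] Cmp_reduce[OF crP(2), of r21] cr by simp_all
  have "?p \<cdot>\<^bsub>TCat C T\<^esub> r = pf \<cdot>\<^bsub>TCat C T\<^esub> rX"
    by (simp add: r_def rX_def pf_def cr f\<xi>[THEN Cmp_reduce])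
  moreover have "?p \<cdot>\<^bsub>TCat C T\<^esub> r = pf \<cdot>\<^bsub>TCat C T\<^esub> rR"
    by (simp add: r_def rR_def pf_def cr')
  ultimately have J: "M.pair pf r rX \<in> Arr (TCat C T)" "Dom (TCat C T) (M.pair pf r rX) = m"
    "Cod (TCat C T) (M.pair pf r rX) = n"
      "M.P pf \<cdot>\<^bsub>TCat C T\<^esub> M.pair pf r rX = r" "M.R pf \<cdot>\<^bsub>TCat C T\<^esub> M.pair pf r rX = rX"
    and L: "M.pair pf r rR \<in> Arr (TCat C T)" "Dom (TCat C T) (M.pair pf r rR) = m"
      "Cod (TCat C T) (M.pair pf r rR) = n"
      "M.P pf \<cdot>\<^bsub>TCat C T\<^esub> M.pair pf r rR = r" "M.R pf \<cdot>\<^bsub>TCat C T\<^esub> M.pair pf r rR = rR"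
    using M.pb_pair_simps[of ?p pf r rX] M.pb_pair_simps[of ?p pf r rR] rA p
      by (simp_all add: r_def rX_def rR_def P)
  obtain j0 j1 where j: "M.pair pf r rX = (m, (j0, j1), n)" and jf: "tfun m n j0 j1"
    using J(1-3) by (elim TCat_ArrE) auto
  obtain l0 l1 where l: "M.pair pf r rR = (m, (l0, l1), n)" and lf: "tfun m n l0 l1"
    using L(1-3) by (elim TCat_ArrE) auto
  note [simp] = tmap_types[OF tfun_tmap[OF jf]] tmap_types[OF tfun_tmap[OF lf]]
  have je: "P10 \<cdot> j0 = r10" "P11 \<cdot> j1 = r11" "P20 \<cdot> j0 = \<xi>0 \<cdot> r20" "P21 \<cdot> j1 = \<xi>1 \<cdot> r21"
    using J(4,5) unfolding j P R by (simp_all add: r_def rX_def)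
  have le: "P10 \<cdot> l0 = r10" "P11 \<cdot> l1 = r11" "P20 \<cdot> l0 = P20 \<cdot> r20" "P21 \<cdot> l1 = P21 \<cdot> r21"
    using L(4,5) unfolding l P R by (simp_all add: r_def rR_def)
  have "X \<cdot>\<^bsub>TCat C T\<^esub> M.pair pf r rX = X \<cdot>\<^bsub>TCat C T\<^esub> M.pair pf r rR"
  proof -
    have "X \<cdot>\<^bsub>TCat C T\<^esub> M.R (?p \<cdot>\<^bsub>TCat C T\<^esub> M.P pf) = rX" by (simp add: X r2 rX_def)
    moreover have "M.R pf \<cdot>\<^bsub>TCat C T\<^esub> M.R (?p \<cdot>\<^bsub>TCat C T\<^esub> M.P pf) = rR" by (simp add: R r2 rR_def)
    moreover have "M.P (?p \<cdot>\<^bsub>TCat C T\<^esub> M.P pf) = r" by (simp add: r1 r_def)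
    ultimately show ?thesis using dat unfolding descent_datum_def pf Let_def by metis
  qed
  then have ass: "\<xi>0 \<cdot> j0 = \<xi>0 \<cdot> l0" "\<xi>1 \<cdot> j1 = \<xi>1 \<cdot> l1" by (simp_all add: X j l)
  obtain act0 where act0: "descent_action C p0 f0 act0" "act0 P10 P20 = \<xi>0"
    "composable C p0 f0 P10 P20"
    by (rule descent_action_of_arrow[OF pbP(1) pbr(1), of \<xi>0 n0 j0 l0]) (simp_all add: f\<xi> Pn \<xi>n je
      le ass)
  obtain act1 where act1: "descent_action C p1 f1 act1" "act1 P11 P21 = \<xi>1"
    "composable C p1 f1 P11 P21"
    by (rule descent_action_of_arrow[OF pbP(2) pbr(2), of \<xi>1 n1 j1 l1]) (simp_all add: f\<xi> Pn \<xi>n je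
      le ass)
  obtain g0 k0 where pb0: "is_pullback C p0 g0 f0 k0" and k0: "k0 \<cdot> \<xi>0 = k0 \<cdot> P20"
    using ac(1) act0 unfolding actions_descend_def by metis
  obtain g1 k1 where pb1: "is_pullback C p1 g1 f1 k1" and k1: "k1 \<cdot> \<xi>1 = k1 \<cdot> P21"
    using ac(2) act1 unfolding actions_descend_def by metis
  have ek: "epi C k0" "epi C k1" and rk: "regular_epi C k0" "regular_epi C k1"
    using r e pb0 pb1 by (auto simp: stably_def)
  note [simp] = pullbackD(2,4)[OF pb0] pullbackD(2,4)[OF pb1]
  have [simp]: "Dom C k0 = ob0 a" "Cod C k0 = Dom C g0" "Cod C g0 = ob0 y"
      "Dom C k1 = ob1 a" "Cod C k1 = Dom C g1" "Cod C g1 = ob1 y"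
    using pullbackD(5,6,8)[OF pb0] pullbackD(5,6,8)[OF pb1] by simp_all
  note gk = pullbackD(9)[OF pb0, symmetric] pullbackD(9)[OF pb1, symmetric]
  note P2m = tfun_tmap[OF P2]
  note kr = k0[THEN Cmp_reduce] k1[THEN Cmp_reduce] k0[THEN TA_reduce] k0[THEN TA_reduce, THEN
    Cmp_reduce]
  note [simp] = k0 k1 kr
  note leftD[simp] = tmap_left[OF \<xi>m] tmap_left[OF P2m] tfun_left[OF \<xi>] tfun_left[OF P2]
  \<comment> \<open>Equivariance of the structure maps is functoriality of \<open>\<xi>\<close> and
    of the second projection: \<open>k0 d0 \<xi>1 = k0 \<xi>0 d0 = k0 P20 d0 = k0 d0 P21\<close>.
    For \<open>d1\<close> the middle equality is the image under \<open>T\<close> of the invariance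
    of \<open>k0\<close>.\<close>
  obtain e0 where e0: "e0 \<in> Arr C" "Dom C e0 = Dom C g1" "Cod C e0 = Dom C g0" "e0 \<cdot> k1 = k0 \<cdot> d0 a"
    by (rule regular_epi_factor_action[OF rk(2) pb1 pbP(2), of \<xi>1 "k0 \<cdot> d0 a"]) (simp_all add: f\<xi>)
  obtain e1 where e1: "e1 \<in> Arr C" "Dom C e1 = Dom C g1" "Cod C e1 = TO (Dom C g0)"
    "e1 \<cdot> k1 = TA k0 \<cdot> d1 a"
    by (rule regular_epi_factor_action[OF rk(2) pb1 pbP(2), of \<xi>1 "TA k0 \<cdot> d1 a"]) (simp_all add:
      f\<xi>)
  obtain sc where sc: "sc \<in> Arr C" "Dom C sc = Dom C g0" "Cod C sc = Dom C g1" "sc \<cdot> k0 = k1 \<cdot> s0 a"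
    by (rule regular_epi_factor_action[OF rk(1) pb0 pbP(1), of \<xi>0 "k1 \<cdot> s0 a"]) (simp_all add: f\<xi>)
  \<comment> \<open>The composition is deferred again: it descends from
    \<open>k1 \<cdot> cm a\<close> along the map between 2-chains, whose target is formed from
    \<open>c'\<close>.\<close>
  define c' where "c' = \<lparr>ob0 = Dom C g0, ob1 = Dom C g1, d1 = e1, d0 = e0, s0 = sc, cm = undefined\<rparr>"
  have tc': "tgraph c'" by (rule tgraphI) (use e0 e1 in \<open>simp_all add: c'_def\<close>)
  then have km': "tmap a c' k0 k1" using e0 e1 by (simp add: tmap_def in_hom_iff) (simp add: c'_def)
  have c'[simp]: "s0 c' = sc" "d0 c' = e0" "d1 c' = e1" by (simp_all add: c'_def)
  have o: "ob0 c' = Dom C g0" "ob1 c' = Dom C g1" by (simp_all add: c'_def)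
  note [simp] = gk gk[THEN Cmp_reduce] gk[THEN TA_reduce] gk(1)[THEN TA_reduce, THEN Cmp_reduce]
    e0 e1
  note [simp] = e0(4)[THEN Cmp_reduce] e1(4)[THEN Cmp_reduce]
  note leftp = tmap_left[OF pm] tmap_left[OF fm] tfun_left[OF p] tfun_left[OF f]
  have gm': "tmap c' y g0 g1"
    unfolding tmap_def
  proof (intro conjI)
    show "d0 y \<cdot> g1 = g0 \<cdot> d0 c'" by (rule epiD[OF ek(2)]) (simp_all add: leftp)
    show "d1 y \<cdot> g1 = TA g0 \<cdot> d1 c'" by (rule epiD[OF ek(2)]) (simp_all add: leftp)
  qed (simp_all add: in_hom_iff tc' o)
  note [simp] = tmap_types[OF km'] tmap_types[OF gm']
  have pb2: "is_pullback C (ind2 x y p1) (ind2 c' y g1) (ind2 a x f1) (ind2 a c' k1)"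
    by (rule chains2_square_pullback[OF pm gm' fm km' pb0 pb1])
  have ek2: "epi C (ind2 a c' k1)" and rk2: "regular_epi C (ind2 a c' k1)"
    using r e pb2 by (auto simp: stably_def)
  \<comment> \<open>The action extends to 2-chains: the pullback underlying \<open>n\<close> passes
    to 2-chains as well, with \<open>ind2 n a \<xi>1\<close> as the action and
    \<open>ind2 n a P21\<close> as the second projection.\<close>
  have pbP2: "is_pullback C (ind2 x y p1) (ind2 x y p1 \<cdot> ind2 a x f1) (ind2 n x P11) (ind2 n a P21)"
    using chains2_square_pullback[OF pm tmap_comp(1)[OF fm pm] tfun_tmap[OF P1] P2m pbP]
      tmap_comp(2)[OF fm pm] by simp
  obtain cc where cc: "cc \<in> Arr C" "Dom C cc = chains2 C T c'" "Cod C cc = Dom C g1"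
    "cc \<cdot> ind2 a c' k1 = k1 \<cdot> cm a"
  proof (rule regular_epi_factor_action[OF rk2 pb2 pbP2, of "ind2 n a \<xi>1" "k1 \<cdot> cm a"])
    show "ind2 a x f1 \<cdot> ind2 n a \<xi>1 = ind2 n x P11" using tmap_comp(2)[OF \<xi>m fm] by (simp add: f\<xi>)
    show "ind2 a c' k1 \<cdot> ind2 n a \<xi>1 = ind2 a c' k1 \<cdot> ind2 n a P21"
      using tmap_comp(2)[OF \<xi>m km'] tmap_comp(2)[OF P2m km'] by simp
  qed simp_all
  define c where "c = c'\<lparr>cm := cc\<rparr>"
  have cs: "ob0 c = ob0 c'" "ob1 c = ob1 c'" "s0 c = sc" "cm c = cc"
    "chains2 C T c = chains2 C T c'" "tgraph c"
    using tc' by (simp_all add: c_def)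
  have sc_c: "tstruct c" unfolding tstruct_def in_hom_iff using cs sc cc by simp
  have km: "tmap a c k0 k1" and gm: "tmap c y g0 g1" using km' gm' by (simp_all add: c_def)
  have ind: "ind2 a c k1 = ind2 a c' k1" by (simp add: c_def)
  have k: "tfun a c k0 k1"
    using km sc_c cs sc cc ind by (simp add: tfun_def)
  have pb2: "is_pullback C (ind2 x y p1) (ind2 c y g1) (ind2 a x f1) (ind2 a c k1)"
    by (rule chains2_square_pullback[OF pm gm fm km pb0 pb1])
  have pb3: "is_pullback C (ind3 x y p1) (ind3 c y g1) (ind3 a x f1) (ind3 a c k1)"
    by (rule chains3_square_pullback[OF pm gm fm km pb0 pb1])
  have ek2: "epi C (ind2 a c k1)" and ek3: "epi C (ind3 a c k1)"
    using e pb2 pb3 by (auto simp: stably_def)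
  have gind: "ind2 c y g1 \<cdot> ind2 a c k1 = ind2 x y p1 \<cdot> ind2 a x f1" using pullbackD(9)[OF pb2]
    by simp
  have pc: "tprecat c" by (rule tprecat_if_epi[OF k a ek ek2])
  have c: "is_tcat C T c" by (rule is_tcat_if_epi[OF k pc a ek(2) ek3])
  \<comment> \<open>\<open>g\<close> composed with \<open>k\<close> is the functor \<open>p\<close>
    composed with \<open>f\<close>, and \<open>k\<close> is epimorphic on objects and on 2-chains;
    so \<open>g\<close> preserves identities and composition.\<close>
  have g: "tfun c y g0 g1"
    by (rule tfun_if_epi[OF k _ gm ek(1) ek2]) (use tfun_comp[OF f p] gk in simp_all)
  have "is_pullback (TCat C T) ?p (c, (g0, g1), y) F (a, (k0, k1), c)"
    unfolding F by (rule TCat_pullbackI[OF a xy(1) c xy(2) p g f k pb0 pb1])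
  moreover have "(a, (k0, k1), c) \<cdot>\<^bsub>TCat C T\<^esub> X = (a, (k0, k1), c) \<cdot>\<^bsub>TCat C T\<^esub> M.R pf"
    by (simp add: X R)
  ultimately show ?thesis unfolding pf by blast
qed

end

theorem theorem4p4p3:
  fixes V :: "('o, 'a) cat" and T :: "('o, 'a) monad"
    and x y :: "('o, 'a) tcat" and p0 p1 :: 'a
  assumes "category V" and "has_finite_limits V"
    and "is_monad V T" and "preserves_pullbacks V V (endo T)"
    and "is_tcat V T x" and "is_tcat V T y" and "is_tfunctor V T x y (p0, p1)"
    and "effective_descent V p1"
    and "descent V (induced2 V T x y p1)"
    and "almost_descent V (induced3 V T x y p1)"
  shows "effective_descent (TCat V T) (x, (p0, p1), y)"
proof -
  have pbs: "has_pullbacks V" using assms(8) by (simp add: effective_descent_def)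
  interpret tcat_setting V T
    by (rule tcat_setting.intro[OF assms(3) pb_category.intro[OF assms(1)
      pb_category_axioms.intro[OF pbs]]
      tcat_setting_axioms.intro[OF assms(4)]])
  note x = assms(5) and y = assms(6)
  have p: "tfun x y p0 p1" using assms(7) x y by (simp add: is_tfunctor_iff)
  note [simp] = tmap_types[OF tfun_tmap[OF p]]
  have arr: "pb_arrow V q" if "q \<in> Arr V" for q
    by (rule pb_arrow.intro[OF pb_category_axioms pb_arrow_axioms.intro[OF that]])
  interpret q1: pb_arrow V p1 by (rule arr) simp
  interpret q2: pb_arrow V "ind2 x y p1" by (rule arr) simp
  interpret q3: pb_arrow V "ind3 x y p1" by (rule arr) simp
  note ed = equivalence_functorD[OF assms(8)[unfolded effective_descent_def, THEN conjunct2, THEN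
    conjunct2, THEN conjunct2]]
  have e1: "stably epi V p1" by (rule q1.faithful_imp_stably_epi[OF assms(2) ed(2)])
  have r1: "stably regular_epi V p1" by (rule q1.full_imp_stably_regular_epi[OF assms(2) ed(3)])
  have a1: "actions_descend V p1" by (rule q1.ess_surj_imp_actions_descend[OF ed(4)])
  have e2: "stably epi V (ind2 x y p1)"
    using assms(9) by (intro q2.faithful_imp_stably_epi[OF assms(2)]) (simp add: descent_def)
  have r2: "stably regular_epi V (ind2 x y p1)"
    using assms(9) by (intro q2.full_imp_stably_regular_epi[OF assms(2)]) (simp add: descent_def)
  have e3: "stably epi V (ind3 x y p1)"
    using assms(10) by (intro q3.faithful_imp_stably_epi[OF assms(2)]) (simp add:
      almost_descent_def)
  interpret R: retract_arrow V p0 p1 "s0 x" "s0 y" "d0 x" "d0 y"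
    using x y tmap_left0(1)[OF tfun_tmap[OF p]] tfun_left(1)[OF p] by unfold_locales simp_all
  have e0: "stably epi V p0" by (rule R.stably_epi[OF e1])
  have r0: "stably regular_epi V p0" by (rule R.stably_regular_epi[OF e1 r1])
  have a0: "actions_descend V p0" by (rule R.actions_descend[OF a1])
  let ?p = "(x, (p0, p1), y)"
  have pA: "?p \<in> Arr (TCat V T)" using x y p by simp
  interpret M: pb_arrow "TCat V T" ?p
    by (rule pb_arrow.intro[OF TCat_pb_category pb_arrow_axioms.intro[OF pA]])
  have E: "stably epi (TCat V T) ?p" by (rule TCat_stably_epi[OF e0 e1])
  have R: "stably regular_epi (TCat V T) ?p" by (rule TCat_stably_regular_epi[OF r0 r1 e0 e1 e2])
  have "equivalence_functor (slice (TCat V T) (Cod (TCat V T) ?p)) (descent_Alg (TCat V T) ?p)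
      (descent_comparison (TCat V T) ?p)"
    by (rule equivalence_functorI[OF M.stably_epi_imp_faithful[OF E]
      M.stably_regular_epi_imp_full[OF E R]
      M.data_descend_imp_ess_surj[OF TCat_data_descend[OF x y p a0 a1 r0 r1 r2 e0 e1 e2 e3]]])
  then show ?thesis
    unfolding effective_descent_def using TCat_category TCat_has_pullbacks pA by blast
qed

end
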